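(* Let $\Gamma$ be a closed curve in $\mathbb C$. Then the smallest spectral value of the Laplacian on the hypersurface $(M^3_{A\Gamma},h_t)$ satisfies $\mu_0(M^3_{A\Gamma})\le t^{-2}$, where $t\ne0$ and $A\in U(2)$.
   Context: Eguchi--Hanson space: $T^*\mathbb P^1(\mathbb C)$ is realized as $H^2=\{(\alpha,\beta,\gamma)\in(\mathbb C^2\setminus\{0\})\times\mathbb C\}/\sim$, where $(\alpha,\beta,\gamma)\sim(A\alpha,A\beta,\gamma/A^2)$ for $A\in\mathbb C^*$; the projection is $p([\alpha,\beta,\gamma])=\alpha/\beta\in\mathbb C\cup\{\infty\}=\mathbb P^1(\mathbb C)$. The complement of the zero section $\{\gamma=0\}$ is identified with $(\mathbb C^2\setminus\{0\})/\{\pm1\}$ by $[\alpha,\beta,\gamma]\mapsto \pm(z_1,z_2)=\pm(\alpha\sqrt\gamma,\beta\sqrt\gamma)$. Put $u_1=|z_1|^2+|z_2|^2$ and $f_t=\sqrt{u_1^2+t^4}+t^2\log\frac{u_1}{\sqrt{u_1^2+t^4}+t^2}$. The form $\omega_t=i\partial\bar\partial f_t$ extends to a Kähler form on $H^2$, and $g_t(X,Y)=\omega_t(X,JY)$ is the Eguchi--Hanson metric ($J$ the complex structure). For a smooth curve $\Gamma$, $M^3_\Gamma=p^{-1}(\Gamma)\subset H^2$ with the metric $h_t$ induced by $g_t$; for closed $\Gamma$ and $t\ne0$ it is complete. $U(2)$ acts on $\mathbb C\cup\{\infty\}$ by Möbius transforms $z\mapsto\frac{az+b}{cz+d}$. $\Delta=-\mathrm{div}\,\mathrm{grad}$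 is the scalar Laplacian on $L^2$ with domain the compactly supported smooth functions (essentially self-adjoint), and $\mu_0$ denotes the infimum of the spectrum of its closure. *)

theory Defs
  imports "HOL-Analysis.Analysis"
begin

section \<open>Smooth functions\<close>

primrec Ck_on :: "nat \<Rightarrow> 'a::euclidean_space set \<Rightarrow> ('a \<Rightarrow> 'b::real_normed_vector) \<Rightarrow> bool" where
  "Ck_on 0 S f \<longleftrightarrow> continuous_on S f"
| "Ck_on (Suc k) S f \<longleftrightarrow>
     (\<forall>x\<in>S. f differentiable (at x)) \<and> (\<forall>v. Ck_on k S (\<lambda>x. frechet_derivative f (at x) v))"

text \<open>Only used for open \<open>S\<close>.\<close>

definition smooth_on :: "'a::euclidean_space set \<Rightarrow> ('a \<Rightarrow> 'b::real_normed_vector) \<Rightarrow> bool" where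
  "smooth_on S f \<longleftrightarrow> (\<forall>k. Ck_on k S f)"

section \<open>Riemannian manifolds given by local parametrizations\<close>

text \<open>
  A Riemannian \<open>n\<close>-manifold is presented by its underlying set \<open>M\<close> and a set \<open>\<A>\<close> of triples
  \<open>(U, \<psi>, G)\<close>, where \<open>\<psi>\<close> parametrizes an open part of \<open>M\<close> by the open set \<open>U\<close> and \<open>G x\<close> is the
  matrix of the metric at \<open>\<psi> x\<close> with respect to the coordinate frame.
\<close>

type_synonym ('m, 'n) rparam = "(real^'n) set \<times> (real^'n \<Rightarrow> 'm) \<times> (real^'n \<Rightarrow> real^'n^'n)"

definition partial_deriv :: "'n::finite \<Rightarrow> (real^'n \<Rightarrow> 'b::real_normed_vector) \<Rightarrow> real^'n \<Rightarrow> 'b" where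
  "partial_deriv i f x = frechet_derivative f (at x) (axis i 1)"

definition vol_density :: "(real^'n \<Rightarrow> real^'n^'n) \<Rightarrow> real^'n \<Rightarrow> real" where
  "vol_density G x = sqrt (det (G x))"

definition grad_coord :: "(real^'n \<Rightarrow> real^'n^'n) \<Rightarrow> (real^'n \<Rightarrow> complex) \<Rightarrow> real^'n \<Rightarrow> complex^'n" where
  "grad_coord G f x = (\<chi> i. \<Sum>j\<in>UNIV. of_real (matrix_inv (G x) $ i $ j) * partial_deriv j f x)"

definition div_coord :: "(real^'n \<Rightarrow> real^'n^'n) \<Rightarrow> (real^'n \<Rightarrow> complex^'n) \<Rightarrow> real^'n \<Rightarrow> complex" where
  "div_coord G X x =
     (\<Sum>i\<in>UNIV. partial_deriv i (\<lambda>y. of_real (vol_density G y) * X y $ i) x) / of_real (vol_density G x)"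

definition smooth_fun :: "('m, 'n::finite) rparam set \<Rightarrow> ('m \<Rightarrow> complex) \<Rightarrow> bool" where
  "smooth_fun \<A> \<phi> \<longleftrightarrow> (\<forall>(U, \<psi>, G)\<in>\<A>. smooth_on U (\<phi> \<circ> \<psi>))"

text \<open>Functions on \<open>M\<close> are total functions whose values off \<open>M\<close> are irrelevant.\<close>

definition test_fun ::
    "'m::topological_space set \<Rightarrow> ('m, 'n::finite) rparam set \<Rightarrow> ('m \<Rightarrow> complex) \<Rightarrow> bool" where
  "test_fun M \<A> \<phi> \<longleftrightarrow>
     smooth_fun \<A> \<phi> \<and> (\<exists>K. compact K \<and> K \<subseteq> M \<and> (\<forall>p\<in>M - K. \<phi> p = 0))"

text \<open>
  The graph of \<open>\<Delta> = - div grad\<close> on compactly supported smooth functions. The local expressions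
  agree on overlaps, so asking for them in every parametrization determines \<open>\<Delta> \<phi>\<close> on \<open>M\<close>.
\<close>

definition laplacian ::
    "'m::topological_space set \<Rightarrow> ('m, 'n::finite) rparam set \<Rightarrow> (('m \<Rightarrow> complex) \<times> ('m \<Rightarrow> complex)) set" where
  "laplacian M \<A> = {(\<phi>, v). test_fun M \<A> \<phi> \<and>
     (\<forall>(U, \<psi>, G)\<in>\<A>. \<forall>x\<in>U. v (\<psi> x) = - div_coord G (grad_coord G (\<phi> \<circ> \<psi>)) x)}"

text \<open>The conditions determine the measure when \<open>\<A>\<close> covers a second countable \<open>M\<close>.\<close>

definition riemannian_volume ::
    "'m::topological_space set \<Rightarrow> ('m, 'n::finite) rparam set \<Rightarrow> 'm measure" where
  "riemannian_volume M \<A> = (SOME \<nu>. sets \<nu> = sets (restrict_space borel M) \<and>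
     (\<forall>(U, \<psi>, G)\<in>\<A>. \<forall>E\<in>sets borel. E \<subseteq> U \<longrightarrow>
        emeasure \<nu> (\<psi> ` E) = (\<integral>\<^sup>+x\<in>E. ennreal (vol_density G x) \<partial>lborel)))"

section \<open>Unbounded operators on complex \<open>L\<^sup>2\<close>\<close>

text \<open>Elements of \<open>L\<^sup>2\<close> are represented by functions, equality being equality almost everywhere;
  operators are represented by their graphs.\<close>

definition L2 :: "'m measure \<Rightarrow> ('m \<Rightarrow> complex) set" where
  "L2 \<nu> = {f \<in> borel_measurable \<nu>. integrable \<nu> (\<lambda>x. (cmod (f x))\<^sup>2)}"

definition L2norm :: "'m measure \<Rightarrow> ('m \<Rightarrow> complex) \<Rightarrow> real" where
  "L2norm \<nu> f = sqrt (\<integral>x. (cmod (f x))\<^sup>2 \<partial>\<nu>)"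

definition L2_closure ::
    "'m measure \<Rightarrow> (('m \<Rightarrow> complex) \<times> ('m \<Rightarrow> complex)) set \<Rightarrow> (('m \<Rightarrow> complex) \<times> ('m \<Rightarrow> complex)) set" where
  "L2_closure \<nu> T = {(u, v) \<in> L2 \<nu> \<times> L2 \<nu>.
     \<exists>f h. (\<forall>n. (f n, h n) \<in> T \<inter> (L2 \<nu> \<times> L2 \<nu>)) \<and>
       (\<lambda>n. L2norm \<nu> (\<lambda>x. f n x - u x)) \<longlonglongrightarrow> 0 \<and>
       (\<lambda>n. L2norm \<nu> (\<lambda>x. h n x - v x)) \<longlonglongrightarrow> 0}"

text \<open>\<open>T - z\<close> maps onto \<open>L\<^sup>2\<close>, and the estimate says that it is injective with bounded inverse.\<close>

definition resolvent_set ::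
    "'m measure \<Rightarrow> (('m \<Rightarrow> complex) \<times> ('m \<Rightarrow> complex)) set \<Rightarrow> complex set" where
  "resolvent_set \<nu> T = {z.
     (\<forall>w\<in>L2 \<nu>. \<exists>(u, v)\<in>T. AE x in \<nu>. v x - z * u x = w x) \<and>
     (\<exists>C. \<forall>(u, v)\<in>T. L2norm \<nu> u \<le> C * L2norm \<nu> (\<lambda>x. v x - z * u x))}"

definition L2_spectrum ::
    "'m measure \<Rightarrow> (('m \<Rightarrow> complex) \<times> ('m \<Rightarrow> complex)) set \<Rightarrow> complex set" where
  "L2_spectrum \<nu> T = - resolvent_set \<nu> T"

text \<open>The infimum is taken in the extended reals, so that it is \<open>\<infinity>\<close> for an empty spectrum.\<close>

definition mu0 :: "'m::topological_space set \<Rightarrow> ('m, 'n::finite) rparam set \<Rightarrow> ereal" where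
  "mu0 M \<A> = (let \<nu> = riemannian_volume M \<A> in
     INF r\<in>{r::real. of_real r \<in> L2_spectrum \<nu> (L2_closure \<nu> (laplacian M \<A>))}. ereal r)"

section \<open>The space \<open>H\<^sup>2\<close>\<close>

type_synonym C3 = "complex \<times> complex \<times> complex"

definition homog :: "C3 set" where
  "homog = {(\<alpha>, \<beta>, \<gamma>). (\<alpha>, \<beta>) \<noteq> (0, 0)}"

fun H2_rel :: "C3 \<Rightarrow> C3 \<Rightarrow> bool" where
  "H2_rel (\<alpha>, \<beta>, \<gamma>) (\<alpha>', \<beta>', \<gamma>') \<longleftrightarrow> (\<alpha>, \<beta>) \<noteq> (0, 0) \<and>
     (\<exists>a. a \<noteq> 0 \<and> \<alpha>' = a * \<alpha> \<and> \<beta>' = a * \<beta> \<and> \<gamma>' = \<gamma> / a\<^sup>2)"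

quotient_type H2 = C3 / partial: H2_rel
proof (rule part_equivpI)
  have "H2_rel (1, 0, 0) (1, 0, 0)"
    by (auto intro!: exI[of _ 1])
  then show "\<exists>x. H2_rel x x" ..
  show "symp H2_rel"
  proof (rule sympI)
    fix x y assume "H2_rel x y"
    obtain \<alpha> \<beta> \<gamma> \<alpha>' \<beta>' \<gamma>' where xy: "x = (\<alpha>, \<beta>, \<gamma>)" "y = (\<alpha>', \<beta>', \<gamma>')"
      by (cases x, cases y)
    with \<open>H2_rel x y\<close> obtain a where
      "(\<alpha>, \<beta>) \<noteq> (0, 0)" "a \<noteq> 0" "\<alpha>' = a * \<alpha>" "\<beta>' = a * \<beta>" "\<gamma>' = \<gamma> / a\<^sup>2"
      by auto
    then show "H2_rel y x"
      unfolding xy by (auto intro!: exI[of _ "inverse a"] simp: field_simps)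
  qed
  show "transp H2_rel"
  proof (rule transpI)
    fix x y z assume *: "H2_rel x y" "H2_rel y z"
    obtain \<alpha> \<beta> \<gamma> \<alpha>' \<beta>' \<gamma>' \<alpha>'' \<beta>'' \<gamma>'' where
      xyz: "x = (\<alpha>, \<beta>, \<gamma>)" "y = (\<alpha>', \<beta>', \<gamma>')" "z = (\<alpha>'', \<beta>'', \<gamma>'')"
      by (cases x, cases y, cases z)
    from * obtain a b where
      "(\<alpha>, \<beta>) \<noteq> (0, 0)" "a \<noteq> 0" "\<alpha>' = a * \<alpha>" "\<beta>' = a * \<beta>" "\<gamma>' = \<gamma> / a\<^sup>2"
      "b \<noteq> 0" "\<alpha>'' = b * \<alpha>'" "\<beta>'' = b * \<beta>'" "\<gamma>'' = \<gamma>' / b\<^sup>2"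
      unfolding xyz by auto
    then show "H2_rel x z"
      unfolding xyz by (auto intro!: exI[of _ "b * a"] simp: power_mult_distrib field_simps)
  qed
qed

text \<open>The quotient map is \<^const>\<open>abs_H2\<close>, restricted to \<^const>\<open>homog\<close>; \<open>H\<^sup>2\<close> carries the
  quotient topology.\<close>

instantiation H2 :: topological_space
begin

definition open_H2 :: "H2 set \<Rightarrow> bool" where
  "open_H2 S \<longleftrightarrow> open {v \<in> homog. abs_H2 v \<in> S}"

instance
proof
  have "homog = - ({0} \<times> {0} \<times> UNIV)"
    by (auto simp: homog_def)
  moreover have "closed ({0::complex} \<times> {0::complex} \<times> (UNIV :: complex set))"
    by (intro closed_Times) auto
  ultimately have "open homog"
    by (metis open_Compl)
  then show "open (UNIV :: H2 set)"
    by (simp add: open_H2_def)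
next
  fix S T :: "H2 set" assume "open S" "open T"
  then have "open ({v \<in> homog. abs_H2 v \<in> S} \<inter> {v \<in> homog. abs_H2 v \<in> T})"
    unfolding open_H2_def by (rule open_Int)
  also have "{v \<in> homog. abs_H2 v \<in> S} \<inter> {v \<in> homog. abs_H2 v \<in> T} = {v \<in> homog. abs_H2 v \<in> S \<inter> T}"
    by auto
  finally show "open (S \<inter> T)"
    unfolding open_H2_def .
next
  fix K :: "H2 set set" assume "\<forall>S\<in>K. open S"
  then have "open (\<Union>S\<in>K. {v \<in> homog. abs_H2 v \<in> S})"
    unfolding open_H2_def by blast
  also have "(\<Union>S\<in>K. {v \<in> homog. abs_H2 v \<in> S}) = {v \<in> homog. abs_H2 v \<in> \<Union>K}"
    by auto
  finally show "open (\<Union>K)"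
    unfolding open_H2_def .
qed

end

datatype riemann_sphere = Fin complex | Infty

lift_definition proj :: "H2 \<Rightarrow> riemann_sphere" is
  "\<lambda>(\<alpha>, \<beta>, \<gamma>). if \<beta> = 0 then Infty else Fin (\<alpha> / \<beta>)"
  by auto

text \<open>\<open>u\<^sub>1 = |z\<^sub>1|\<^sup>2 + |z\<^sub>2|\<^sup>2\<close> with \<open>(z\<^sub>1, z\<^sub>2) = (\<alpha> \<surd>\<gamma>, \<beta> \<surd>\<gamma>)\<close>.\<close>

lift_definition u1 :: "H2 \<Rightarrow> real" is
  "\<lambda>(\<alpha>, \<beta>, \<gamma>). (cmod (\<alpha> * csqrt \<gamma>))\<^sup>2 + (cmod (\<beta> * csqrt \<gamma>))\<^sup>2"
proof -
  have *: "(cmod (x * csqrt y))\<^sup>2 = (cmod x)\<^sup>2 * cmod y" for x y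
    by (simp add: norm_mult power_mult_distrib flip: norm_power)
  fix x y assume "H2_rel x y"
  then show "?thesis x y"
    by (cases x; cases y)
      (auto simp: * norm_mult norm_divide norm_power power_mult_distrib simp del: eq_divide_eq divide_eq_eq)
qed

definition eh_potential :: "real \<Rightarrow> H2 \<Rightarrow> real" where
  "eh_potential t x = sqrt ((u1 x)\<^sup>2 + t^4) + t\<^sup>2 * ln (u1 x / (sqrt ((u1 x)\<^sup>2 + t^4) + t\<^sup>2))"

section \<open>The Eguchi--Hanson metric\<close>

definition cJ :: "C3 \<Rightarrow> C3" where
  "cJ = (\<lambda>(a, b, c). (\<i> * a, \<i> * b, \<i> * c))"

text \<open>\<open>wirt X F = \<Sum>\<^sub>j X\<^sub>j \<partial>F/\<partial>z\<^sub>j\<close> and \<open>wirt_bar X F = \<Sum>\<^sub>j cnj X\<^sub>j \<partial>F/\<partial>(cnj z\<^sub>j)\<close> for a constant vector \<open>X\<close>.\<close>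

definition wirt :: "C3 \<Rightarrow> (C3 \<Rightarrow> complex) \<Rightarrow> C3 \<Rightarrow> complex" where
  "wirt X F v = (frechet_derivative F (at v) X - \<i> * frechet_derivative F (at v) (cJ X)) / 2"

definition wirt_bar :: "C3 \<Rightarrow> (C3 \<Rightarrow> complex) \<Rightarrow> C3 \<Rightarrow> complex" where
  "wirt_bar X F v = (frechet_derivative F (at v) X + \<i> * frechet_derivative F (at v) (cJ X)) / 2"

text \<open>The two-form \<open>i del delbar F = i \<Sum>\<^sub>j\<^sub>k \<partial>\<^sup>2F/\<partial>z\<^sub>j\<partial>(cnj z\<^sub>k) dz\<^sub>j \<and> d(cnj z\<^sub>k)\<close>, where
  \<open>(\<xi> \<and> \<eta>)(X, Y) = \<xi>(X) \<eta>(Y) - \<xi>(Y) \<eta>(X)\<close>.\<close>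

definition i_del_delbar :: "(C3 \<Rightarrow> complex) \<Rightarrow> C3 \<Rightarrow> C3 \<Rightarrow> C3 \<Rightarrow> complex" where
  "i_del_delbar F v X Y = \<i> * (wirt X (wirt_bar Y F) v - wirt Y (wirt_bar X F) v)"

text \<open>
  The quotient map \<open>q = abs_H2\<close> is a holomorphic submersion, so a tangent vector of \<open>H\<^sup>2\<close> at \<open>q v\<close> is
  the image of some \<open>X \<in> \<complex>\<^sup>3\<close>, unique up to the tangent line of the orbit through \<open>v\<close>, and forms on \<open>H\<^sup>2\<close>
  are faithfully represented by their pullbacks. Thus \<open>eh_form t v X Y = \<omega>\<^sub>t(dq X, dq Y)\<close>: off the
  zero section \<open>q\<^sup>*(i del delbar f) = i del delbar (f \<circ> q)\<close>, and on it \<open>\<omega>\<^sub>t\<close> is the continuous extension.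
\<close>

definition eh_form :: "real \<Rightarrow> C3 \<Rightarrow> C3 \<Rightarrow> C3 \<Rightarrow> real" where
  "eh_form t v X Y =
     (let \<omega> = (\<lambda>v. Re (i_del_delbar (\<lambda>v. of_real (eh_potential t (abs_H2 v))) v X Y));
          N = {(\<alpha>, \<beta>, \<gamma>) \<in> homog. \<gamma> \<noteq> 0}
      in if v \<in> N then \<omega> v else Lim (at v within N) \<omega>)"

definition eh_metric :: "real \<Rightarrow> C3 \<Rightarrow> C3 \<Rightarrow> C3 \<Rightarrow> real" where
  "eh_metric t v X Y = eh_form t v X (cJ Y)"

section \<open>Hypersurfaces in \<open>H\<^sup>2\<close>\<close>

text \<open>Tangent line of the orbit \<open>a \<mapsto> (a\<alpha>, a\<beta>, \<gamma>/a\<^sup>2)\<close> at \<open>a = 1\<close>, that is the kernel of \<open>dq\<close>.\<close>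

fun orbit_tangent :: "C3 \<Rightarrow> C3 set" where
  "orbit_tangent (\<alpha>, \<beta>, \<gamma>) = range (\<lambda>a. (a * \<alpha>, a * \<beta>, - 2 * a * \<gamma>))"

text \<open>\<open>q \<circ> \<Psi>\<close> is a smooth immersion and a homeomorphism of \<open>U\<close> onto an open subset of \<open>M\<close>. Since \<open>q\<close>
  has smooth local sections, every smooth map into \<open>H\<^sup>2\<close> is locally of this form.\<close>

definition local_param :: "H2 set \<Rightarrow> (real^3) set \<Rightarrow> (real^3 \<Rightarrow> C3) \<Rightarrow> bool" where
  "local_param M U \<Psi> \<longleftrightarrow> open U \<and> smooth_on U \<Psi> \<and> \<Psi> ` U \<subseteq> homog \<and>
     (\<forall>x\<in>U. \<forall>v. v \<noteq> 0 \<longrightarrow> frechet_derivative \<Psi> (at x) v \<notin> orbit_tangent (\<Psi> x)) \<and>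
     openin (top_of_set M) ((abs_H2 \<circ> \<Psi>) ` U) \<and>
     (\<exists>\<kappa>. homeomorphism U ((abs_H2 \<circ> \<Psi>) ` U) (abs_H2 \<circ> \<Psi>) \<kappa>)"

definition induced_metric :: "real \<Rightarrow> (real^3 \<Rightarrow> C3) \<Rightarrow> real^3 \<Rightarrow> real^3^3" where
  "induced_metric t \<Psi> x = (\<chi> i j. eh_metric t (\<Psi> x) (partial_deriv i \<Psi> x) (partial_deriv j \<Psi> x))"

text \<open>The hypersurface \<open>M\<close> with the metric \<open>h\<^sub>t\<close> induced by \<open>g\<^sub>t\<close>.\<close>

definition eh_hypersurface :: "real \<Rightarrow> H2 set \<Rightarrow> (H2, 3) rparam set" where
  "eh_hypersurface t M = {(U, abs_H2 \<circ> \<Psi>, induced_metric t \<Psi>) | U \<Psi>. local_param M U \<Psi>}"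

definition M3 :: "riemann_sphere set \<Rightarrow> H2 set" where
  "M3 \<Gamma> = proj -` \<Gamma>"

section \<open>Closed curves and the action of \<open>U(2)\<close>\<close>

definition smooth_closed_curve :: "complex set \<Rightarrow> bool" where
  "smooth_closed_curve \<Gamma> \<longleftrightarrow> (\<exists>(c :: real \<Rightarrow> complex) l. l > 0 \<and> smooth_on UNIV c \<and>
     (\<forall>s. c (s + l) = c s) \<and> inj_on c {0..<l} \<and>
     (\<forall>s. vector_derivative c (at s) \<noteq> 0) \<and> \<Gamma> = range c)"

definition U2 :: "(complex^2^2) set" where
  "U2 = {A. (\<chi> i j. cnj (A $ j $ i)) ** A = mat 1}"

fun moebius_map :: "complex^2^2 \<Rightarrow> riemann_sphere \<Rightarrow> riemann_sphere" where
  "moebius_map A (Fin z) = (if A$2$1 * z + A$2$2 = 0 then Infty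
     else Fin ((A$1$1 * z + A$1$2) / (A$2$1 * z + A$2$2)))"
| "moebius_map A Infty = (if A$2$1 = 0 then Infty else Fin (A$1$1 / A$2$1))"

end

(*
  The hypersurface has polynomial volume growth, so 0 already lies in the spectrum, which is stronger
  than the asserted bound.

  Lift the curve A(Gamma) to a unit curve sigma in C^2 that is horizontal for the Hopf connection. In the
  coordinates (s, w) of [sigma(s), w] one has u_1 = |w|, and with S = sqrt(|w|^2 + t^4) the metric is
  2 S rho(s)^2 ds^2 + |dw|^2 / (2 S), where rho is the Fubini-Study speed. For the radial bump functions
  phi_R = h(u_1^2 / R^2) this gives |Delta phi_R| <= K / R, with support in the tube u_1 <= R, while
  phi_R is bounded below on the tube u_1 <= R/2, whose volume is at least a quarter of that of the tube
  u_1 <= R. Hence |Delta phi_R| / |phi_R| tends to 0 in L^2, and 0 is not in the resolvent set.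

  Every smooth parametrization of the hypersurface factors locally through the coordinates (s, w), where
  the Laplacian transforms correctly by the Piola identity (divergence-free cofactors) and the volume
  by the change of variables theorem.
*)
theory Submission
  imports Defs
begin

section \<open>Calculus of smooth functions\<close>

text \<open>The rate 1/R comes from the shape of the metric: far out the inverse metric in the two w
  directions is 2 S, of size R, while two derivatives of a bump of width R cost R^-2. The bumps are
  functions of u_1^2 and not of u_1 because |w|^2 stays smooth at w = 0, so the zero section is an
  ordinary part of the chart. The horizontal lift need not close up after a period, and s is
  determined only modulo the period l. So (s, w) is a coordinate system only over arcs, a
  parametrization reaches it through a local choice of the parameter, and the bumps are defined by
  u_1, which is global. \<open>riemannian_volume\<close> picks some measure with prescribed values
  on all charts. Tube volumes can be computed only after one such measure has been built, from a
  half-open fundamental domain, and shown to be the only one. The coordinate change into this domain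
  jumps along one fibre, and charts and Borel sets are split along that fibre.\<close>

text \<open>Derivatives are taken \<open>at x\<close> in the whole space, so values on
  \<open>S\<close> determine them only because \<open>S\<close> is open.\<close>

lemma Ck_on_cong:
  assumes "open S" "\<And>x. x \<in> S \<Longrightarrow> f x = g x"
  shows "Ck_on k S f \<longleftrightarrow> Ck_on k S g"
  using assms
proof (induction k arbitrary: f g)
  case 0
  then show ?case by (auto intro!: continuous_on_cong)
next
  case (Suc k)
  have *: "(f has_derivative f') (at x) \<longleftrightarrow> (g has_derivative f') (at x)" if "x \<in> S" for x f'
    using Suc.prems that by (metis has_derivative_transform_within_open)
  have d: "f differentiable (at x) \<longleftrightarrow> g differentiable (at x)" if "x \<in> S" for x
    using * that by (auto simp: differentiable_def)
  have fd: "frechet_derivative f (at x) = frechet_derivative g (at x)" if "x \<in> S" for x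
    using * that by (auto simp: frechet_derivative_def)
  show ?case
    using Suc.IH[OF Suc.prems(1), of "\<lambda>x. frechet_derivative f (at x) v" "\<lambda>x. frechet_derivative g (at x) v" for v]
    by (auto simp: d fd)
qed

lemma smooth_on_cong:
  "open S \<Longrightarrow> (\<And>x. x \<in> S \<Longrightarrow> f x = g x) \<Longrightarrow> smooth_on S f \<longleftrightarrow> smooth_on S g"
  unfolding smooth_on_def using Ck_on_cong by blast

lemma Ck_on_Suc_imp: "Ck_on (Suc k) S f \<Longrightarrow> Ck_on k S f"
proof (induction k arbitrary: f)
  case 0
  then show ?case
    by (auto intro!: continuous_at_imp_continuous_on differentiable_imp_continuous_within)
next
  case (Suc k)
  have "Ck_on k S (\<lambda>x. frechet_derivative f (at x) v)" for v
    by (rule Suc.IH) (use Suc.prems in auto)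
  then show ?case using Suc.prems by simp
qed

lemma Ck_on_antimono: "Ck_on k S f \<Longrightarrow> j \<le> k \<Longrightarrow> Ck_on j S f"
proof (induction k)
  case (Suc k)
  then show ?case by (metis Ck_on_Suc_imp le_Suc_eq)
qed simp

lemma Ck_on_imp_continuous_on: "Ck_on k S f \<Longrightarrow> continuous_on S f"
  using Ck_on_antimono[of k S f 0] by simp

lemma Ck_on_subset: "Ck_on k S f \<Longrightarrow> T \<subseteq> S \<Longrightarrow> Ck_on k T f"
  by (induction k arbitrary: f) (auto intro: continuous_on_subset)

text \<open>Replaces \<open>frechet_derivative\<close> by any explicit formula for the derivative;
  the inductions on k below run on such formulas.\<close>

lemma Ck_on_SucI:
  assumes "open S" "\<And>x. x \<in> S \<Longrightarrow> (f has_derivative f' x) (at x)" "\<And>v. Ck_on k S (\<lambda>x. f' x v)"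
  shows "Ck_on (Suc k) S f"
proof -
  have "frechet_derivative f (at x) = f' x" if "x \<in> S" for x
    using frechet_derivative_at[OF assms(2)[OF that]] by simp
  then have "Ck_on k S (\<lambda>x. frechet_derivative f (at x) v)" for v
    using assms(1,3) by (subst Ck_on_cong[where g="\<lambda>x. f' x v"]) auto
  then show ?thesis using assms(2) by (auto simp: differentiable_def)
qed

lemma Ck_on_SucD:
  assumes "Ck_on (Suc k) S f" "x \<in> S"
  shows "(f has_derivative frechet_derivative f (at x)) (at x)"
  using assms by (simp add: frechet_derivative_works)

lemma Ck_on_const: "Ck_on k S (\<lambda>x. c)"
  by (induction k arbitrary: c) auto

lemma Ck_on_bounded_linear_comp:
  assumes "open S" "bounded_linear L"
  shows "Ck_on k S f \<Longrightarrow> Ck_on k S (\<lambda>x. L (f x))"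
proof (induction k arbitrary: f)
  case 0
  then show ?case by (auto intro: bounded_linear.continuous_on[OF assms(2)])
next
  case (Suc k)
  show ?case
    by (rule Ck_on_SucI[OF assms(1)])
       (auto intro!: bounded_linear.has_derivative[OF assms(2)] Ck_on_SucD[OF Suc.prems] Suc.IH
          simp: Suc.prems[simplified])
qed

lemma Ck_on_bounded_linear:
  assumes "bounded_linear L"
  shows "Ck_on k S L"
proof (cases k)
  case 0
  then show ?thesis using assms by (auto intro!: linear_continuous_on)
next
  case (Suc j)
  \<comment> \<open>\<open>S\<close> may fail to be open, so the derivative is computed on the whole
    space and the result restricted.\<close>
  have "Ck_on (Suc j) UNIV L"
    by (rule Ck_on_SucI[OF open_UNIV bounded_linear_imp_has_derivative[OF assms]])
       (auto intro: Ck_on_const)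
  then show ?thesis using Suc Ck_on_subset by blast
qed

lemma Ck_on_add:
  assumes "open S"
  shows "Ck_on k S f \<Longrightarrow> Ck_on k S g \<Longrightarrow> Ck_on k S (\<lambda>x. f x + g x)"
proof (induction k arbitrary: f g)
  case 0
  then show ?case by (auto intro: continuous_on_add)
next
  case (Suc k)
  show ?case
    by (rule Ck_on_SucI[OF assms])
       (auto intro!: has_derivative_add Ck_on_SucD[OF Suc.prems(1)] Ck_on_SucD[OF Suc.prems(2)] Suc.IH
          simp: Suc.prems[simplified])
qed

text \<open>Induction through the Leibniz rule: each summand of the derivative pairs a derivative of
  one factor with the other factor, and both are of class C^k.\<close>

lemma Ck_on_bilinear:
  assumes S: "open S" and B: "bounded_bilinear B"
  shows "Ck_on k S f \<Longrightarrow> Ck_on k S g \<Longrightarrow> Ck_on k S (\<lambda>x. B (f x) (g x))"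
proof (induction k arbitrary: f g)
  case 0
  then show ?case by (auto intro: bounded_bilinear.continuous_on[OF B])
next
  case (Suc k)
  have fg: "Ck_on k S f" "Ck_on k S g" using Suc.prems Ck_on_Suc_imp by blast+
  show ?case
    by (rule Ck_on_SucI[OF S bounded_bilinear.FDERIV[OF B]])
       (auto intro!: Ck_on_SucD[OF Suc.prems(1)] Ck_on_SucD[OF Suc.prems(2)] Suc.IH fg Ck_on_add[OF S]
          simp: Suc.prems[simplified])
qed

lemma Ck_on_sum:
  assumes "open S" "\<And>i. i \<in> I \<Longrightarrow> Ck_on k S (f i)"
  shows "Ck_on k S (\<lambda>x. \<Sum>i\<in>I. f i x)"
  using assms(2)
  by (induction I rule: infinite_finite_induct) (auto intro: Ck_on_const Ck_on_add[OF assms(1)])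

lemma Ck_on_compose:
  fixes f :: "'a::euclidean_space \<Rightarrow> 'b::euclidean_space"
  assumes S: "open S" and T: "open T"
  shows "Ck_on k S f \<Longrightarrow> Ck_on k T g \<Longrightarrow> f ` S \<subseteq> T \<Longrightarrow> Ck_on k S (\<lambda>x. g (f x))"
proof (induction k arbitrary: g)
  case 0
  then show ?case by (auto intro: continuous_on_compose2)
next
  case (Suc k)
  have f: "Ck_on k S f" using Suc.prems Ck_on_Suc_imp by blast
  have df: "(f has_derivative frechet_derivative f (at x)) (at x)" if "x \<in> S" for x
    using Ck_on_SucD[OF Suc.prems(1)] that .
  have dg: "(g has_derivative frechet_derivative g (at (f x))) (at (f x))" if "x \<in> S" for x
    using Ck_on_SucD[OF Suc.prems(2)] that Suc.prems(3) by blast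
  show ?case
  proof (rule Ck_on_SucI[OF S])
    fix x assume x: "x \<in> S"
    show "((\<lambda>x. g (f x)) has_derivative
        (\<lambda>v. frechet_derivative g (at (f x)) (frechet_derivative f (at x) v))) (at x)"
      using has_derivative_compose[OF df dg] x by blast
  next
    fix v
    \<comment> \<open>The chain rule evaluates the derivative of \<open>g\<close> at a direction
      that varies with x, while \<open>Ck_on\<close> controls fixed directions only. Expanding in
      the basis separates the two dependences.\<close>
    have eq: "frechet_derivative g (at (f x)) (frechet_derivative f (at x) v) =
       (\<Sum>b\<in>Basis. (frechet_derivative f (at x) v \<bullet> b) *\<^sub>R frechet_derivative g (at (f x)) b)"
      if "x \<in> S" for x
    proof -
      have lin: "linear (frechet_derivative g (at (f x)))"
        using dg[OF that] has_derivative_linear by blast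
      have "frechet_derivative g (at (f x)) (\<Sum>b\<in>Basis. (frechet_derivative f (at x) v \<bullet> b) *\<^sub>R b) =
        (\<Sum>b\<in>Basis. (frechet_derivative f (at x) v \<bullet> b) *\<^sub>R frechet_derivative g (at (f x)) b)"
        by (simp add: linear_sum[OF lin] linear_cmul[OF lin])
      then show ?thesis by (simp add: euclidean_representation)
    qed
    have "Ck_on k S (\<lambda>x. (\<Sum>b\<in>Basis. (frechet_derivative f (at x) v \<bullet> b) *\<^sub>R frechet_derivative g (at (f x)) b))"
      by (intro Ck_on_sum[OF S] Ck_on_bilinear[OF S bounded_bilinear_scaleR]
          Ck_on_bounded_linear_comp[OF S bounded_linear_inner_left] Suc.IH[OF f])
         (use Suc.prems in auto)
    then show "Ck_on k S (\<lambda>x. frechet_derivative g (at (f x)) (frechet_derivative f (at x) v))"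
      using Ck_on_cong[OF S eq] by simp
  qed
qed

lemma Ck_on_Pair:
  assumes "open S" "Ck_on k S f" "Ck_on k S g"
  shows "Ck_on k S (\<lambda>x. (f x, g x))"
proof -
  have "Ck_on k S (\<lambda>x. (f x, 0) + (0, g x))"
    by (intro Ck_on_add Ck_on_bounded_linear_comp[OF assms(1) _ assms(2), of "\<lambda>y. (y, 0)"]
        Ck_on_bounded_linear_comp[OF assms(1) _ assms(3), of "\<lambda>y. (0, y)"] assms(1))
       (auto intro!: bounded_linear_Pair bounded_linear_ident bounded_linear_zero)
  then show ?thesis by simp
qed

lemma Ck_on_real_SucI:
  fixes f :: "real \<Rightarrow> 'b::real_normed_vector"
  assumes "open S" "\<And>x. x \<in> S \<Longrightarrow> (f has_vector_derivative f' x) (at x)" "Ck_on k S f'"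
  shows "Ck_on (Suc k) S f"
proof (rule Ck_on_SucI[OF assms(1)])
  show "(f has_derivative (\<lambda>v. v *\<^sub>R f' x)) (at x)" if "x \<in> S" for x
    using assms(2)[OF that] by (simp add: has_vector_derivative_def)
  show "Ck_on k S (\<lambda>x. v *\<^sub>R f' x)" for v
    by (rule Ck_on_bounded_linear_comp[OF assms(1) bounded_linear_scaleR_right assms(3)])
qed

section \<open>Closure properties of smooth functions\<close>

lemma smooth_onI: "(\<And>k. Ck_on k S f) \<Longrightarrow> smooth_on S f"
  and smooth_onD: "smooth_on S f \<Longrightarrow> Ck_on k S f"
  by (auto simp: smooth_on_def)

lemma smooth_on_subset: "smooth_on S f \<Longrightarrow> T \<subseteq> S \<Longrightarrow> smooth_on T f"
  by (rule smooth_onI) (rule Ck_on_subset[OF smooth_onD])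

lemma smooth_on_const: "smooth_on S (\<lambda>x. c)"
  by (simp add: smooth_on_def Ck_on_const)

lemma smooth_on_add: "open S \<Longrightarrow> smooth_on S f \<Longrightarrow> smooth_on S g \<Longrightarrow> smooth_on S (\<lambda>x. f x + g x)"
  by (simp add: smooth_on_def Ck_on_add)

lemma smooth_on_bounded_linear_comp:
  "open S \<Longrightarrow> bounded_linear L \<Longrightarrow> smooth_on S f \<Longrightarrow> smooth_on S (\<lambda>x. L (f x))"
  by (simp add: smooth_on_def Ck_on_bounded_linear_comp)

lemma smooth_on_bounded_linear: "bounded_linear L \<Longrightarrow> smooth_on S L"
  by (simp add: smooth_on_def Ck_on_bounded_linear)

lemma smooth_on_bilinear:
  "open S \<Longrightarrow> bounded_bilinear B \<Longrightarrow> smooth_on S f \<Longrightarrow> smooth_on S g \<Longrightarrow> smooth_on S (\<lambda>x. B (f x) (g x))"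
  by (simp add: smooth_on_def Ck_on_bilinear)

lemmas smooth_on_mult = smooth_on_bilinear[OF _ bounded_bilinear_mult]
lemmas smooth_on_scaleR = smooth_on_bilinear[OF _ bounded_bilinear_scaleR]

lemma smooth_on_minus: "open S \<Longrightarrow> smooth_on S f \<Longrightarrow> smooth_on S (\<lambda>x. - f x)"
  by (rule smooth_on_bounded_linear_comp[OF _ bounded_linear_minus[OF bounded_linear_ident]])

lemma smooth_on_diff: "open S \<Longrightarrow> smooth_on S f \<Longrightarrow> smooth_on S g \<Longrightarrow> smooth_on S (\<lambda>x. f x - g x)"
  using smooth_on_add[OF _ _ smooth_on_minus, of S f g] by simp

lemma smooth_on_power:
  fixes f :: "'a::euclidean_space \<Rightarrow> 'b::real_normed_algebra_1"
  shows "open S \<Longrightarrow> smooth_on S f \<Longrightarrow> smooth_on S (\<lambda>x. f x ^ n)"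
  by (induction n) (simp_all add: smooth_on_const smooth_on_mult)

lemma smooth_on_compose:
  fixes f :: "'a::euclidean_space \<Rightarrow> 'b::euclidean_space"
  shows "open S \<Longrightarrow> open T \<Longrightarrow> smooth_on S f \<Longrightarrow> smooth_on T g \<Longrightarrow> f ` S \<subseteq> T \<Longrightarrow> smooth_on S (\<lambda>x. g (f x))"
  by (rule smooth_onI) (rule Ck_on_compose[of S T, OF _ _ smooth_onD smooth_onD])

lemma smooth_on_Pair:
  "open S \<Longrightarrow> smooth_on S f \<Longrightarrow> smooth_on S g \<Longrightarrow> smooth_on S (\<lambda>x. (f x, g x))"
  by (simp add: smooth_on_def Ck_on_Pair)

lemma smooth_on_imp_continuous_on: "smooth_on S f \<Longrightarrow> continuous_on S f"
  by (rule Ck_on_imp_continuous_on[OF smooth_onD])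

lemma smooth_on_has_derivative:
  "smooth_on S f \<Longrightarrow> x \<in> S \<Longrightarrow> (f has_derivative frechet_derivative f (at x)) (at x)"
  by (rule Ck_on_SucD[OF smooth_onD])

lemma smooth_on_frechet_derivative:
  "smooth_on S f \<Longrightarrow> smooth_on S (\<lambda>x. frechet_derivative f (at x) v)"
  by (rule smooth_onI) (use smooth_onD[of S f "Suc k" for k] in simp)

lemma smooth_on_realI:
  fixes f :: "real \<Rightarrow> 'b::real_normed_vector"
  assumes "open S" "\<And>x. x \<in> S \<Longrightarrow> (f has_vector_derivative f' x) (at x)" "smooth_on S f'"
  shows "smooth_on S f"
proof (rule smooth_onI)
  fix k show "Ck_on k S f"
    by (rule Ck_on_Suc_imp[OF Ck_on_real_SucI[OF assms(1,2) smooth_onD[OF assms(3)]]])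
qed

text \<open>The derivative is a polynomial in \<open>inverse\<close> itself, so C^k gives C^(k+1).
  For \<open>sqrt\<close> below the derivative is \<open>inverse (sqrt x) / 2\<close>, and the same
  bootstrap works.\<close>

lemma smooth_on_inverse_real: "smooth_on {0<..} (inverse :: real \<Rightarrow> real)"
proof (rule smooth_onI)
  fix k show "Ck_on k {0<..} (inverse :: real \<Rightarrow> real)"
  proof (induction k)
    case 0
    then show ?case by (auto intro!: continuous_intros)
  next
    case (Suc k)
    show ?case
    proof (rule Ck_on_real_SucI)
      show "(inverse has_vector_derivative - (inverse x * inverse x)) (at x)" if "x \<in> {0<..}" for x :: real
        using DERIV_inverse[of x UNIV] that
        by (simp add: has_real_derivative_iff_has_vector_derivative power2_eq_square)
      show "Ck_on k {0<..} (\<lambda>x::real. - (inverse x * inverse x))"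
        by (rule Ck_on_bounded_linear_comp[OF _ bounded_linear_minus[OF bounded_linear_ident]
              Ck_on_bilinear[OF _ bounded_bilinear_mult Suc Suc]]) auto
    qed auto
  qed
qed

lemma smooth_on_sqrt: "smooth_on {0<..} sqrt"
proof (rule smooth_onI)
  fix k show "Ck_on k {0<..} sqrt"
  proof (induction k)
    case 0
    then show ?case by (auto intro!: continuous_intros)
  next
    case (Suc k)
    show ?case
    proof (rule Ck_on_real_SucI)
      show "(sqrt has_vector_derivative inverse (sqrt x) / 2) (at x)" if "x \<in> {0<..}" for x :: real
        using DERIV_real_sqrt[of x] that
        by (simp add: has_real_derivative_iff_has_vector_derivative)
      show "Ck_on k {0<..} (\<lambda>x::real. inverse (sqrt x) / 2)"
        by (rule Ck_on_bounded_linear_comp[OF _ bounded_linear_divide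
            Ck_on_compose[OF _ _ Suc smooth_onD[OF smooth_on_inverse_real]]]) auto
    qed auto
  qed
qed

lemma smooth_on_cnj: "open S \<Longrightarrow> smooth_on S f \<Longrightarrow> smooth_on S (\<lambda>x. cnj (f x))"
  and smooth_on_Re: "open S \<Longrightarrow> smooth_on S f \<Longrightarrow> smooth_on S (\<lambda>x. Re (f x))"
  and smooth_on_Im: "open S \<Longrightarrow> smooth_on S f \<Longrightarrow> smooth_on S (\<lambda>x. Im (f x))"
  and smooth_on_of_real: "open S \<Longrightarrow> smooth_on S g \<Longrightarrow> smooth_on S (\<lambda>x. complex_of_real (g x))"
  by (simp_all add: smooth_on_bounded_linear_comp bounded_linear_cnj bounded_linear_Re bounded_linear_Im
      bounded_linear_of_real)

lemma smooth_on_norm2: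
  fixes f :: "'a::euclidean_space \<Rightarrow> complex"
  shows "open S \<Longrightarrow> smooth_on S f \<Longrightarrow> smooth_on S (\<lambda>x. (cmod (f x))\<^sup>2)"
  unfolding cmod_power2 by (intro smooth_on_add smooth_on_power smooth_on_Re smooth_on_Im)

text \<open>Writing 1/z as the conjugate of z divided by |z|^2 reduces the claim to the inverse of a
  positive real function.\<close>

lemma smooth_on_inverse_complex:
  fixes f :: "'a::euclidean_space \<Rightarrow> complex"
  assumes "open S" "smooth_on S f" "\<And>x. x \<in> S \<Longrightarrow> f x \<noteq> 0"
  shows "smooth_on S (\<lambda>x. inverse (f x))"
proof -
  have "smooth_on S (\<lambda>x. complex_of_real (inverse ((cmod (f x))\<^sup>2)) * cnj (f x))"
    using assms
    by (intro smooth_on_mult smooth_on_of_real smooth_on_cnj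
        smooth_on_compose[OF _ _ _ smooth_on_inverse_real] smooth_on_norm2) auto
  moreover have "complex_of_real (inverse ((cmod z)\<^sup>2)) * cnj z = inverse z" for z
    by (cases "z = 0") (simp_all add: field_simps flip: complex_norm_square)
  ultimately show ?thesis by simp
qed

lemma smooth_on_divide_complex:
  fixes f g :: "'a::euclidean_space \<Rightarrow> complex"
  assumes "open S" "smooth_on S f" "smooth_on S g" "\<And>x. x \<in> S \<Longrightarrow> g x \<noteq> 0"
  shows "smooth_on S (\<lambda>x. f x / g x)"
  unfolding divide_inverse using assms by (intro smooth_on_mult smooth_on_inverse_complex)

section \<open>A smooth bump function\<close>

definition flat_exp :: "real \<Rightarrow> real" where
  "flat_exp x = (if x \<le> 0 then 0 else exp (- inverse x))"

text \<open>From the right this is y^n / exp y as y = 1/x tends to infinity; from the left the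
  function is 0.\<close>

lemma tendsto_inverse_power_flat_exp: "((\<lambda>x. inverse x ^ n * flat_exp x) \<longlongrightarrow> 0) (at 0)"
proof -
  have "((\<lambda>x. inverse x ^ n * flat_exp x) \<longlongrightarrow> 0) (at_right 0)"
  proof (rule Lim_transform_eventually)
    show "((\<lambda>x::real. inverse x ^ n / exp (inverse x)) \<longlongrightarrow> 0) (at_right 0)"
      by (rule filterlim_compose[OF tendsto_power_div_exp_0 filterlim_inverse_at_top_right])
    show "\<forall>\<^sub>F x in at_right 0. inverse x ^ n / exp (inverse x) = inverse x ^ n * flat_exp x"
      using eventually_at_right_less[of "0::real"]
      by eventually_elim (simp add: flat_exp_def exp_minus field_simps)
  qed
  moreover have "((\<lambda>x. inverse x ^ n * flat_exp x) \<longlongrightarrow> 0) (at_left 0)"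
    by (rule Lim_transform_eventually[OF tendsto_const])
       (auto simp: eventually_at_left_field flat_exp_def intro!: exI[of _ "-1"])
  ultimately show ?thesis
    using filterlim_split_at by blast
qed

text \<open>The products of \<open>flat_exp\<close> with powers of 1/x form a family whose span is
  closed under differentiation, also at 0. This one rule yields smoothness and the first two
  derivatives.\<close>

lemma has_derivative_inverse_power_flat_exp:
  "((\<lambda>x. inverse x ^ n * flat_exp x) has_vector_derivative
     inverse x ^ (n + 2) * flat_exp x - real n * (inverse x ^ Suc n * flat_exp x)) (at x)"
proof -
  consider "x < 0" | "x > 0" | "x = 0" by linarith
  then show ?thesis
  proof cases
    case 1
    have "((\<lambda>x. inverse x ^ n * flat_exp x) has_vector_derivative 0) (at x)"
      by (rule has_vector_derivative_transform_within_open[OF has_vector_derivative_const, where S="{..<0}"])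
         (use 1 in \<open>auto simp: flat_exp_def\<close>)
    then show ?thesis using 1 by (simp add: flat_exp_def)
  next
    case 2
    have e: "((\<lambda>x. exp (- inverse x)) has_field_derivative inverse x ^ 2 * exp (- inverse x)) (at x)"
      using 2 by (auto intro!: derivative_eq_intros simp: power2_eq_square)
    have p: "((\<lambda>x. inverse x ^ n) has_field_derivative - real n * inverse x ^ Suc n) (at x)"
      using DERIV_power[OF DERIV_inverse[of x UNIV], of n] 2
      by (cases n) (simp_all add: power2_eq_square algebra_simps)
    have "((\<lambda>x. inverse x ^ n * exp (- inverse x)) has_field_derivative
        inverse x ^ (n + 2) * exp (- inverse x) - real n * (inverse x ^ Suc n * exp (- inverse x))) (at x)"
      using DERIV_mult[OF p e] by (simp add: algebra_simps power2_eq_square)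
    then have "((\<lambda>x. inverse x ^ n * exp (- inverse x)) has_vector_derivative
        inverse x ^ (n + 2) * exp (- inverse x) - real n * (inverse x ^ Suc n * exp (- inverse x))) (at x)"
      by (simp add: has_real_derivative_iff_has_vector_derivative)
    then have "((\<lambda>x. inverse x ^ n * flat_exp x) has_vector_derivative
        inverse x ^ (n + 2) * exp (- inverse x) - real n * (inverse x ^ Suc n * exp (- inverse x))) (at x)"
      by (rule has_vector_derivative_transform_within_open[where S="{0<..}"])
         (use 2 in \<open>auto simp: flat_exp_def\<close>)
    then show ?thesis using 2 by (simp add: flat_exp_def)
  next
    case 3
    \<comment> \<open>The difference quotient at 0 is the member of the family with exponent n + 1.
      The asserted derivative has value 0 there because \<open>flat_exp 0 = 0\<close>.\<close>
    have "((\<lambda>h. inverse h ^ Suc n * flat_exp h) \<longlongrightarrow> 0) (at 0)"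
      by (rule tendsto_inverse_power_flat_exp)
    then have "((\<lambda>x. inverse x ^ n * flat_exp x) has_field_derivative 0) (at 0)"
      by (simp add: DERIV_def field_simps flat_exp_def cong: if_cong)
    then show ?thesis
      using 3 by (simp add: has_real_derivative_iff_has_vector_derivative flat_exp_def)
  qed
qed

text \<open>Differentiation raises the exponent, so the induction on k must carry all n at once;
  \<open>flat_exp\<close> is the case n = 0.\<close>

lemma smooth_on_flat_exp: "smooth_on UNIV flat_exp"
proof -
  have "Ck_on k UNIV (\<lambda>x. inverse x ^ n * flat_exp x)" for k n
  proof (induction k arbitrary: n)
    case 0
    show ?case
      using has_derivative_inverse_power_flat_exp
      by (auto intro!: continuous_at_imp_continuous_on has_vector_derivative_continuous)
  next
    case (Suc k)
    have "Ck_on k UNIV (\<lambda>x. inverse x ^ (n + 2) * flat_exp x + (- real n) * (inverse x ^ Suc n * flat_exp x))"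
      by (rule Ck_on_add[OF open_UNIV Suc Ck_on_bounded_linear_comp[OF open_UNIV bounded_linear_mult_right Suc]])
    then show ?case
      using has_derivative_inverse_power_flat_exp[of n]
      by (intro Ck_on_real_SucI[OF open_UNIV]) auto
  qed
  from this[of _ 0] show ?thesis by (simp add: smooth_on_def)
qed

lemma flat_exp_eq_0: "x \<le> 0 \<Longrightarrow> flat_exp x = 0"
  and flat_exp_pos: "0 < x \<Longrightarrow> 0 < flat_exp x"
  and flat_exp_nonneg: "0 \<le> flat_exp x"
  by (auto simp: flat_exp_def)

lemma flat_exp_mono: "x \<le> y \<Longrightarrow> flat_exp x \<le> flat_exp y"
  by (auto simp: flat_exp_def)

definition flat_exp1 :: "real \<Rightarrow> real" where "flat_exp1 x = inverse x ^ 2 * flat_exp x"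
definition flat_exp2 :: "real \<Rightarrow> real" where
  "flat_exp2 x = inverse x ^ 4 * flat_exp x - 2 * (inverse x ^ 3 * flat_exp x)"

lemma DERIV_flat_exp: "(flat_exp has_field_derivative flat_exp1 x) (at x)"
  using has_derivative_inverse_power_flat_exp[of 0 x]
  by (simp add: flat_exp1_def has_real_derivative_iff_has_vector_derivative power2_eq_square)

lemma DERIV_flat_exp1: "(flat_exp1 has_field_derivative flat_exp2 x) (at x)"
  using has_derivative_inverse_power_flat_exp[of 2 x]
  by (simp add: flat_exp1_def[abs_def] flat_exp2_def has_real_derivative_iff_has_vector_derivative
      eval_nat_numeral)

lemma continuous_flat_exp: "continuous_on S flat_exp"
  and continuous_flat_exp1: "continuous_on S flat_exp1"
  by (auto intro!: continuous_at_imp_continuous_on DERIV_isCont DERIV_flat_exp DERIV_flat_exp1)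

lemma continuous_flat_exp2: "continuous_on S flat_exp2"
proof -
  have "continuous_on S (\<lambda>x. inverse x ^ n * flat_exp x)" for n
    by (intro continuous_at_imp_continuous_on ballI
        has_vector_derivative_continuous[OF has_derivative_inverse_power_flat_exp])
  then show ?thesis
    unfolding flat_exp2_def by (intro continuous_on_diff continuous_on_mult_left)
qed

lemma flat_exp1_eq_0: "x \<le> 0 \<Longrightarrow> flat_exp1 x = 0"
  and flat_exp2_eq_0: "x \<le> 0 \<Longrightarrow> flat_exp2 x = 0"
  by (auto simp: flat_exp1_def flat_exp2_def flat_exp_def)

section \<open>Coordinate invariance of the Laplacian\<close>

text \<open>The mean value theorem is used twice: along u for the difference of f between the two
  sides of the parallelogram, then along v for the derivative in direction u.\<close>

lemma second_difference_mean_value: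
  fixes f :: "'a::real_normed_vector \<Rightarrow> real"
  assumes f: "\<And>y. y \<in> S \<Longrightarrow> (f has_derivative f' y) (at y)"
    and f': "\<And>y. y \<in> S \<Longrightarrow> ((\<lambda>y. f' y u) has_derivative f'' y) (at y)"
    and S: "\<And>s t. s \<in> {0..h} \<Longrightarrow> t \<in> {0..h} \<Longrightarrow> x + s *\<^sub>R u + t *\<^sub>R v \<in> S"
    and h: "h > 0"
  obtains s t where "0 < s" "s < h" "0 < t" "t < h"
    "f (x + h *\<^sub>R u + h *\<^sub>R v) - f (x + h *\<^sub>R u) - f (x + h *\<^sub>R v) + f x =
       h\<^sup>2 * f'' (x + s *\<^sub>R u + t *\<^sub>R v) v"
proof -
  have d1: "((\<lambda>s. f (x + s *\<^sub>R u + t *\<^sub>R v)) has_real_derivative f' (x + s *\<^sub>R u + t *\<^sub>R v) u) (at s)"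
    if "s \<in> {0..h}" "t \<in> {0..h}" for s t
  proof -
    have "((\<lambda>s. x + s *\<^sub>R u + t *\<^sub>R v) has_derivative (\<lambda>r. r *\<^sub>R u)) (at s)"
      by (auto intro!: derivative_eq_intros)
    from has_derivative_compose[OF this f[OF S[OF that]]]
    show ?thesis
      using linear_cmul[OF has_derivative_linear[OF f[OF S[OF that]]]]
      by (simp add: has_field_derivative_def mult_commute_abs)
  qed
  have d2: "((\<lambda>t. f' (x + s *\<^sub>R u + t *\<^sub>R v) u) has_real_derivative f'' (x + s *\<^sub>R u + t *\<^sub>R v) v) (at t)"
    if "s \<in> {0..h}" "t \<in> {0..h}" for s t
  proof -
    have "((\<lambda>t. x + s *\<^sub>R u + t *\<^sub>R v) has_derivative (\<lambda>r. r *\<^sub>R v)) (at t)"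
      by (auto intro!: derivative_eq_intros)
    from has_derivative_compose[OF this f'[OF S[OF that]]]
    show ?thesis
      using linear_cmul[OF has_derivative_linear[OF f'[OF S[OF that]]]]
      by (simp add: has_field_derivative_def mult_commute_abs)
  qed
  have "\<exists>s>0. s < h \<and>
      (f (x + h *\<^sub>R u + h *\<^sub>R v) - f (x + h *\<^sub>R u + 0 *\<^sub>R v)) - (f (x + 0 *\<^sub>R u + h *\<^sub>R v) - f (x + 0 *\<^sub>R u + 0 *\<^sub>R v)) =
      (h - 0) * (f' (x + s *\<^sub>R u + h *\<^sub>R v) u - f' (x + s *\<^sub>R u + 0 *\<^sub>R v) u)"
    by (rule MVT2[OF h]) (use h in \<open>auto intro!: DERIV_diff d1 d1[of _ 0, simplified]\<close>)
  then obtain s where s: "0 < s" "s < h" and 1: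
      "f (x + h *\<^sub>R u + h *\<^sub>R v) - f (x + h *\<^sub>R u) - f (x + h *\<^sub>R v) + f x =
      h * (f' (x + s *\<^sub>R u + h *\<^sub>R v) u - f' (x + s *\<^sub>R u + 0 *\<^sub>R v) u)"
    by (auto simp: algebra_simps)
  have "\<exists>t>0. t < h \<and> f' (x + s *\<^sub>R u + h *\<^sub>R v) u - f' (x + s *\<^sub>R u + 0 *\<^sub>R v) u =
      (h - 0) * f'' (x + s *\<^sub>R u + t *\<^sub>R v) v"
    by (rule MVT2[OF h]) (use h s in \<open>auto intro!: d2\<close>)
  then obtain t where "0 < t" "t < h"
      "f' (x + s *\<^sub>R u + h *\<^sub>R v) u - f' (x + s *\<^sub>R u + 0 *\<^sub>R v) u = h * f'' (x + s *\<^sub>R u + t *\<^sub>R v) v"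
    by auto
  with s 1 that show thesis by (simp add: power2_eq_square)
qed

text \<open>The second difference over the parallelogram spanned by h u and h v is symmetric in u
  and v. It equals h^2 times either mixed derivative at some point of the parallelogram, and
  continuity moves both points to x.\<close>

lemma second_derivative_symmetric:
  fixes f :: "'a::real_normed_vector \<Rightarrow> real"
  assumes S: "open S" "x \<in> S"
    and f: "\<And>y. y \<in> S \<Longrightarrow> (f has_derivative f' y) (at y)"
    and u: "\<And>y. y \<in> S \<Longrightarrow> ((\<lambda>y. f' y u) has_derivative fu y) (at y)"
    and v: "\<And>y. y \<in> S \<Longrightarrow> ((\<lambda>y. f' y v) has_derivative fv y) (at y)"
    and cu: "continuous_on S (\<lambda>y. fu y v)"
    and cv: "continuous_on S (\<lambda>y. fv y u)"
  shows "fu x v = fv x u"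
proof (rule ccontr)
  assume ne: "fu x v \<noteq> fv x u"
  \<comment> \<open>Half the gap: two equal numbers cannot lie strictly within e of two numbers at
    distance 2 e.\<close>
  define e where "e = \<bar>fu x v - fv x u\<bar> / 2"
  have e: "e > 0" using ne by (simp add: e_def)
  have "continuous (at x) (\<lambda>y. fu y v)" "continuous (at x) (\<lambda>y. fv y u)"
    using cu cv S by (auto simp: continuous_on_eq_continuous_at)
  with e obtain d1 d2 where d: "d1 > 0" "d2 > 0"
    "\<And>y. dist y x < d1 \<Longrightarrow> dist (fu y v) (fu x v) < e"
    "\<And>y. dist y x < d2 \<Longrightarrow> dist (fv y u) (fv x u) < e"
    unfolding continuous_at_eps_delta by metis
  obtain d3 where d3: "d3 > 0" "ball x d3 \<subseteq> S" using S openE by blast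
  define d where "d = Min {d1, d2, d3}"
  \<comment> \<open>The 1 keeps N positive when u = v = 0; with h = d / (2 N) the parallelogram
    stays within distance d of x.\<close>
  define N where "N = norm u + norm v + 1"
  define h where "h = d / N / 2"
  have pos: "N > 0" unfolding N_def by (smt (verit) norm_ge_zero)
  have d0: "d > 0" "d \<le> d1" "d \<le> d2" "d \<le> d3" using d d3 by (auto simp: d_def)
  have h: "h > 0" using d0 pos by (simp add: h_def)
  have near: "dist (x + s *\<^sub>R u + t *\<^sub>R v) x < d" if "s \<in> {0..h}" "t \<in> {0..h}" for s t
  proof -
    have "norm (s *\<^sub>R u + t *\<^sub>R v) \<le> s * norm u + t * norm v"
      using that by (intro norm_triangle_le) auto
    also have "\<dots> \<le> h * norm u + h * norm v"
      using that by (intro add_mono mult_right_mono) auto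
    also have "\<dots> < h * N" using h by (simp add: N_def algebra_simps)
    also have "\<dots> = d / 2" using pos by (simp add: h_def)
    finally show ?thesis using d0 by (simp add: dist_norm add.assoc)
  qed
  have inS: "x + s *\<^sub>R u + t *\<^sub>R v \<in> S" if "s \<in> {0..h}" "t \<in> {0..h}" for s t
    using near[OF that] d0 d3 by (auto simp: dist_commute)
  then have inS': "x + s *\<^sub>R v + t *\<^sub>R u \<in> S" if "s \<in> {0..h}" "t \<in> {0..h}" for s t
    using that by (metis add.assoc add.commute)
  obtain s t where st: "0 < s" "s < h" "0 < t" "t < h"
    "f (x + h *\<^sub>R u + h *\<^sub>R v) - f (x + h *\<^sub>R u) - f (x + h *\<^sub>R v) + f x =
       h\<^sup>2 * fu (x + s *\<^sub>R u + t *\<^sub>R v) v"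
    by (rule second_difference_mean_value[OF f u inS h])
  obtain s' t' where st': "0 < s'" "s' < h" "0 < t'" "t' < h"
    "f (x + h *\<^sub>R v + h *\<^sub>R u) - f (x + h *\<^sub>R v) - f (x + h *\<^sub>R u) + f x =
       h\<^sup>2 * fv (x + s' *\<^sub>R v + t' *\<^sub>R u) u"
    by (rule second_difference_mean_value[OF f v inS' h])
  have "h\<^sup>2 * fu (x + s *\<^sub>R u + t *\<^sub>R v) v = h\<^sup>2 * fv (x + t' *\<^sub>R u + s' *\<^sub>R v) u"
    using st(5) st'(5) by (simp add: algebra_simps)
  then have "fu (x + s *\<^sub>R u + t *\<^sub>R v) v = fv (x + t' *\<^sub>R u + s' *\<^sub>R v) u" using h by simp
  moreover have "dist (fu (x + s *\<^sub>R u + t *\<^sub>R v) v) (fu x v) < e"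
    using st near[of s t] d0 by (intro d) auto
  moreover have "dist (fv (x + t' *\<^sub>R u + s' *\<^sub>R v) u) (fv x u) < e"
    using st' near[of t' s'] d0 by (intro d) auto
  ultimately show False by (auto simp: e_def dist_real_def abs_if split: if_splits)
qed

section \<open>The adjugate and the Piola identity\<close>

text \<open>The adjugate, with entries written out so that the Piola identity becomes a polynomial
  identity.\<close>

definition adj3 :: "real^3^3 \<Rightarrow> real^3^3" where
  "adj3 d = vector [
     vector [d$2$2 * d$3$3 - d$2$3 * d$3$2, d$1$3 * d$3$2 - d$1$2 * d$3$3, d$1$2 * d$2$3 - d$1$3 * d$2$2],
     vector [d$2$3 * d$3$1 - d$2$1 * d$3$3, d$1$1 * d$3$3 - d$1$3 * d$3$1, d$1$3 * d$2$1 - d$1$1 * d$2$3],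
     vector [d$2$1 * d$3$2 - d$2$2 * d$3$1, d$1$2 * d$3$1 - d$1$1 * d$3$2, d$1$1 * d$2$2 - d$1$2 * d$2$1]]"

lemma adj3_mult: "d ** adj3 d = mat (det d)"
  by (simp add: adj3_def vec_eq_iff forall_3 matrix_matrix_mult_def sum_3 vector_3 mat_def det_3)
     (simp add: algebra_simps)

lemma partial_deriv_eq: "(f has_derivative f') (at x) \<Longrightarrow> partial_deriv i f x = f' (axis i 1)"
  unfolding partial_deriv_def using frechet_derivative_at by metis

lemma partial_deriv_cong:
  assumes "open V" "x \<in> V" "\<And>y. y \<in> V \<Longrightarrow> f y = g y"
  shows "partial_deriv i f x = partial_deriv i g x"
proof -
  have "(f has_derivative f') (at x) \<longleftrightarrow> (g has_derivative f') (at x)" for f'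
    using assms by (metis has_derivative_transform_within_open)
  then show ?thesis unfolding partial_deriv_def frechet_derivative_def by simp
qed

text \<open>Here \<open>d\<close> is a Jacobian, and \<open>b\<close> is the derivative of the field
  in the target coordinates. By the product rule the derivatives of the cofactors cancel because
  mixed partials agree (\<open>sym\<close>), and what remains is the trace of \<open>b\<close> times
  \<open>d ** adj3 d\<close>, which is the determinant times the trace of \<open>b\<close>.\<close>

lemma piola:
  fixes d :: "real^3 \<Rightarrow> real^3^3" and y :: "real^3 \<Rightarrow> real^3"
  assumes d: "\<And>i j. ((\<lambda>z. d z $ i $ j) has_derivative d' i j) (at x)"
    and y: "\<And>k. ((\<lambda>z. y z $ k) has_derivative y' k) (at x)"
    and sym: "\<And>i j k. d' i j (axis k 1) = d' i k (axis j 1)"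
    and y': "\<And>k l. y' k (axis l 1) = (\<Sum>m\<in>UNIV. b k m * d x $ m $ l)"
  shows "(\<Sum>i\<in>UNIV. partial_deriv i (\<lambda>z. (adj3 (d z) *v y z) $ i) x) = det (d x) * (\<Sum>k\<in>UNIV. b k k)"
    and "(\<lambda>z. (adj3 (d z) *v y z) $ i) differentiable (at x)"
proof -
  let ?D = "\<lambda>i j k. d' i j (axis k (1::real))"
  have adj: "(adj3 (d z) *v y z) $ 1 =
      (d z$2$2 * d z$3$3 - d z$2$3 * d z$3$2) * y z $ 1 + (d z$1$3 * d z$3$2 - d z$1$2 * d z$3$3) * y z $ 2
        + (d z$1$2 * d z$2$3 - d z$1$3 * d z$2$2) * y z $ 3"
     "(adj3 (d z) *v y z) $ 2 =
      (d z$2$3 * d z$3$1 - d z$2$1 * d z$3$3) * y z $ 1 + (d z$1$1 * d z$3$3 - d z$1$3 * d z$3$1) * y z $ 2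
        + (d z$1$3 * d z$2$1 - d z$1$1 * d z$2$3) * y z $ 3"
     "(adj3 (d z) *v y z) $ 3 =
      (d z$2$1 * d z$3$2 - d z$2$2 * d z$3$1) * y z $ 1 + (d z$1$2 * d z$3$1 - d z$1$1 * d z$3$2) * y z $ 2
        + (d z$1$1 * d z$2$2 - d z$1$2 * d z$2$1) * y z $ 3" for z
    by (simp_all add: adj3_def matrix_vector_mult_def sum_3 vector_3)
  note I = has_derivative_add has_derivative_diff has_derivative_mult d y
  have der1: "((\<lambda>z. (adj3 (d z) *v y z) $ 1) has_derivative (\<lambda>h.
      (d x$2$2 * d x$3$3 - d x$2$3 * d x$3$2) * y' 1 h + (d x$2$2 * d' 3 3 h + d' 2 2 h * d x$3$3 - (d x$2$3 * d' 3 2 h + d' 2 3 h * d x$3$2)) * y x $ 1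
    + ((d x$1$3 * d x$3$2 - d x$1$2 * d x$3$3) * y' 2 h + (d x$1$3 * d' 3 2 h + d' 1 3 h * d x$3$2 - (d x$1$2 * d' 3 3 h + d' 1 2 h * d x$3$3)) * y x $ 2)
    + ((d x$1$2 * d x$2$3 - d x$1$3 * d x$2$2) * y' 3 h + (d x$1$2 * d' 2 3 h + d' 1 2 h * d x$2$3 - (d x$1$3 * d' 2 2 h + d' 1 3 h * d x$2$2)) * y x $ 3))) (at x)"
    unfolding adj by (intro I)
  have der2: "((\<lambda>z. (adj3 (d z) *v y z) $ 2) has_derivative (\<lambda>h.
      (d x$2$3 * d x$3$1 - d x$2$1 * d x$3$3) * y' 1 h + (d x$2$3 * d' 3 1 h + d' 2 3 h * d x$3$1 - (d x$2$1 * d' 3 3 h + d' 2 1 h * d x$3$3)) * y x $ 1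
    + ((d x$1$1 * d x$3$3 - d x$1$3 * d x$3$1) * y' 2 h + (d x$1$1 * d' 3 3 h + d' 1 1 h * d x$3$3 - (d x$1$3 * d' 3 1 h + d' 1 3 h * d x$3$1)) * y x $ 2)
    + ((d x$1$3 * d x$2$1 - d x$1$1 * d x$2$3) * y' 3 h + (d x$1$3 * d' 2 1 h + d' 1 3 h * d x$2$1 - (d x$1$1 * d' 2 3 h + d' 1 1 h * d x$2$3)) * y x $ 3))) (at x)"
    unfolding adj by (intro I)
  have der3: "((\<lambda>z. (adj3 (d z) *v y z) $ 3) has_derivative (\<lambda>h.
      (d x$2$1 * d x$3$2 - d x$2$2 * d x$3$1) * y' 1 h + (d x$2$1 * d' 3 2 h + d' 2 1 h * d x$3$2 - (d x$2$2 * d' 3 1 h + d' 2 2 h * d x$3$1)) * y x $ 1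
    + ((d x$1$2 * d x$3$1 - d x$1$1 * d x$3$2) * y' 2 h + (d x$1$2 * d' 3 1 h + d' 1 2 h * d x$3$1 - (d x$1$1 * d' 3 2 h + d' 1 1 h * d x$3$2)) * y x $ 2)
    + ((d x$1$1 * d x$2$2 - d x$1$2 * d x$2$1) * y' 3 h + (d x$1$1 * d' 2 2 h + d' 1 1 h * d x$2$2 - (d x$1$2 * d' 2 1 h + d' 1 2 h * d x$2$1)) * y x $ 3))) (at x)"
    unfolding adj by (intro I)
  have "\<forall>i. (\<lambda>z. (adj3 (d z) *v y z) $ i) differentiable (at x)"
    unfolding forall_3 using der1 der2 der3 differentiableI by blast
  then show "(\<lambda>z. (adj3 (d z) *v y z) $ i) differentiable (at x)" by blast
  have s: "?D i 2 1 = ?D i 1 2" "?D i 3 1 = ?D i 1 3" "?D i 3 2 = ?D i 2 3" for i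
    using sym by blast+
  show "(\<Sum>i\<in>UNIV. partial_deriv i (\<lambda>z. (adj3 (d z) *v y z) $ i) x) = det (d x) * (\<Sum>k\<in>UNIV. b k k)"
    by (simp add: sum_3 partial_deriv_eq[OF der1] partial_deriv_eq[OF der2] partial_deriv_eq[OF der3] s y' det_3)
       (simp add: algebra_simps)
qed

section \<open>Gradient and divergence under a coordinate change\<close>

lemma matrix_inv_right: "invertible A \<Longrightarrow> A ** matrix_inv A = mat 1"
  and matrix_inv_left: "invertible A \<Longrightarrow> matrix_inv A ** A = mat 1"
  unfolding invertible_def matrix_inv_def by (rule someI2_ex; simp)+

lemma matrix_inv_eqI:
  assumes "A ** B = mat 1" "B ** A = mat 1"
  shows "matrix_inv A = B"
proof -
  have "invertible A" using assms by (auto simp: invertible_def)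
  then have "matrix_inv A ** (A ** B) = B"
    by (simp only: matrix_mul_assoc matrix_inv_left matrix_mul_lid)
  then show ?thesis by (simp add: assms)
qed

text \<open>The linear algebra behind the invariance of the gradient: with respect to the
  pulled-back metric, the gradient of a pulled-back function is the inverse Jacobian applied to the
  original gradient.\<close>

lemma matrix_inv_congruence:
  fixes D G :: "real^'n^'n"
  assumes "det D \<noteq> 0" "det G \<noteq> 0"
  shows "matrix_inv (transpose D ** G ** D) ** transpose D = matrix_inv D ** matrix_inv G"
proof -
  let ?H = "transpose D ** G ** D"
  have inv: "invertible D" "invertible G" "invertible ?H"
    using assms by (simp_all add: invertible_det_nz det_mul det_transpose)
  have "?H ** (matrix_inv D ** matrix_inv G) = transpose D ** (G ** ((D ** matrix_inv D) ** matrix_inv G))"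
    by (simp add: matrix_mul_assoc)
  also have "\<dots> = transpose D"
    by (simp add: matrix_inv_right inv)
  finally have "matrix_inv ?H ** (?H ** (matrix_inv D ** matrix_inv G)) = matrix_inv ?H ** transpose D"
    by simp
  then show ?thesis
    by (simp add: matrix_mul_assoc matrix_inv_left[OF inv(3), unfolded matrix_mul_assoc])
qed

lemma adj3_eq_matrix_inv:
  assumes "det D \<noteq> 0"
  shows "adj3 D = det D *\<^sub>R matrix_inv D"
proof -
  have inv: "invertible D" using assms by (simp add: invertible_det_nz)
  have "mat (det D) = det D *\<^sub>R (mat 1 :: real^3^3)"
    by (simp add: vec_eq_iff mat_def)
  then have "matrix_inv D ** (D ** adj3 D) = det D *\<^sub>R matrix_inv D"
    by (simp add: adj3_mult scalar_matrix_assoc matrix_scalar_ac)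
  then show ?thesis by (simp add: matrix_mul_assoc matrix_inv_left[OF inv])
qed

definition jac_mat :: "(real^'n \<Rightarrow> real^'n) \<Rightarrow> real^'n \<Rightarrow> real^'n^'n" where
  "jac_mat \<tau> x = matrix (frechet_derivative \<tau> (at x))"

lemma jac_mat_nth: "jac_mat \<tau> x $ i $ j = frechet_derivative \<tau> (at x) (axis j 1) $ i"
  by (simp add: jac_mat_def matrix_def)

lemma partial_deriv_of_real_compose:
  fixes \<tau> :: "real^'n \<Rightarrow> real^'n" and F :: "real^'n \<Rightarrow> real"
  assumes "\<tau> differentiable (at x)" "F differentiable (at (\<tau> x))"
  shows "partial_deriv j (\<lambda>y. complex_of_real (F (\<tau> y))) x =
    of_real ((transpose (jac_mat \<tau> x) *v (\<chi> k. partial_deriv k F (\<tau> x))) $ j)"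
proof -
  have F: "(F has_derivative frechet_derivative F (at (\<tau> x))) (at (\<tau> x))"
    using assms(2) by (simp add: frechet_derivative_works)
  have \<tau>: "(\<tau> has_derivative frechet_derivative \<tau> (at x)) (at x)"
    using assms(1) by (simp add: frechet_derivative_works)
  have lin: "linear (frechet_derivative F (at (\<tau> x)))" using F has_derivative_linear by blast
  have "frechet_derivative F (at (\<tau> x)) w = (\<Sum>k\<in>UNIV. w $ k * partial_deriv k F (\<tau> x))" for w
  proof -
    have "frechet_derivative F (at (\<tau> x)) (\<Sum>k\<in>UNIV. w $ k *\<^sub>R axis k 1) =
       (\<Sum>k\<in>UNIV. w $ k * partial_deriv k F (\<tau> x))"
      by (simp add: linear_sum[OF lin] linear_cmul[OF lin] partial_deriv_def)
    then show ?thesis using basis_expansion[of w] by (simp add: scalar_mult_eq_scaleR)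
  qed
  then show ?thesis
    using partial_deriv_eq[OF has_derivative_of_real[OF has_derivative_compose[OF \<tau> F]]]
    by (simp add: matrix_vector_mult_def transpose_def jac_mat_nth)
qed

text \<open>\<open>Y\<close> is the gradient of \<open>F\<close> times the density in the model
  coordinates. In the new coordinates the same product is |det D| times the inverse of D applied to
  \<open>Y\<close>, that is, up to a sign the adjugate of D applied to \<open>Y\<close>. The Piola
  identity turns its divergence into det D times the divergence of \<open>Y\<close>, and dividing by
  the new density cancels the determinant.\<close>

lemma div_grad_coordinate_change:
  fixes \<tau> :: "real^3 \<Rightarrow> real^3" and F :: "real^3 \<Rightarrow> real"
  assumes V: "open V" "x \<in> V" and \<tau>: "Ck_on (Suc (Suc 0)) V \<tau>"
    and G: "\<And>y. y \<in> V \<Longrightarrow> G1 y = transpose (jac_mat \<tau> y) ** G0 (\<tau> y) ** jac_mat \<tau> y"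
    and det: "\<And>y. y \<in> V \<Longrightarrow> det (jac_mat \<tau> y) \<noteq> 0"
    and detG: "\<And>y. y \<in> V \<Longrightarrow> det (G0 (\<tau> y)) \<noteq> 0"
    and F: "\<And>y. y \<in> V \<Longrightarrow> F differentiable (at (\<tau> y))"
    and Y: "\<And>y. y \<in> V \<Longrightarrow> vol_density G0 (\<tau> y) *\<^sub>R
         (matrix_inv (G0 (\<tau> y)) *v (\<chi> k. partial_deriv k F (\<tau> y))) = Y (\<tau> y)"
    and dY: "(Y has_derivative Y') (at (\<tau> x))"
  shows "div_coord G1 (grad_coord G1 (\<lambda>y. complex_of_real (F (\<tau> y)))) x =
    of_real ((\<Sum>k\<in>UNIV. Y' (axis k 1) $ k) / vol_density G0 (\<tau> x))"
proof -
  let ?D = "jac_mat \<tau>"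
  have d\<tau>: "(\<tau> has_derivative frechet_derivative \<tau> (at y)) (at y)" if "y \<in> V" for y
    using Ck_on_SucD[OF \<tau> that] .
  have C1: "Ck_on (Suc 0) V (\<lambda>y. frechet_derivative \<tau> (at y) v)" for v
    using \<tau> by (subst (asm) Ck_on.simps(2)) blast
  have dd\<tau>: "((\<lambda>y. frechet_derivative \<tau> (at y) v) has_derivative
      frechet_derivative (\<lambda>y. frechet_derivative \<tau> (at y) v) (at y)) (at y)" if "y \<in> V" for v y
    using Ck_on_SucD[OF C1 that] .
  have C0: "continuous_on V (\<lambda>y. frechet_derivative (\<lambda>y. frechet_derivative \<tau> (at y) v) (at y) w)" for v w
    using C1[of v] by simp
  have contD: "continuous_on V (\<lambda>y. ?D y $ i $ j)" for i j
    unfolding jac_mat_nth using Ck_on_imp_continuous_on[OF C1]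
    by (intro continuous_on_component)
  \<comment> \<open>On \<open>W\<close> the determinant keeps the sign it has at x, so this sign is
    a constant and can be pulled out of the derivatives.\<close>
  define W where "W = V \<inter> (\<lambda>y. det (?D y) * det (?D x)) -` {0<..}"
  have "continuous_on V (\<lambda>y. det (?D y) * det (?D x))"
    unfolding det_3 by (intro continuous_on_add continuous_on_diff continuous_on_mult continuous_on_const contD)
  then have W: "open W" "W \<subseteq> V"
    unfolding W_def using V by (auto intro!: continuous_open_preimage)
  have xW: "x \<in> W" using V det[OF V(2)] by (auto simp: W_def zero_less_mult_iff)
  have sg: "sgn (det (?D y)) = sgn (det (?D x))" if "y \<in> W" for y
    using that by (auto simp: W_def zero_less_mult_iff)
  have vol: "vol_density G1 y = \<bar>det (?D y)\<bar> * vol_density G0 (\<tau> y)" if "y \<in> V" for y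
    by (simp add: vol_density_def G[OF that] det_mul det_transpose real_sqrt_mult)
  have field: "of_real (vol_density G1 y) * grad_coord G1 (\<lambda>y. complex_of_real (F (\<tau> y))) y $ i =
      complex_of_real (sgn (det (?D x)) * (adj3 (?D y) *v Y (\<tau> y)) $ i)" if "y \<in> W" for y i
  proof -
    from that W have y: "y \<in> V" by blast
    let ?g = "\<chi> k. partial_deriv k F (\<tau> y)"
    have "\<tau> differentiable (at y)" using d\<tau>[OF y] differentiableI by blast
    from partial_deriv_of_real_compose[OF this F[OF y]]
    have "grad_coord G1 (\<lambda>y. complex_of_real (F (\<tau> y))) y $ i =
       of_real ((matrix_inv (G1 y) *v (transpose (?D y) *v ?g)) $ i)"
      by (simp add: grad_coord_def matrix_vector_mult_def)
    also have "matrix_inv (G1 y) *v (transpose (?D y) *v ?g) =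
        matrix_inv (?D y) *v (matrix_inv (G0 (\<tau> y)) *v ?g)"
      by (simp only: matrix_vector_mul_assoc G[OF y] matrix_inv_congruence[OF det[OF y] detG[OF y]])
    finally have "of_real (vol_density G1 y) * grad_coord G1 (\<lambda>y. complex_of_real (F (\<tau> y))) y $ i =
      complex_of_real (\<bar>det (?D y)\<bar> * (matrix_inv (?D y) *v (vol_density G0 (\<tau> y) *\<^sub>R (matrix_inv (G0 (\<tau> y)) *v ?g))) $ i)"
      by (simp add: vol[OF y] matrix_vector_mult_scaleR)
    also have "\<bar>det (?D y)\<bar> * (matrix_inv (?D y) *v (vol_density G0 (\<tau> y) *\<^sub>R (matrix_inv (G0 (\<tau> y)) *v ?g))) $ i =
       \<bar>det (?D y)\<bar> * (matrix_inv (?D y) *v Y (\<tau> y)) $ i"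
      by (simp only: Y[OF y])
    also have "\<dots> = sgn (det (?D y)) * (adj3 (?D y) *v Y (\<tau> y)) $ i"
      by (simp add: adj3_eq_matrix_inv[OF det[OF y]] scaleR_matrix_vector_assoc[symmetric] abs_sgn)
    finally show ?thesis using sg[OF that] by simp
  qed
  let ?d' = "\<lambda>i j h. frechet_derivative (\<lambda>z. frechet_derivative \<tau> (at z) (axis j 1)) (at x) h $ i"
  have comp: "((\<lambda>z. f z $ i) has_derivative (\<lambda>h. f' h $ i)) F" if "(f has_derivative f') F"
    for f :: "real^3 \<Rightarrow> real^3" and f' i F
    using bounded_linear.has_derivative[OF bounded_linear_vec_nth that] .
  have p1: "((\<lambda>z. ?D z $ i $ j) has_derivative ?d' i j) (at x)" for i j
    unfolding jac_mat_nth by (rule comp[OF dd\<tau>[OF V(2)]])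
  have p2: "((\<lambda>z. Y (\<tau> z) $ k) has_derivative (\<lambda>h. Y' (frechet_derivative \<tau> (at x) h) $ k)) (at x)" for k
    by (rule comp[OF has_derivative_compose[OF d\<tau>[OF V(2)] dY]])
  have p3: "?d' i j (axis k 1) = ?d' i k (axis j 1)" for i j k
    by (rule second_derivative_symmetric[OF V, where f="\<lambda>z. \<tau> z $ i" and f'="\<lambda>y h. frechet_derivative \<tau> (at y) h $ i"
          and fu="\<lambda>y h. frechet_derivative (\<lambda>z. frechet_derivative \<tau> (at z) (axis j 1)) (at y) h $ i"
          and fv="\<lambda>y h. frechet_derivative (\<lambda>z. frechet_derivative \<tau> (at z) (axis k 1)) (at y) h $ i"])
       (intro comp[OF d\<tau>] comp[OF dd\<tau>] continuous_on_component C0; assumption)+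
  have linY: "linear Y'" using dY has_derivative_linear by blast
  have p4: "Y' (frechet_derivative \<tau> (at x) (axis l 1)) $ k = (\<Sum>m\<in>UNIV. Y' (axis m 1) $ k * ?D x $ m $ l)" for k l
  proof -
    have "Y' (\<Sum>m\<in>UNIV. w $ m *\<^sub>R axis m 1) $ k = (\<Sum>m\<in>UNIV. Y' (axis m 1) $ k * w $ m)" for w
      by (simp add: linear_sum[OF linY] linear_cmul[OF linY] mult.commute)
    from this[of "frechet_derivative \<tau> (at x) (axis l 1)"] show ?thesis
      using basis_expansion[of "frechet_derivative \<tau> (at x) (axis l 1)"]
      by (simp add: scalar_mult_eq_scaleR jac_mat_nth)
  qed
  note P = piola[of ?D ?d' x "\<lambda>z. Y (\<tau> z)" "\<lambda>k h. Y' (frechet_derivative \<tau> (at x) h) $ k" "\<lambda>k m. Y' (axis m 1) $ k",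
      OF p1 p2 p3 p4]
  let ?s = "sgn (det (?D x))"
  have "partial_deriv i (\<lambda>y. of_real (vol_density G1 y) * grad_coord G1 (\<lambda>y. complex_of_real (F (\<tau> y))) y $ i) x =
     of_real (?s * partial_deriv i (\<lambda>z. (adj3 (?D z) *v Y (\<tau> z)) $ i) x)" for i
  proof -
    let ?Z = "\<lambda>z. (adj3 (?D z) *v Y (\<tau> z)) $ i"
    have "partial_deriv i (\<lambda>y. of_real (vol_density G1 y) * grad_coord G1 (\<lambda>y. complex_of_real (F (\<tau> y))) y $ i) x =
      partial_deriv i (\<lambda>y. complex_of_real (?s * ?Z y)) x"
      by (rule partial_deriv_cong[OF W(1) xW field])
    also have "(?Z has_derivative frechet_derivative ?Z (at x)) (at x)"
      using P(2) by (simp add: frechet_derivative_works)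
    then have "((\<lambda>y. complex_of_real (?s * ?Z y)) has_derivative
       (\<lambda>h. of_real (?s * frechet_derivative ?Z (at x) h))) (at x)"
      by (intro has_derivative_of_real has_derivative_mult_right)
    from partial_deriv_eq[OF this]
    have "partial_deriv i (\<lambda>y. complex_of_real (?s * ?Z y)) x = of_real (?s * partial_deriv i ?Z x)"
      by (simp add: partial_deriv_def)
    finally show ?thesis .
  qed
  then have "div_coord G1 (grad_coord G1 (\<lambda>y. complex_of_real (F (\<tau> y)))) x =
     of_real (?s * (\<Sum>i\<in>UNIV. partial_deriv i (\<lambda>z. (adj3 (?D z) *v Y (\<tau> z)) $ i) x) / vol_density G1 x)"
    unfolding div_coord_def by (simp add: sum_distrib_left)
  also have "\<dots> = of_real ((\<Sum>k\<in>UNIV. Y' (axis k 1) $ k) / vol_density G0 (\<tau> x))"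
    using det[OF V(2)] unfolding P(1) vol[OF V(2)] by (simp add: sgn_if)
  finally show ?thesis .
qed

section \<open>Change of variables for nonnegative integrals\<close>

text \<open>If one side is integrable, so is the other, with equal integrals; otherwise both
  integrals are infinite. The integrand \<open>h\<close> is a parameter of its own, so that
  measurability is asked of it and not of the chosen derivatives \<open>g'\<close>. Derivatives
  within \<open>S\<close> suffice, which allows coordinate changes that jump across the boundary of
  \<open>S\<close>.\<close>

lemma nn_integral_change_of_variables:
  fixes g :: "real^'n::{finite,wellorder} \<Rightarrow> real^'n::_" and f h :: "real^'n::_ \<Rightarrow> real"
  assumes S: "S \<in> sets borel"
    and der: "\<And>x. x \<in> S \<Longrightarrow> (g has_derivative g' x) (at x within S)"
    and inj: "inj_on g S"
    and h: "\<And>x. x \<in> S \<Longrightarrow> h x = \<bar>det (matrix (g' x))\<bar> * f (g x)"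
    and f0: "\<And>y. y \<in> g ` S \<Longrightarrow> 0 \<le> f y"
    and mh: "set_borel_measurable borel S h"
    and mf: "set_borel_measurable borel (g ` S) f"
  shows "(\<integral>\<^sup>+x\<in>S. ennreal (h x) \<partial>lborel) = (\<integral>\<^sup>+y\<in>g ` S. ennreal (f y) \<partial>lborel)"
proof -
  have key: "k absolutely_integrable_on T \<longleftrightarrow> (\<integral>\<^sup>+x\<in>T. ennreal (k x) \<partial>lborel) < \<infinity>"
       "k absolutely_integrable_on T \<Longrightarrow> (\<integral>\<^sup>+x\<in>T. ennreal (k x) \<partial>lborel) = ennreal (integral T k)"
    if k: "set_borel_measurable borel T k" "\<And>x. x \<in> T \<Longrightarrow> 0 \<le> k x" for T :: "(real^'n::{finite,wellorder}) set" and k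
  proof -
    let ?k = "\<lambda>x. indicator T x *\<^sub>R k x"
    have m: "?k \<in> borel_measurable borel" using k(1) by (simp add: set_borel_measurable_def)
    have nn: "0 \<le> ?k x" for x using k(2) by (simp add: indicator_def)
    have eq: "(\<integral>\<^sup>+x\<in>T. ennreal (k x) \<partial>lborel) = (\<integral>\<^sup>+x. ennreal (?k x) \<partial>lborel)"
      by (intro nn_integral_cong) (simp add: indicator_def)
    have abs: "k absolutely_integrable_on T \<longleftrightarrow> integrable lborel ?k"
      unfolding set_integrable_def using m by (simp add: integrable_completion)
    show "k absolutely_integrable_on T \<longleftrightarrow> (\<integral>\<^sup>+x\<in>T. ennreal (k x) \<partial>lborel) < \<infinity>"
      unfolding abs eq using m nn by (simp add: integrable_iff_bounded)
    assume a: "k absolutely_integrable_on T"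
    have "(\<integral>\<^sup>+x. ennreal (?k x) \<partial>lborel) = ennreal (integral\<^sup>L lborel ?k)"
      using a nn unfolding abs by (intro nn_integral_eq_integral) auto
    also have "integral\<^sup>L lborel ?k = integral T k"
      using set_lebesgue_integral_eq_integral(2)[OF a] m
      by (simp add: set_lebesgue_integral_def integral_completion)
    finally show "(\<integral>\<^sup>+x\<in>T. ennreal (k x) \<partial>lborel) = ennreal (integral T k)" unfolding eq .
  qed
  have S': "S \<in> sets lebesgue" using S by simp
  have cov: "h absolutely_integrable_on S \<and> integral S h = b \<longleftrightarrow>
       f absolutely_integrable_on (g ` S) \<and> integral (g ` S) f = b" for b
  proof -
    \<comment> \<open>Scalar functions pass through \<open>real^1\<close> to fit the vector-valued
      change of variables theorem.\<close>
    have "(\<lambda>x. \<bar>det (matrix (g' x))\<bar> *\<^sub>R (vec (f (g x)) :: real^1)) absolutely_integrable_on S \<and>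
           integral S (\<lambda>x. \<bar>det (matrix (g' x))\<bar> *\<^sub>R (vec (f (g x)) :: real^1)) = vec b
     \<longleftrightarrow> (\<lambda>y. vec (f y) :: real^1) absolutely_integrable_on (g ` S) \<and> integral (g ` S) (\<lambda>y. vec (f y) :: real^1) = vec b"
      by (rule has_absolute_integral_change_of_variables[OF S' der inj])
    then have "(\<lambda>x. \<bar>det (matrix (g' x))\<bar> * f (g x)) absolutely_integrable_on S \<and>
           integral S (\<lambda>x. \<bar>det (matrix (g' x))\<bar> * f (g x)) = b \<longleftrightarrow>
        f absolutely_integrable_on (g ` S) \<and> integral (g ` S) f = b"
      by (simp add: absolutely_integrable_on_1_iff integral_on_1_eq)
    moreover have "h absolutely_integrable_on S \<longleftrightarrow> (\<lambda>x. \<bar>det (matrix (g' x))\<bar> * f (g x)) absolutely_integrable_on S"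
      by (intro set_integrable_cong) (simp_all add: h)
    moreover have "integral S h = integral S (\<lambda>x. \<bar>det (matrix (g' x))\<bar> * f (g x))"
      by (intro integral_cong) (simp add: h)
    ultimately show ?thesis by simp
  qed
  have h0: "0 \<le> h x" if "x \<in> S" for x using that h f0 by simp
  show ?thesis
  proof (cases "h absolutely_integrable_on S")
    case True
    then show ?thesis using cov[of "integral S h"] key(2)[OF mh h0] key(2)[OF mf f0] by simp
  next
    case False
    then have "\<not> f absolutely_integrable_on (g ` S)" using cov[of "integral (g ` S) f"] by simp
    with False show ?thesis using key(1)[OF mh h0] key(1)[OF mf f0] by (simp add: not_less top_unique)
  qed
qed

section \<open>The Eguchi--Hanson metric in homogeneous coordinates\<close>

abbreviation c1 :: "C3 \<Rightarrow> complex" where "c1 \<equiv> fst"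
abbreviation c2 :: "C3 \<Rightarrow> complex" where "c2 v \<equiv> fst (snd v)"
abbreviation c3 :: "C3 \<Rightarrow> complex" where "c3 v \<equiv> snd (snd v)"

text \<open>At \<open>v = (\<alpha>, \<beta>, \<gamma>)\<close> with \<open>n = |\<alpha>|\<^sup>2 + |\<beta>|\<^sup>2\<close> one has \<open>u\<^sub>1 = n |\<gamma>|\<close>. As a function of \<open>log u\<^sub>1\<close> the potential has
  first derivative \<open>S = sqrt (u\<^sub>1\<^sup>2 + t\<^sup>4)\<close> and second derivative \<open>u\<^sub>1\<^sup>2 / S\<close>, so \<open>\<partial> delbar f\<close> is the Hermitian form
  \<open>eh_B = p (cnj p) / S + S q (cnj q)\<close>. Here \<open>p = u\<^sub>1 \<partial> log u\<^sub>1\<close> up to a phase (written so that it makes sense at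
  \<open>\<gamma> = 0\<close>), and \<open>q (cnj q)\<close> is the Fubini--Study form.\<close>

definition eh_n :: "C3 \<Rightarrow> real" where "eh_n v = (cmod (c1 v))\<^sup>2 + (cmod (c2 v))\<^sup>2"
definition eh_S :: "real \<Rightarrow> C3 \<Rightarrow> real" where "eh_S t v = sqrt ((eh_n v * cmod (c3 v))\<^sup>2 + t ^ 4)"
definition eh_in :: "C3 \<Rightarrow> C3 \<Rightarrow> complex" where "eh_in v X = c1 X * cnj (c1 v) + c2 X * cnj (c2 v)"
definition eh_p :: "C3 \<Rightarrow> C3 \<Rightarrow> complex" where
  "eh_p v X = c3 v * eh_in v X + of_real (eh_n v) * c3 X / 2"
definition eh_q :: "C3 \<Rightarrow> C3 \<Rightarrow> complex" where
  "eh_q v X = (c1 X * c2 v - c2 X * c1 v) / of_real (eh_n v)"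
definition eh_B :: "real \<Rightarrow> C3 \<Rightarrow> C3 \<Rightarrow> C3 \<Rightarrow> complex" where
  "eh_B t v X Y = eh_p v X * cnj (eh_p v Y) / of_real (eh_S t v) + of_real (eh_S t v) * (eh_q v X * cnj (eh_q v Y))"

lemma homog_iff: "v \<in> homog \<longleftrightarrow> c1 v \<noteq> 0 \<or> c2 v \<noteq> 0"
  by (cases v) (auto simp: homog_def)

lemma eh_n_pos: "v \<in> homog \<Longrightarrow> 0 < eh_n v"
  by (auto simp: homog_iff eh_n_def add_pos_nonneg add_nonneg_pos)

lemma eh_S_pos: "t \<noteq> 0 \<Longrightarrow> 0 < eh_S t v"
  by (simp add: eh_S_def add_nonneg_pos zero_less_power_eq)

lemma open_homog: "open homog"
proof -
  have "homog = {v. c1 v \<noteq> 0} \<union> {v. c2 v \<noteq> 0}"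
    by (auto simp: homog_iff)
  moreover have "open ({v. c1 v \<noteq> 0} \<union> {v. c2 v \<noteq> 0})"
    by (intro open_Un open_Collect_neq continuous_intros)
  ultimately show ?thesis by simp
qed

lemma H2_rel_refl_iff: "H2_rel v v \<longleftrightarrow> v \<in> homog"
  by (cases v) (auto simp: homog_def intro!: exI[of _ 1])

lemma u1_abs_H2: "v \<in> homog \<Longrightarrow> u1 (abs_H2 v) = eh_n v * cmod (c3 v)"
proof -
  have *: "(cmod (x * csqrt y))\<^sup>2 = (cmod x)\<^sup>2 * cmod y" for x y
    by (simp add: norm_mult power_mult_distrib flip: norm_power)
  assume "v \<in> homog"
  from u1.abs_eq[OF H2_rel_refl_iff[THEN iffD2, OF this]] show ?thesis
    by (cases v) (simp add: * eh_n_def algebra_simps)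
qed

definition eh_off_zero :: "C3 set" where "eh_off_zero = {v \<in> homog. c3 v \<noteq> 0}"

lemma open_eh_off_zero: "open eh_off_zero"
proof -
  have "eh_off_zero = homog \<inter> {v. c3 v \<noteq> 0}"
    by (auto simp: eh_off_zero_def)
  moreover have "open (homog \<inter> {v. c3 v \<noteq> 0})"
    by (intro open_Int open_homog open_Collect_neq continuous_intros)
  ultimately show ?thesis by simp
qed

section \<open>The two-form of the potential off the zero section\<close>

lemma cmod_square: "(complex_of_real (cmod z))\<^sup>2 = z * cnj z"
  using complex_norm_square[of z] by simp

lemma has_derivative_norm2:
  fixes g :: "'a::real_normed_vector \<Rightarrow> complex"
  assumes "(g has_derivative g') (at x)"
  shows "((\<lambda>x. (cmod (g x))\<^sup>2) has_derivative (\<lambda>h. 2 * Re (g' h * cnj (g x)))) (at x)"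
  unfolding power2_norm_eq_inner
  by (rule has_derivative_eq_rhs[OF has_derivative_inner[OF assms assms]])
     (simp add: fun_eq_iff inner_complex_def algebra_simps)

lemma has_derivative_c123:
  "(c1 has_derivative c1) F" "(c2 has_derivative c2) F" "(c3 has_derivative c3) F"
  by (auto intro!: derivative_eq_intros)

lemma has_derivative_eh_n: "(eh_n has_derivative (\<lambda>X. 2 * Re (eh_in v X))) (at v)"
  unfolding eh_n_def[abs_def] eh_in_def
  by (rule has_derivative_eq_rhs[OF has_derivative_add[OF has_derivative_norm2 has_derivative_norm2]])
     (auto intro: has_derivative_c123 simp: algebra_simps)

text \<open>The (1,0)-form \<partial> log u_1, as the sum of \<partial> log n and \<partial> log
  |\<gamma>|.\<close>

definition eh_dlog :: "C3 \<Rightarrow> C3 \<Rightarrow> complex" where "eh_dlog v X = eh_in v X / of_real (eh_n v) + c3 X / (2 * c3 v)"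

lemma cJ_simps [simp]: "c1 (cJ X) = \<i> * c1 X" "c2 (cJ X) = \<i> * c2 X" "c3 (cJ X) = \<i> * c3 X"
  by (simp_all add: cJ_def case_prod_beta)

lemma eh_in_cJ [simp]: "eh_in v (cJ X) = \<i> * eh_in v X"
  and eh_dlog_cJ [simp]: "eh_dlog v (cJ X) = \<i> * eh_dlog v X"
  and eh_p_cJ [simp]: "eh_p v (cJ X) = \<i> * eh_p v X"
  and eh_q_cJ [simp]: "eh_q v (cJ X) = \<i> * eh_q v X"
  by (simp_all add: eh_in_def eh_dlog_def eh_p_def eh_q_def algebra_simps add_divide_distrib diff_divide_distrib)

text \<open>The square of u_1, a polynomial in real and imaginary parts, so that \<open>cmod\<close>
  itself never has to be differentiated.\<close>

definition eh_u2 :: "C3 \<Rightarrow> real" where "eh_u2 v = (eh_n v)\<^sup>2 * (cmod (c3 v))\<^sup>2"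

lemma has_derivative_eh_u2:
  assumes "v \<in> eh_off_zero"
  shows "(eh_u2 has_derivative (\<lambda>X. 4 * eh_u2 v * Re (eh_dlog v X))) (at v)"
proof -
  have nz: "eh_n v > 0" "c3 v \<noteq> 0" using assms by (auto simp: eh_off_zero_def eh_n_pos)
  have "(eh_u2 has_derivative (\<lambda>X. (eh_n v)\<^sup>2 * (2 * Re (c3 X * cnj (c3 v))) +
      (of_nat 2 * (2 * Re (eh_in v X)) * eh_n v ^ (2 - 1)) * (cmod (c3 v))\<^sup>2)) (at v)"
    unfolding eh_u2_def[abs_def]
    by (intro has_derivative_mult has_derivative_power has_derivative_eh_n has_derivative_norm2 has_derivative_c123)
  moreover have "(eh_n v)\<^sup>2 * (2 * Re (c3 X * cnj (c3 v))) +
      (of_nat 2 * (2 * Re (eh_in v X)) * eh_n v ^ (2 - 1)) * (cmod (c3 v))\<^sup>2 = 4 * eh_u2 v * Re (eh_dlog v X)" for X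
  proof -
    have "c3 X / (2 * c3 v) = (c3 X * cnj (c3 v)) / of_real (2 * (cmod (c3 v))\<^sup>2)"
      using nz by (simp add: cmod_square field_simps)
    then have "Re (eh_dlog v X) = Re (eh_in v X) / eh_n v + Re (c3 X * cnj (c3 v)) / (2 * (cmod (c3 v))\<^sup>2)"
      by (simp only: eh_dlog_def plus_complex.simps Re_divide_of_real)
    then have R: "Re (eh_dlog v X) = Re (eh_in v X) / eh_n v + Re (c3 X * cnj (c3 v)) / (2 * (cmod (c3 v))\<^sup>2)" .
    show ?thesis
      unfolding R eh_u2_def using nz by (simp add: field_simps power2_eq_square del: times_complex.simps)
  qed
  ultimately show ?thesis by simp
qed

lemma eh_u2_pos: "v \<in> eh_off_zero \<Longrightarrow> 0 < eh_u2 v"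
  unfolding eh_u2_def eh_off_zero_def by (intro mult_pos_pos zero_less_power) (auto intro: eh_n_pos)

lemma eh_S_eh_u2: "eh_S t v = sqrt (eh_u2 v + t ^ 4)"
  by (simp add: eh_S_def eh_u2_def power_mult_distrib)

text \<open>With m = u_1^2 this says that the potential has derivative S with respect to log u_1,
  which is where its logarithmic term earns its place.\<close>

lemma eh_potential_DERIV:
  assumes "m > 0" and t: "t \<noteq> 0"
  shows "((\<lambda>m. sqrt (m + t ^ 4) + t\<^sup>2 * (ln m / 2 - ln (sqrt (m + t ^ 4) + t\<^sup>2))) has_real_derivative
     sqrt (m + t ^ 4) / (2 * m)) (at m)"
proof -
  define S where "S = sqrt (m + t ^ 4)"
  have pos: "m + t ^ 4 > 0" using assms by (simp add: add_pos_nonneg)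
  have S: "S > 0" "S + t\<^sup>2 > 0" using pos by (auto simp: S_def add_pos_nonneg)
  \<comment> \<open>Factoring m = S^2 - t^4 makes the remaining claim a rational identity in S and
    t.\<close>
  have m: "m = (S - t\<^sup>2) * (S + t\<^sup>2)" using pos by (simp add: S_def algebra_simps flip: power2_eq_square)
  then have nz: "S - t\<^sup>2 \<noteq> 0" using assms by auto
  have "((\<lambda>m. sqrt (m + t ^ 4) + t\<^sup>2 * (ln m / 2 - ln (sqrt (m + t ^ 4) + t\<^sup>2))) has_real_derivative
     inverse S / 2 + t\<^sup>2 * (1 / m / 2 - (inverse S / 2) / (S + t\<^sup>2))) (at m)"
    using assms pos S by (auto intro!: derivative_eq_intros simp: S_def[symmetric] mult.commute)
  moreover have "inverse S / 2 + t\<^sup>2 * (1 / m / 2 - (inverse S / 2) / (S + t\<^sup>2)) = S / (2 * m)"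
    using S nz unfolding m by (simp add: divide_simps) (simp add: algebra_simps power2_eq_square power4_eq_xxxx)
  ultimately show ?thesis by (simp add: S_def)
qed

lemma has_derivative_eh_potential:
  assumes v: "v \<in> eh_off_zero" and t: "t \<noteq> 0"
  shows "((\<lambda>v. complex_of_real (eh_potential t (abs_H2 v))) has_derivative
     (\<lambda>X. of_real (2 * eh_S t v * Re (eh_dlog v X)))) (at v)"
proof -
  let ?f = "\<lambda>m. sqrt (m + t ^ 4) + t\<^sup>2 * (ln m / 2 - ln (sqrt (m + t ^ 4) + t\<^sup>2))"
  have "((\<lambda>v. ?f (eh_u2 v)) has_derivative (\<lambda>X. sqrt (eh_u2 v + t ^ 4) / (2 * eh_u2 v) * (4 * eh_u2 v * Re (eh_dlog v X)))) (at v)"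
    using has_derivative_compose[OF has_derivative_eh_u2[OF v]
        eh_potential_DERIV[OF eh_u2_pos[OF v] t, unfolded has_field_derivative_def]] .
  then have d: "((\<lambda>v. complex_of_real (?f (eh_u2 v))) has_derivative (\<lambda>X. of_real (2 * eh_S t v * Re (eh_dlog v X)))) (at v)"
    using eh_u2_pos[OF v] by (intro has_derivative_of_real) (simp add: eh_S_eh_u2 ac_simps)
  have eq: "?f (eh_u2 v) = eh_potential t (abs_H2 v)" if "v \<in> eh_off_zero" for v
  proof -
    have v: "v \<in> homog" and m: "eh_u2 v > 0" using that eh_u2_pos by (auto simp: eh_off_zero_def)
    have u: "u1 (abs_H2 v) = sqrt (eh_u2 v)" using eh_n_pos[OF v] v
      by (simp add: u1_abs_H2 eh_u2_def real_sqrt_mult)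
    have "sqrt (eh_u2 v + t ^ 4) + t\<^sup>2 > 0" using m by (intro add_pos_nonneg) (auto intro!: add_pos_nonneg)
    then have "ln (sqrt (eh_u2 v) / (sqrt (eh_u2 v + t ^ 4) + t\<^sup>2)) = ln (eh_u2 v) / 2 - ln (sqrt (eh_u2 v + t ^ 4) + t\<^sup>2)"
      using m by (subst ln_div) (auto simp: ln_sqrt)
    then show ?thesis using m by (simp add: eh_potential_def u)
  qed
  show ?thesis
    by (rule has_derivative_transform_within_open[OF d open_eh_off_zero v]) (simp only: eq)
qed

lemma wirt_bar_eh_potential:
  assumes v: "v \<in> eh_off_zero" and t: "t \<noteq> 0"
  shows "wirt_bar Y (\<lambda>v. complex_of_real (eh_potential t (abs_H2 v))) v = of_real (eh_S t v) * cnj (eh_dlog v Y)"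
proof -
  have "frechet_derivative (\<lambda>v. complex_of_real (eh_potential t (abs_H2 v))) (at v) =
     (\<lambda>X. of_real (2 * eh_S t v * Re (eh_dlog v X)))"
    using frechet_derivative_at[OF has_derivative_eh_potential[OF assms]] by simp
  then show ?thesis by (simp add: wirt_bar_def complex_eq_iff)
qed

lemma has_derivative_eh_S:
  assumes v: "v \<in> eh_off_zero" and t: "t \<noteq> 0"
  shows "(eh_S t has_derivative (\<lambda>X. eh_u2 v / eh_S t v * (2 * Re (eh_dlog v X)))) (at v)"
proof -
  have pos: "eh_u2 v + t ^ 4 > 0" using eh_u2_pos[OF v] by (simp add: add_pos_nonneg)
  have "(sqrt has_derivative (*) (inverse (sqrt (eh_u2 v + t ^ 4)) / 2)) (at (eh_u2 v + t ^ 4))"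
    using DERIV_real_sqrt[OF pos] by (simp add: has_field_derivative_def)
  from has_derivative_compose[OF has_derivative_add_const[OF has_derivative_eh_u2[OF v]] this]
  show ?thesis by (simp add: eh_S_eh_u2[abs_def] field_simps)
qed

lemma has_derivative_eh_dlog:
  assumes v: "v \<in> eh_off_zero"
  shows "((\<lambda>v. eh_dlog v Y) has_derivative (\<lambda>X. (c1 Y * cnj (c1 X) + c2 Y * cnj (c2 X)) / of_real (eh_n v)
     - eh_in v Y * of_real (2 * Re (eh_in v X)) / of_real ((eh_n v)\<^sup>2) - c3 Y * c3 X / (2 * (c3 v)\<^sup>2))) (at v)"
proof -
  have nz: "complex_of_real (eh_n v) \<noteq> 0" "c3 v \<noteq> 0" using v eh_n_pos[of v] by (auto simp: eh_off_zero_def)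
  have 1: "((\<lambda>v. eh_in v Y) has_derivative (\<lambda>X. c1 Y * cnj (c1 X) + c2 Y * cnj (c2 X))) (at v)"
    unfolding eh_in_def by (intro has_derivative_add has_derivative_mult_right has_derivative_cnj has_derivative_c123)
  have two: "((\<lambda>v. 2 * c3 v) has_derivative (\<lambda>X. 2 * c3 X)) (at v)"
    by (intro has_derivative_mult_right has_derivative_c123)
  have 2: "((\<lambda>v. c3 Y / (2 * c3 v)) has_derivative (\<lambda>X. - c3 Y * c3 X / (2 * (c3 v)\<^sup>2))) (at v)"
    using has_derivative_divide'[OF has_derivative_const[of "c3 Y"] two] nz
    by (simp add: field_simps power2_eq_square)
  show ?thesis
    unfolding eh_dlog_def
    by (rule has_derivative_eq_rhs[OF has_derivative_add[OF has_derivative_divide'[OF 1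
            has_derivative_of_real[OF has_derivative_eh_n]] 2]])
       (use nz in \<open>auto simp: fun_eq_iff field_simps power2_eq_square\<close>)
qed

text \<open>The combination of values at X and at JX in \<open>wirt\<close> projects to the complex
  linear part: \<open>P\<close>, \<open>r\<close> and \<open>T\<close> pick up the factor \<i> and
  survive, their conjugates and that of \<open>q\<close> pick up -\<i> and drop out.\<close>

lemma wirt_algebra:
  fixes s :: complex
  shows "((s * (P - h * (r + cnj r) * c - cnj q) + m * (T + cnj T) * k)
    - \<i> * (s * (\<i> * P - h * (\<i> * r + - \<i> * cnj r) * c - - \<i> * cnj q) + m * (\<i> * T + - \<i> * cnj T) * k)) / 2
    = s * (P - h * r * c) + m * T * k"
  by (simp add: field_simps)

lemma wirt_wirt_bar_eh_potential:
  assumes v: "v \<in> eh_off_zero" and t: "t \<noteq> 0"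
  shows "wirt X (wirt_bar Y (\<lambda>v. complex_of_real (eh_potential t (abs_H2 v)))) v = eh_B t v X Y"
proof -
  let ?D = "\<lambda>X. complex_of_real (eh_S t v) * cnj ((c1 Y * cnj (c1 X) + c2 Y * cnj (c2 X)) / of_real (eh_n v)
     - eh_in v Y * of_real (2 * Re (eh_in v X)) / of_real ((eh_n v)\<^sup>2) - c3 Y * c3 X / (2 * (c3 v)\<^sup>2))
     + of_real (eh_u2 v / eh_S t v * (2 * Re (eh_dlog v X))) * cnj (eh_dlog v Y)"
  have "((\<lambda>v. of_real (eh_S t v) * cnj (eh_dlog v Y)) has_derivative ?D) (at v)"
    by (intro has_derivative_mult has_derivative_of_real has_derivative_cnj has_derivative_eh_S[OF v t]
        has_derivative_eh_dlog[OF v])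
  then have "(wirt_bar Y (\<lambda>v. complex_of_real (eh_potential t (abs_H2 v))) has_derivative ?D) (at v)"
    by (rule has_derivative_transform_within_open[OF _ open_eh_off_zero v])
       (simp add: wirt_bar_eh_potential t)
  from frechet_derivative_at[OF this]
  have fd: "frechet_derivative (wirt_bar Y (\<lambda>v. complex_of_real (eh_potential t (abs_H2 v)))) (at v) = ?D"
    by (rule sym)
  have nz: "complex_of_real (eh_n v) \<noteq> 0" "complex_of_real (eh_S t v) \<noteq> 0" "c3 v \<noteq> 0"
    using v eh_n_pos[of v] eh_S_pos[OF t, of v] by (auto simp: eh_off_zero_def)
  let ?\<kappa> = "(c1 X * cnj (c1 Y) + c2 X * cnj (c2 Y)) / of_real (eh_n v) - eh_in v X * cnj (eh_in v Y) / of_real ((eh_n v)\<^sup>2)"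
  define P where "P X = (c1 X * cnj (c1 Y) + c2 X * cnj (c2 Y)) / of_real (eh_n v)" for X
  define Q where "Q X = c3 Y * c3 X / (2 * (c3 v)\<^sup>2)" for X
  define c where "c = 1 / complex_of_real ((eh_n v)\<^sup>2)"
  have D: "?D X = of_real (eh_S t v) * (P X - cnj (eh_in v Y) * (eh_in v X + cnj (eh_in v X)) * c - cnj (Q X)) +
      of_real (eh_u2 v / eh_S t v) * (eh_dlog v X + cnj (eh_dlog v X)) * cnj (eh_dlog v Y)" for X
    by (simp add: complex_add_cnj P_def Q_def c_def mult.commute)
  have J: "P (cJ X) = \<i> * P X" "Q (cJ X) = \<i> * Q X"
    by (simp_all add: P_def Q_def algebra_simps add_divide_distrib)
  have "wirt X (wirt_bar Y (\<lambda>v. complex_of_real (eh_potential t (abs_H2 v)))) v =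
     of_real (eh_S t v) * (P X - cnj (eh_in v Y) * eh_in v X * c) + of_real (eh_u2 v / eh_S t v) * eh_dlog v X * cnj (eh_dlog v Y)"
    unfolding wirt_def fd D J eh_in_cJ eh_dlog_cJ complex_cnj_mult complex_cnj_i by (rule wirt_algebra)
  also have "\<dots> = of_real (eh_S t v) * ?\<kappa> + of_real (eh_u2 v / eh_S t v) * eh_dlog v X * cnj (eh_dlog v Y)"
    by (simp add: P_def c_def mult.commute)
  \<comment> \<open>Lagrange's identity in two complex dimensions: the Gram determinant of the pairs
    X, v and Y, v is a product of two wedge products.\<close>
  also have "?\<kappa> = eh_q v X * cnj (eh_q v Y)"
  proof -
    have "complex_of_real (eh_n v) * (c1 X * cnj (c1 Y) + c2 X * cnj (c2 Y)) - eh_in v X * cnj (eh_in v Y) =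
       (c1 X * c2 v - c2 X * c1 v) * cnj (c1 Y * c2 v - c2 Y * c1 v)"
      by (simp add: eh_n_def eh_in_def cmod_square algebra_simps)
    note L = this
    have "?\<kappa> = (complex_of_real (eh_n v) * (c1 X * cnj (c1 Y) + c2 X * cnj (c2 Y)) - eh_in v X * cnj (eh_in v Y)) / (of_real (eh_n v))\<^sup>2"
      using nz by (simp add: field_simps power2_eq_square)
    also have "\<dots> = eh_q v X * cnj (eh_q v Y)"
      unfolding L eh_q_def by (simp add: power2_eq_square)
    finally show ?thesis .
  qed
  \<comment> \<open>\<open>eh_p\<close> is \<open>eh_dlog\<close> multiplied by n \<gamma>, and the
    squared modulus of that factor is u_1^2.\<close>
  also have "of_real (eh_u2 v / eh_S t v) * eh_dlog v X * cnj (eh_dlog v Y) = eh_p v X * cnj (eh_p v Y) / of_real (eh_S t v)"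
  proof -
    have p: "eh_p v X = of_real (eh_n v) * c3 v * eh_dlog v X" for X
      using nz by (simp add: eh_p_def eh_dlog_def field_simps)
    have "complex_of_real (eh_u2 v) = of_real (eh_n v) * c3 v * (of_real (eh_n v) * cnj (c3 v))"
      by (simp add: eh_u2_def cmod_square power2_eq_square[of "complex_of_real (eh_n v)"])
    then show ?thesis unfolding p using nz by (simp add: field_simps)
  qed
  finally show ?thesis by (simp add: eh_B_def add.commute)
qed

lemma cnj_eh_B: "cnj (eh_B t v X Y) = eh_B t v Y X"
  by (simp add: eh_B_def mult.commute)

lemma i_del_delbar_eh_potential:
  assumes "v \<in> eh_off_zero" "t \<noteq> 0"
  shows "Re (i_del_delbar (\<lambda>v. complex_of_real (eh_potential t (abs_H2 v))) v X Y) = - 2 * Im (eh_B t v X Y)"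
proof -
  have "i_del_delbar (\<lambda>v. complex_of_real (eh_potential t (abs_H2 v))) v X Y =
      \<i> * (eh_B t v X Y - cnj (eh_B t v X Y))"
    unfolding i_del_delbar_def cnj_eh_B by (simp only: wirt_wirt_bar_eh_potential[OF assms])
  then show ?thesis by simp
qed

section \<open>Extension over the zero section\<close>

text \<open>Nothing degenerates at \<gamma> = 0: \<open>eh_p\<close> has no \<gamma> in a
  denominator, and S is positive as t does not vanish. So \<open>eh_B\<close> is the continuous
  extension that \<open>eh_form\<close> takes as a limit.\<close>

lemma continuous_on_eh_B:
  assumes "t \<noteq> 0"
  shows "continuous_on homog (\<lambda>v. eh_B t v X Y)"
proof -
  have "continuous_on homog eh_n" unfolding eh_n_def[abs_def] by (intro continuous_intros)
  moreover have "continuous_on homog (eh_S t)" unfolding eh_S_def[abs_def] eh_n_def[abs_def] by (intro continuous_intros)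
  moreover have "complex_of_real (eh_S t v) \<noteq> 0" for v using eh_S_pos[OF assms, of v] by simp
  moreover have "complex_of_real (eh_n v) \<noteq> 0" if "v \<in> homog" for v using eh_n_pos[OF that] by simp
  ultimately show ?thesis unfolding eh_B_def eh_p_def eh_q_def eh_in_def
    by (intro continuous_intros) auto
qed

lemma eh_form_eq:
  assumes v: "v \<in> homog" and t: "t \<noteq> 0"
  shows "eh_form t v X Y = - 2 * Im (eh_B t v X Y)"
proof -
  let ?\<omega> = "\<lambda>v. Re (i_del_delbar (\<lambda>v. complex_of_real (eh_potential t (abs_H2 v))) v X Y)"
  have N: "{(\<alpha>, \<beta>, \<gamma>) \<in> homog. \<gamma> \<noteq> 0} = eh_off_zero"
    by (auto simp: eh_off_zero_def)
  show ?thesis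
  proof (cases "v \<in> eh_off_zero")
    case True
    then show ?thesis using i_del_delbar_eh_potential[OF True t] by (simp add: eh_form_def N)
  next
    case False
    obtain a b where v_eq: "v = (a, b, 0)" using False v by (cases v) (auto simp: eh_off_zero_def)
    \<comment> \<open>\<open>Lim\<close> is determined only along a nontrivial filter; moving the
      third coordinate away from 0 approaches v from off the zero section.\<close>
    have "v islimpt eh_off_zero"
      unfolding islimpt_approachable
    proof (intro allI impI)
      fix e :: real assume "e > 0"
      then show "\<exists>v'\<in>eh_off_zero. v' \<noteq> v \<and> dist v' v < e"
        using v v_eq by (intro bexI[of _ "(a, b, of_real (e / 2))"])
          (auto simp: dist_Pair_Pair eh_off_zero_def homog_def dist_norm)
    qed
    then have nb: "at v within eh_off_zero \<noteq> bot" by (simp add: trivial_limit_within)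
    have "((\<lambda>v. - 2 * Im (eh_B t v X Y)) \<longlongrightarrow> - 2 * Im (eh_B t v X Y)) (at v)"
      using continuous_on_eh_B[OF t, of X Y] v open_homog
      by (intro tendsto_intros) (simp add: continuous_on_eq_continuous_at isCont_def)
    then have "((\<lambda>v. - 2 * Im (eh_B t v X Y)) \<longlongrightarrow> - 2 * Im (eh_B t v X Y)) (at v within eh_off_zero)"
      by (rule tendsto_within_subset) simp
    then have "(?\<omega> \<longlongrightarrow> - 2 * Im (eh_B t v X Y)) (at v within eh_off_zero)"
      using i_del_delbar_eh_potential[OF _ t]
      by (subst tendsto_cong[where g="\<lambda>v. - 2 * Im (eh_B t v X Y)"]) (auto simp: eventually_at_filter)
    from tendsto_Lim[OF nb this] show ?thesis using False by (simp add: eh_form_def N)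
  qed
qed

theorem eh_metric_eq:
  assumes "v \<in> homog" "t \<noteq> 0"
  shows "eh_metric t v X Y = 2 * Re (eh_B t v X Y)"
proof -
  have "eh_B t v X (cJ Y) = - \<i> * eh_B t v X Y" by (simp add: eh_B_def algebra_simps)
  then show ?thesis by (simp add: eh_metric_def eh_form_eq[OF assms])
qed

section \<open>The topology of \<open>H\<^sup>2\<close>\<close>

lemma abs_H2_eq_iff: "v \<in> homog \<Longrightarrow> w \<in> homog \<Longrightarrow> abs_H2 v = abs_H2 w \<longleftrightarrow> H2_rel v w"
  using Quotient_rel[OF Quotient_H2, of v w] by (simp add: H2_rel_refl_iff)

lemma abs_H2_surj: obtains v where "v \<in> homog" "abs_H2 v = p"
  using Quotient_abs_rep[OF Quotient_H2] Quotient_rep_reflp[OF Quotient_H2] H2_rel_refl_iff by metis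

definition act :: "complex \<Rightarrow> C3 \<Rightarrow> C3" where "act a v = (a * c1 v, a * c2 v, c3 v / a\<^sup>2)"

lemma act_homog: "a \<noteq> 0 \<Longrightarrow> act a v \<in> homog \<longleftrightarrow> v \<in> homog"
  by (simp add: act_def homog_iff)

lemma abs_H2_eq_iff_act:
  assumes "v \<in> homog" "w \<in> homog"
  shows "abs_H2 v = abs_H2 w \<longleftrightarrow> (\<exists>a. a \<noteq> 0 \<and> w = act a v)"
  unfolding abs_H2_eq_iff[OF assms] using assms
  by (cases v; cases w) (auto simp: act_def homog_def)

lemma abs_H2_act: "v \<in> homog \<Longrightarrow> a \<noteq> 0 \<Longrightarrow> abs_H2 (act a v) = abs_H2 v"
  using abs_H2_eq_iff_act[of v "act a v"] act_homog by auto

lemma continuous_on_abs_H2: "continuous_on homog abs_H2"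
  unfolding continuous_on_open_vimage[OF open_homog]
proof (intro allI impI)
  fix B :: "H2 set" assume "open B"
  moreover have "abs_H2 -` B \<inter> homog = {v \<in> homog. abs_H2 v \<in> B}" by auto
  ultimately show "open (abs_H2 -` B \<inter> homog)" by (simp add: open_H2_def)
qed

text \<open>The quotient map of a group action is open: the saturation of W is a union of preimages
  of W under the continuous maps \<open>act a\<close>.\<close>

lemma open_abs_H2_image:
  assumes "open W" "W \<subseteq> homog"
  shows "open (abs_H2 ` W)"
proof -
  have "{v \<in> homog. abs_H2 v \<in> abs_H2 ` W} = (\<Union>a\<in>-{0}. act a -` W \<inter> homog)"
  proof (intro set_eqI iffI)
    fix v assume "v \<in> {v \<in> homog. abs_H2 v \<in> abs_H2 ` W}"
    then obtain w where "v \<in> homog" "w \<in> W" "abs_H2 v = abs_H2 w" by auto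
    with assms(2) abs_H2_eq_iff_act[of v w] show "v \<in> (\<Union>a\<in>-{0}. act a -` W \<inter> homog)" by auto
  next
    fix v assume "v \<in> (\<Union>a\<in>-{0}. act a -` W \<inter> homog)"
    then obtain a where "a \<noteq> 0" "act a v \<in> W" "v \<in> homog" by auto
    then show "v \<in> {v \<in> homog. abs_H2 v \<in> abs_H2 ` W}"
      using abs_H2_act[of v a] by (metis (mono_tags) imageI mem_Collect_eq)
  qed
  moreover have "open (act a -` W \<inter> homog)" if "a \<noteq> 0" for a
  proof -
    have "continuous_on UNIV (act a)" unfolding act_def[abs_def] using that by (intro continuous_intros) auto
    then show ?thesis using assms(1) by (intro open_Int open_homog open_vimage)
  qed
  ultimately show ?thesis unfolding open_H2_def by (metis (no_types, lifting) ComplD open_UN singletonI)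
qed

text \<open>The universal property of the quotient, relative to an arbitrary subset. Passing to
  subsets is legitimate because the quotient map is open.\<close>

lemma continuous_on_H2:
  assumes "continuous_on {v \<in> homog. abs_H2 v \<in> S} (\<lambda>v. f (abs_H2 v))"
  shows "continuous_on S f"
  unfolding continuous_on_open_invariant
proof (intro allI impI)
  fix B :: "'a set" assume "open B"
  then obtain W where W: "open W" "W \<inter> {v \<in> homog. abs_H2 v \<in> S} = (\<lambda>v. f (abs_H2 v)) -` B \<inter> {v \<in> homog. abs_H2 v \<in> S}"
    using assms unfolding continuous_on_open_invariant by blast
  have "open (abs_H2 ` (W \<inter> homog))"
    by (rule open_abs_H2_image) (auto intro: open_Int W open_homog)
  moreover have "abs_H2 ` (W \<inter> homog) \<inter> S = f -` B \<inter> S"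
  proof (intro set_eqI iffI)
    fix p assume "p \<in> abs_H2 ` (W \<inter> homog) \<inter> S"
    then obtain v where "v \<in> W" "v \<in> homog" "p = abs_H2 v" "p \<in> S" by auto
    with W(2) show "p \<in> f -` B \<inter> S" by blast
  next
    fix p assume p: "p \<in> f -` B \<inter> S"
    obtain v where "v \<in> homog" "abs_H2 v = p" by (rule abs_H2_surj)
    with p W(2) show "p \<in> abs_H2 ` (W \<inter> homog) \<inter> S" by blast
  qed
  ultimately show "\<exists>A. open A \<and> A \<inter> S = f -` B \<inter> S" by blast
qed

lemma continuous_on_u1: "continuous_on S u1"
proof -
  have "continuous_on homog (\<lambda>v. eh_n v * cmod (c3 v))" unfolding eh_n_def by (intro continuous_intros)
  then have "continuous_on homog (\<lambda>v. u1 (abs_H2 v))" by (rule continuous_on_eq) (simp add: u1_abs_H2)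
  then show ?thesis by (intro continuous_on_H2) (auto elim: continuous_on_subset)
qed

lemma proj_abs_H2: "v \<in> homog \<Longrightarrow> proj (abs_H2 v) = (if c2 v = 0 then Infty else Fin (c1 v / c2 v))"
  using proj.abs_eq[OF H2_rel_refl_iff[THEN iffD2], of v] by (cases v) simp

section \<open>Closed curves and their horizontal lifts\<close>

lemma smooth_on_has_vector_derivative:
  fixes f :: "real \<Rightarrow> 'b::real_normed_vector"
  assumes "smooth_on UNIV f"
  shows "(f has_vector_derivative vector_derivative f (at s)) (at s)"
  using smooth_on_has_derivative[OF assms, of s]
  by (simp add: vector_derivative_works[symmetric] differentiableI)

lemma smooth_on_vector_derivative:
  fixes f :: "real \<Rightarrow> 'b::real_normed_vector"
  assumes "smooth_on UNIV f"
  shows "smooth_on UNIV (\<lambda>s. vector_derivative f (at s))"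
proof -
  have "vector_derivative f (at s) = frechet_derivative f (at s) 1" for s
    using frechet_derivative_at[OF smooth_on_has_vector_derivative[OF assms, unfolded has_vector_derivative_def], of s]
    by (metis scaleR_one)
  then show ?thesis using smooth_on_frechet_derivative[OF assms, of 1] by simp
qed

lemma smooth_on_cis:
  fixes \<theta> :: "real \<Rightarrow> real"
  assumes "smooth_on UNIV \<theta>"
  shows "smooth_on UNIV (\<lambda>s. cis (\<theta> s))"
proof -
  have "Ck_on k UNIV cis" for k
  proof (induction k)
    case 0
    show ?case by (simp add: continuous_intros)
  next
    case (Suc k)
    show ?case
    proof (rule Ck_on_real_SucI[OF open_UNIV])
      show "(cis has_vector_derivative \<i> * cis s) (at s)" for s
        using has_derivative_cis[OF has_derivative_ident, of s UNIV]
        by (simp add: has_vector_derivative_def)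
      show "Ck_on k UNIV (\<lambda>s. \<i> * cis s)"
        by (rule Ck_on_bounded_linear_comp[OF open_UNIV bounded_linear_mult_right Suc])
    qed
  qed
  then show ?thesis
    by (intro smooth_on_compose[OF _ open_UNIV assms]) (auto intro: smooth_onI)
qed

lemma smooth_antiderivative:
  fixes f :: "real \<Rightarrow> real"
  assumes "smooth_on UNIV f"
  obtains F where "smooth_on UNIV F" "\<And>s. (F has_vector_derivative f s) (at s)"
proof -
  have "isCont f s" for s
    using smooth_on_imp_continuous_on[OF assms] by (simp add: continuous_on_eq_continuous_at)
  then have "\<exists>F. \<forall>s. (F has_vector_derivative f s) (at s)"
    using einterval_antiderivative[of "-\<infinity>" "\<infinity>" f] by auto
  then obtain F where F: "\<And>s. (F has_vector_derivative f s) (at s)" by blast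
  show thesis by (rule that[OF smooth_on_realI[OF open_UNIV F assms] F])
qed

lemma U2_relations:
  assumes "A \<in> U2"
  shows "cnj (A$1$1) * A$1$1 + cnj (A$2$1) * A$2$1 = 1" "cnj (A$1$2) * A$1$2 + cnj (A$2$2) * A$2$2 = 1"
    "cnj (A$1$1) * A$1$2 + cnj (A$2$1) * A$2$2 = 0" "cnj (A$1$2) * A$1$1 + cnj (A$2$2) * A$2$1 = 0"
    "A$1$1 * cnj (A$1$1) + A$1$2 * cnj (A$1$2) = 1" "A$2$1 * cnj (A$2$1) + A$2$2 * cnj (A$2$2) = 1"
    "A$1$1 * cnj (A$2$1) + A$1$2 * cnj (A$2$2) = 0" "A$2$1 * cnj (A$1$1) + A$2$2 * cnj (A$1$2) = 0"
    "A$1$1 * A$2$2 - A$1$2 * A$2$1 \<noteq> 0"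
proof -
  let ?B = "\<chi> i j. cnj (A $ j $ i)"
  have 1: "?B ** A = mat 1" using assms by (simp add: U2_def)
  then have 2: "A ** ?B = mat 1" by (simp add: matrix_left_right_inverse)
  from 1 have 3: "(?B ** A) $ i $ j = (if i = j then 1 else 0)" for i j by (simp add: mat_def)
  from 2 have 4: "(A ** ?B) $ i $ j = (if i = j then 1 else 0)" for i j by (simp add: mat_def)
  from 3[of 1 1] 3[of 1 2] 3[of 2 1] 3[of 2 2] 4[of 1 1] 4[of 1 2] 4[of 2 1] 4[of 2 2]
  show "cnj (A$1$1) * A$1$1 + cnj (A$2$1) * A$2$1 = 1" "cnj (A$1$2) * A$1$2 + cnj (A$2$2) * A$2$2 = 1"
    "cnj (A$1$1) * A$1$2 + cnj (A$2$1) * A$2$2 = 0" "cnj (A$1$2) * A$1$1 + cnj (A$2$2) * A$2$1 = 0"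
    "A$1$1 * cnj (A$1$1) + A$1$2 * cnj (A$1$2) = 1" "A$2$1 * cnj (A$2$1) + A$2$2 * cnj (A$2$2) = 1"
    "A$1$1 * cnj (A$2$1) + A$1$2 * cnj (A$2$2) = 0" "A$2$1 * cnj (A$1$1) + A$2$2 * cnj (A$1$2) = 0"
    by (simp_all add: matrix_matrix_mult_def sum_2)
  have "invertible A" using 1 2 by (auto simp: invertible_def)
  then show "A$1$1 * A$2$2 - A$1$2 * A$2$1 \<noteq> 0"
    by (simp add: invertible_det_nz det_2)
qed

section \<open>Parameters of a simple closed curve\<close>

locale closed_curve =
  fixes c :: "real \<Rightarrow> complex" and l :: real
  assumes l_pos: "l > 0" and smooth_c: "smooth_on UNIV c" and periodic: "\<And>s. c (s + l) = c s"
    and inj_c: "inj_on c {0..<l}" and c'_nz: "\<And>s. vector_derivative c (at s) \<noteq> 0"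
begin

lemma c_cont: "continuous_on S c"
  using smooth_on_imp_continuous_on[OF smooth_c] continuous_on_subset by blast

lemma c_add_int: "c (s + of_int k * l) = c s"
proof -
  have nat: "c (s + of_nat n * l) = c s" for n s
  proof (induction n)
    case (Suc n)
    then show ?case using periodic[of "s + of_nat n * l"] by (simp add: algebra_simps)
  qed simp
  show ?thesis
  proof (cases "k \<ge> 0")
    case True
    then show ?thesis using nat[of s "nat k"] by simp
  next
    case False
    then show ?thesis using nat[of "s + of_int k * l" "nat (- k)"] by (simp add: algebra_simps)
  qed
qed

lemma reduce: obtains k :: int where "s + of_int k * l \<in> {a..<a + l}"
proof
  let ?f = "\<lfloor>(s - a) / l\<rfloor>"
  have "of_int ?f \<le> (s - a) / l" "(s - a) / l < of_int ?f + 1" by linarith+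
  then have "of_int ?f * l \<le> s - a" "s - a < (of_int ?f + 1) * l"
    using l_pos by (simp_all only: pos_le_divide_eq pos_divide_less_eq)
  then show "s + of_int (- ?f) * l \<in> {a..<a + l}"
    by (simp add: algebra_simps)
qed

lemma c_eq_iff: "c s = c s' \<longleftrightarrow> (\<exists>k::int. s' = s + of_int k * l)"
proof
  assume eq: "c s = c s'"
  obtain k where k: "s + of_int k * l \<in> {0..<0 + l}" by (rule reduce)
  obtain k' where k': "s' + of_int k' * l \<in> {0..<0 + l}" by (rule reduce)
  have "s + of_int k * l = s' + of_int k' * l"
    by (rule inj_onD[OF inj_c]) (use k k' eq in \<open>simp_all add: c_add_int\<close>)
  then show "\<exists>k::int. s' = s + of_int k * l" by (intro exI[of _ "k - k'"]) (simp add: algebra_simps)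
qed (auto simp: c_add_int)

lemma inj_on_period: "inj_on c {a..<a + l}"
proof (rule inj_onI)
  fix s s' assume s: "s \<in> {a..<a + l}" "s' \<in> {a..<a + l}" and "c s = c s'"
  then obtain k :: int where k: "s' = s + of_int k * l" by (auto simp: c_eq_iff)
  have "\<bar>of_int k * l\<bar> < 1 * l" using s k by auto
  then have "\<bar>real_of_int k\<bar> < 1" using l_pos by (simp add: abs_mult)
  then have "k = 0" by linarith
  then show "s = s'" using k by simp
qed

lemma range_c: "range c = c ` {a..<a + l}"
proof -
  have "c s \<in> c ` {a..<a + l}" for s
    by (rule reduce[of s a]) (metis c_add_int imageI)
  then show ?thesis by blast
qed

text \<open>Continuity of the inverse of c modulo the period: one full period with a neighbourhood
  of s0 removed has a compact image that misses c s0, so it stays at a positive distance.\<close>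

lemma c_near:
  assumes "e > 0"
  obtains d where "d > 0" "\<And>s. dist (c s) (c s0) < d \<Longrightarrow> \<exists>k::int. \<bar>s + of_int k * l - s0\<bar> < e"
proof -
  \<comment> \<open>The period is centred at s0 and closed for compactness. All its points are
    within l/2 of s0, so the only translate of s0 in it is s0 itself.\<close>
  let ?K = "{s0 - l / 2..s0 - l / 2 + l} - {s0 - e<..<s0 + e}"
  have "compact ?K" by (intro compact_diff) auto
  then have cK: "compact (c ` ?K)" by (rule compact_continuous_image[OF c_cont])
  have "c s0 \<notin> c ` ?K"
  proof
    assume "c s0 \<in> c ` ?K"
    then obtain s where s: "s \<in> ?K" "c s0 = c s" by blast
    then obtain k :: int where k: "s = s0 + of_int k * l" by (auto simp: c_eq_iff)
    have "\<bar>of_int k * l\<bar> \<le> (1/2) * l" using s k by auto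
    then have "\<bar>real_of_int k\<bar> \<le> 1/2" using l_pos by (simp add: abs_mult)
    then have "k = 0" by linarith
    then show False using s k assms by auto
  qed
  moreover have "closed (c ` ?K)" using cK by (rule compact_imp_closed)
  ultimately obtain d where d: "d > 0" "\<And>z. z \<in> c ` ?K \<Longrightarrow> d \<le> dist (c s0) z"
    using separate_point_closed[of "c ` ?K" "c s0"] by blast
  show thesis
  proof (rule that[OF d(1)])
    fix s assume s: "dist (c s) (c s0) < d"
    obtain k where k: "s + of_int k * l \<in> {s0 - l / 2..<s0 - l / 2 + l}" by (rule reduce)
    have "s + of_int k * l \<notin> ?K"
    proof
      assume "s + of_int k * l \<in> ?K"
      then have "c (s + of_int k * l) \<in> c ` ?K" by (rule imageI)
      from d(2)[OF this] s show False by (simp add: c_add_int dist_commute)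
    qed
    then show "\<exists>k::int. \<bar>s + of_int k * l - s0\<bar> < e" using k by (intro exI[of _ k]) auto
  qed
qed

text \<open>The functional \<open>L\<close> is chosen so that \<open>L \<circ> c\<close> is strictly increasing near \<open>s0\<close>.\<close>
lemma local_inverse:
  assumes "e0 > 0"
  obtains e J T L where "0 < e" "e \<le> e0" "open T" "smooth_on T J" "bounded_linear L"
    "\<And>s. \<bar>s - s0\<bar> < e \<Longrightarrow> L (c s) \<in> T \<and> J (L (c s) :: real) = (s::real)"
proof -
  let ?c' = "\<lambda>s. vector_derivative c (at s)"
  define L where "L z = z \<bullet> ?c' s0" for z
  have L: "bounded_linear L" unfolding L_def by (rule bounded_linear_inner_left)
  define r where "r s = L (c s)" for s
  define r' where "r' s = L (?c' s)" for s
  have sr: "smooth_on UNIV r" unfolding r_def by (rule smooth_on_bounded_linear_comp[OF open_UNIV L smooth_c])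
  have sr': "smooth_on UNIV r'"
    unfolding r'_def by (rule smooth_on_bounded_linear_comp[OF open_UNIV L smooth_on_vector_derivative[OF smooth_c]])
  have dr: "(r has_real_derivative r' s) (at s)" for s
    using bounded_linear.has_vector_derivative[OF L smooth_on_has_vector_derivative[OF smooth_c]]
    by (simp add: r_def[abs_def] r'_def has_real_derivative_iff_has_vector_derivative)
  have "r' s0 > 0" using c'_nz[of s0] by (simp add: r'_def L_def)
  moreover have "isCont r' s0" using smooth_on_imp_continuous_on[OF sr'] by (simp add: continuous_on_eq_continuous_at)
  ultimately have "\<forall>\<^sub>F s in at s0. r' s > 0"
    using order_tendstoD(1)[of r' "r' s0" "at s0" 0] by (simp add: isCont_def)
  then obtain e1 where e1: "e1 > 0" "\<And>s. s \<noteq> s0 \<Longrightarrow> dist s s0 < e1 \<Longrightarrow> r' s > 0"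
    by (auto simp: eventually_at)
  define e where "e = min e0 (e1 / 2)"
  have e: "e > 0" "e \<le> e0" "e < e1" using e1 assms by (auto simp: e_def)
  have r'_pos: "r' s > 0" if "\<bar>s - s0\<bar> \<le> e" for s
    using e1(2)[of s] that e \<open>r' s0 > 0\<close> by (cases "s = s0") (auto simp: dist_real_def)
  have mono: "r s < r s'" if "s < s'" "\<bar>s - s0\<bar> \<le> e" "\<bar>s' - s0\<bar> \<le> e" for s s'
  proof (rule DERIV_pos_imp_increasing[OF that(1)])
    fix x assume "s \<le> x" "x \<le> s'"
    then have "\<bar>x - s0\<bar> \<le> e" using that by linarith
    then show "\<exists>y. (r has_real_derivative y) (at x) \<and> 0 < y" using dr r'_pos by blast
  qed
  define I where "I = {s0 - e..s0 + e}"
  have inj: "inj_on r I"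
  proof (rule inj_onI)
    fix x y assume "x \<in> I" "y \<in> I" and eq: "r x = r y"
    then have "\<bar>x - s0\<bar> \<le> e" "\<bar>y - s0\<bar> \<le> e" by (auto simp: I_def)
    then show "x = y" using mono[of x y] mono[of y x] eq by (cases x y rule: linorder_cases) simp_all
  qed
  define J where "J = the_inv_into I r"
  have Jr: "J (r s) = s" if "s \<in> I" for s unfolding J_def by (rule the_inv_into_f_f[OF inj that])
  have rcont: "continuous_on S r" for S using smooth_on_imp_continuous_on[OF sr] continuous_on_subset by blast
  define T where "T = {r (s0 - e)<..<r (s0 + e)}"
  have TJ: "\<exists>s\<in>{s0 - e<..<s0 + e}. r s = y" if "y \<in> T" for y
  proof -
    have "\<exists>s\<ge>s0 - e. s \<le> s0 + e \<and> r s = y"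
      by (rule IVT') (use that e rcont in \<open>auto simp: T_def\<close>)
    then obtain s where s: "s0 - e \<le> s" "s \<le> s0 + e" "r s = y" by blast
    then show ?thesis using that by (intro bexI[of _ s]) (auto simp: T_def order_less_le)
  qed
  have JT: "J y \<in> {s0 - e<..<s0 + e}" "r (J y) = y" if "y \<in> T" for y
    using TJ[OF that] Jr by (auto simp: I_def)
  have Jcont: "continuous_on T J"
  proof -
    have "continuous_on (r ` I) J"
      by (rule continuous_on_inv) (use Jr rcont in \<open>auto simp: I_def\<close>)
    moreover have "T \<subseteq> r ` I" using TJ by (fastforce simp: I_def)
    ultimately show ?thesis by (rule continuous_on_subset)
  qed
  have r'J: "r' (J y) > 0" if "y \<in> T" for y
  proof (rule r'_pos)
    show "\<bar>J y - s0\<bar> \<le> e" using JT(1)[OF that] by (simp add: abs_le_iff)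
  qed
  have dJ: "(J has_vector_derivative inverse (r' (J y))) (at y)" if "y \<in> T" for y
  proof -
    have "(J has_real_derivative inverse (r' (J y))) (at y)"
    proof (rule DERIV_inverse_function[where f=r and a="r (s0 - e)" and b="r (s0 + e)"])
      show "(r has_real_derivative r' (J y)) (at (J y))" by (rule dr)
      show "r' (J y) \<noteq> 0" using r'J[OF that] by simp
      show "isCont J y" using Jcont that by (auto simp: continuous_on_eq_continuous_at T_def)
      show "r (J z) = z" if "r (s0 - e) < z" "z < r (s0 + e)" for z
        using JT[of z] that by (auto simp: T_def)
    qed (use that in \<open>auto simp: T_def\<close>)
    then show ?thesis by (simp add: has_real_derivative_iff_has_vector_derivative)
  qed
  have oT: "open T" by (simp add: T_def)
  \<comment> \<open>The derivative of J is the inverse of r' composed with J, so J of class C^k has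
    a derivative of class C^k.\<close>
  have "smooth_on T J"
  proof (rule smooth_onI)
    fix k show "Ck_on k T J"
    proof (induction k)
      case (Suc k)
      have r'J_Ck: "Ck_on k T (\<lambda>y. r' (J y))"
        by (rule Ck_on_compose[OF oT open_UNIV Suc smooth_onD[OF sr']]) auto
      have "Ck_on k T (\<lambda>y. inverse (r' (J y)))"
        by (rule Ck_on_compose[OF oT open_greaterThan r'J_Ck smooth_onD[OF smooth_on_inverse_real]])
           (use r'J in auto)
      from Ck_on_real_SucI[OF oT dJ this] show ?case .
    qed (use Jcont in simp)
  qed
  moreover have "L (c s) \<in> T \<and> J (L (c s)) = s" if "\<bar>s - s0\<bar> < e" for s
  proof -
    have "r s \<in> T" unfolding T_def using that e by (auto intro!: mono)
    moreover have "J (r s) = s" using that by (intro Jr) (auto simp: I_def)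
    ultimately show ?thesis by (simp add: r_def)
  qed
  ultimately show thesis using that e oT L by blast
qed

end

section \<open>Unit lifts and horizontal lifts\<close>

lemma U2_norm:
  assumes "A \<in> U2"
  shows "(cmod (A$1$1 * z + A$1$2))\<^sup>2 + (cmod (A$2$1 * z + A$2$2))\<^sup>2 = 1 + (cmod z)\<^sup>2"
proof -
  let ?a = "A$1$1" and ?b = "A$1$2" and ?c = "A$2$1" and ?d = "A$2$2"
  have "(?a * z + ?b) * cnj (?a * z + ?b) + (?c * z + ?d) * cnj (?c * z + ?d) =
     (cnj ?a * ?a + cnj ?c * ?c) * (z * cnj z) + (cnj ?b * ?a + cnj ?d * ?c) * z
     + (cnj ?a * ?b + cnj ?c * ?d) * cnj z + (cnj ?b * ?b + cnj ?d * ?d)"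
    by (simp add: algebra_simps)
  also have "\<dots> = 1 + z * cnj z" by (simp only: U2_relations[OF assms]) simp
  finally have "complex_of_real ((cmod (A$1$1 * z + A$1$2))\<^sup>2 + (cmod (A$2$1 * z + A$2$2))\<^sup>2) = complex_of_real (1 + (cmod z)\<^sup>2)"
    by (simp add: cmod_square)
  then show ?thesis using of_real_eq_iff by blast
qed

text \<open>A curve on a sphere moves orthogonally to its position, so for a unit lift only the
  imaginary part of the Hermitian product is left, and that can be removed by a phase.\<close>

lemma has_vector_derivative_norm2_const:
  fixes e f :: "real \<Rightarrow> complex"
  assumes d: "(e has_vector_derivative e') (at s)" "(f has_vector_derivative f') (at s)"
    and n: "\<And>s. (cmod (e s))\<^sup>2 + (cmod (f s))\<^sup>2 = k"
  shows "Re (e' * cnj (e s) + f' * cnj (f s)) = 0"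
proof -
  have "((\<lambda>s. (cmod (e s))\<^sup>2 + (cmod (f s))\<^sup>2) has_derivative
      (\<lambda>h. 2 * Re ((h *\<^sub>R e') * cnj (e s)) + 2 * Re ((h *\<^sub>R f') * cnj (f s)))) (at s)"
    using d unfolding has_vector_derivative_def by (intro has_derivative_add has_derivative_norm2)
  moreover have "((\<lambda>s. (cmod (e s))\<^sup>2 + (cmod (f s))\<^sup>2) has_derivative (\<lambda>h. 0)) (at s)"
    unfolding n by simp
  ultimately have "(\<lambda>h. 2 * Re ((h *\<^sub>R e') * cnj (e s)) + 2 * Re ((h *\<^sub>R f') * cnj (f s))) = (\<lambda>h. 0)"
    by (rule has_derivative_unique)
  from fun_cong[OF this, of 1] show ?thesis by simp
qed

text \<open>Component k of \<mu> times A applied to the vector (c, 1). Indexing by the type 2 treats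
  both components at once.\<close>

definition frame :: "complex^2^2 \<Rightarrow> (real \<Rightarrow> complex) \<Rightarrow> (real \<Rightarrow> complex) \<Rightarrow> 2 \<Rightarrow> real \<Rightarrow> complex" where
  "frame A c \<mu> k s = \<mu> s * (A$k$1 * c s + A$k$2)"

lemma smooth_on_frame:
  assumes "smooth_on UNIV c" "smooth_on UNIV \<mu>"
  shows "smooth_on UNIV (frame A c \<mu> k)"
  unfolding frame_def[abs_def]
  by (intro smooth_on_mult smooth_on_add smooth_on_const open_UNIV assms)

text \<open>For the normalized lift e the product of e' with the conjugate of e is \<i> \<kappa>
  with real \<kappa>. Multiplying e by a phase exp(-\<i> \<theta>) with \<theta>' = \<kappa>
  subtracts exactly this term.\<close>

lemma (in closed_curve) horizontal_lift:
  assumes A: "A \<in> U2"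
  obtains \<mu> where "smooth_on UNIV \<mu>" "\<And>s. (cmod (\<mu> s))\<^sup>2 * (1 + (cmod (c s))\<^sup>2) = 1"
    "\<And>s. vector_derivative (frame A c \<mu> 1) (at s) * cnj (frame A c \<mu> 1 s) +
         vector_derivative (frame A c \<mu> 2) (at s) * cnj (frame A c \<mu> 2 s) = 0"
proof -
  define m where "m s = complex_of_real (inverse (sqrt (1 + (cmod (c s))\<^sup>2)))" for s
  have pos: "1 + (cmod (c s))\<^sup>2 > 0" for s by (simp add: add_pos_nonneg)
  have sm: "smooth_on UNIV m"
    unfolding m_def
    by (intro smooth_on_of_real smooth_on_compose[OF _ _ _ smooth_on_inverse_real]
        smooth_on_compose[OF _ _ _ smooth_on_sqrt] smooth_on_add smooth_on_const smooth_on_norm2 smooth_c)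
       (use pos in auto)
  define e where "e = frame A c m"
  have se: "smooth_on UNIV (e k)" for k unfolding e_def by (rule smooth_on_frame[OF smooth_c sm])
  define e' where "e' k s = vector_derivative (e k) (at s)" for k s
  have de: "(e k has_vector_derivative e' k s) (at s)" for k s
    unfolding e'_def by (rule smooth_on_has_vector_derivative[OF se])
  have m2: "(cmod (m s))\<^sup>2 * (1 + (cmod (c s))\<^sup>2) = 1" for s
    using pos[of s] by (simp add: m_def norm_inverse power_inverse)
  have unit: "(cmod (e 1 s))\<^sup>2 + (cmod (e 2 s))\<^sup>2 = 1" for s
    using m2[of s] U2_norm[OF A, of "c s"]
    by (simp add: e_def frame_def norm_mult power_mult_distrib flip: distrib_left)
  define \<kappa> where "\<kappa> s = Im (e' 1 s * cnj (e 1 s) + e' 2 s * cnj (e 2 s))" for s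
  have s\<kappa>: "smooth_on UNIV \<kappa>"
    unfolding \<kappa>_def e'_def
    by (intro smooth_on_Im smooth_on_add smooth_on_mult smooth_on_cnj smooth_on_vector_derivative open_UNIV se)
  obtain \<theta> where \<theta>: "smooth_on UNIV \<theta>" "\<And>s. (\<theta> has_vector_derivative \<kappa> s) (at s)"
    using smooth_antiderivative[OF s\<kappa>] by metis
  have re: "Re (e' 1 s * cnj (e 1 s) + e' 2 s * cnj (e 2 s)) = 0" for s
    by (rule has_vector_derivative_norm2_const[OF de de unit])
  define p where "p s = cis (- \<theta> s)" for s
  have sp: "smooth_on UNIV p" unfolding p_def by (intro smooth_on_cis smooth_on_minus \<theta> open_UNIV)
  have dp: "(p has_vector_derivative (- \<i> * \<kappa> s * p s)) (at s)" for s
  proof -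
    have "((\<lambda>s. - \<theta> s) has_derivative (\<lambda>h. - (h *\<^sub>R \<kappa> s))) (at s)"
      using \<theta>(2)[of s] unfolding has_vector_derivative_def by (rule has_derivative_minus)
    from has_derivative_cis[OF this] show ?thesis
      by (simp add: has_vector_derivative_def p_def[abs_def] scaleR_conv_of_real algebra_simps)
  qed
  define \<mu> where "\<mu> s = p s * m s" for s
  have fr: "frame A c \<mu> k = (\<lambda>s. p s * e k s)" for k by (simp add: fun_eq_iff frame_def \<mu>_def e_def)
  have vd: "vector_derivative (frame A c \<mu> k) (at s) = p s * (e' k s - \<i> * \<kappa> s * e k s)" for k s
  proof (rule vector_derivative_at)
    show "(frame A c \<mu> k has_vector_derivative p s * (e' k s - \<i> * \<kappa> s * e k s)) (at s)"
      unfolding fr using has_vector_derivative_mult[OF dp de] by (simp add: algebra_simps)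
  qed
  have pp: "p s * cnj (p s) = 1" for s by (simp add: p_def cis_cnj cis_mult)
  have ee: "e 1 s * cnj (e 1 s) + e 2 s * cnj (e 2 s) = 1" for s
    using unit[of s] by (metis cmod_square of_real_1 of_real_add of_real_power)
  have \<kappa>: "e' 1 s * cnj (e 1 s) + e' 2 s * cnj (e 2 s) = \<i> * \<kappa> s" for s
    using re[of s] by (simp add: complex_eq_iff \<kappa>_def)
  have hor: "vector_derivative (frame A c \<mu> 1) (at s) * cnj (frame A c \<mu> 1 s) +
         vector_derivative (frame A c \<mu> 2) (at s) * cnj (frame A c \<mu> 2 s) = 0" for s
  proof -
    have "vector_derivative (frame A c \<mu> 1) (at s) * cnj (frame A c \<mu> 1 s) +
         vector_derivative (frame A c \<mu> 2) (at s) * cnj (frame A c \<mu> 2 s) =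
       (p s * cnj (p s)) * ((e' 1 s * cnj (e 1 s) + e' 2 s * cnj (e 2 s))
         - \<i> * \<kappa> s * (e 1 s * cnj (e 1 s) + e 2 s * cnj (e 2 s)))"
      unfolding vd unfolding fr by (simp add: algebra_simps)
    then show ?thesis unfolding pp ee \<kappa> by simp
  qed
  show thesis
  proof (rule that[OF _ _ hor])
    show "smooth_on UNIV \<mu>" unfolding \<mu>_def by (intro smooth_on_mult open_UNIV sp sm)
    show "(cmod (\<mu> s))\<^sup>2 * (1 + (cmod (c s))\<^sup>2) = 1" for s
      using m2[of s] by (simp add: \<mu>_def norm_mult p_def)
  qed
qed

text \<open>With \<open>A \<in> U(2)\<close> applied to a lift of the curve to \<open>\<complex>\<^sup>2\<close>, points of the transformed curve at infinity need no
  special treatment. The phase of \<open>\<mu>\<close> makes the unit lift horizontal, which turns the metric of the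
  chart \<open>\<Phi>\<close> into a diagonal matrix.\<close>

locale lifted_curve = closed_curve c l for c l +
  fixes A :: "complex^2^2" and \<mu> :: "real \<Rightarrow> complex" and t :: real
  assumes A: "A \<in> U2" and t_nz: "t \<noteq> 0" and smooth_\<mu>: "smooth_on UNIV \<mu>"
    and \<mu>_norm: "\<And>s. (cmod (\<mu> s))\<^sup>2 * (1 + (cmod (c s))\<^sup>2) = 1"
    and horizontal: "\<And>s. vector_derivative (frame A c \<mu> 1) (at s) * cnj (frame A c \<mu> 1 s) +
         vector_derivative (frame A c \<mu> 2) (at s) * cnj (frame A c \<mu> 2 s) = 0"
begin

abbreviation \<sigma> :: "2 \<Rightarrow> real \<Rightarrow> complex" where "\<sigma> \<equiv> frame A c \<mu>"
definition \<sigma>' :: "2 \<Rightarrow> real \<Rightarrow> complex" where "\<sigma>' k s = vector_derivative (\<sigma> k) (at s)"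
definition \<rho> :: "real \<Rightarrow> real" where "\<rho> s = cmod (\<sigma>' 1 s * \<sigma> 2 s - \<sigma>' 2 s * \<sigma> 1 s)"

lemma smooth_\<sigma>: "smooth_on UNIV (\<sigma> k)"
  by (rule smooth_on_frame[OF smooth_c smooth_\<mu>])

lemma \<sigma>_deriv: "(\<sigma> k has_vector_derivative \<sigma>' k s) (at s)"
  unfolding \<sigma>'_def by (rule smooth_on_has_vector_derivative[OF smooth_\<sigma>])

lemma \<sigma>_horizontal: "\<sigma>' 1 s * cnj (\<sigma> 1 s) + \<sigma>' 2 s * cnj (\<sigma> 2 s) = 0"
  using horizontal by (simp add: \<sigma>'_def)

lemma \<mu>_nz: "\<mu> s \<noteq> 0"
  using \<mu>_norm[of s] by auto

lemma \<sigma>_unit: "(cmod (\<sigma> 1 s))\<^sup>2 + (cmod (\<sigma> 2 s))\<^sup>2 = 1"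
  using \<mu>_norm[of s] U2_norm[OF A, of "c s"]
  by (simp add: frame_def norm_mult power_mult_distrib flip: distrib_left)

lemma \<sigma>_unit': "\<sigma> 1 s * cnj (\<sigma> 1 s) + \<sigma> 2 s * cnj (\<sigma> 2 s) = 1"
  using \<sigma>_unit[of s] by (metis cmod_square of_real_1 of_real_add of_real_power)

text \<open>The contribution of the derivative of \<mu> is proportional to the lift itself and
  cancels in the wedge product. What is left does not vanish, since c is regular and A
  invertible.\<close>

lemma wedge: "\<sigma>' 1 s * \<sigma> 2 s - \<sigma>' 2 s * \<sigma> 1 s =
    (\<mu> s)\<^sup>2 * vector_derivative c (at s) * (A$1$1 * A$2$2 - A$1$2 * A$2$1)"
proof -
  have d: "\<sigma>' k s = vector_derivative \<mu> (at s) * (A$k$1 * c s + A$k$2) + \<mu> s * (A$k$1 * vector_derivative c (at s))" for k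
  proof -
    have "(\<sigma> k has_vector_derivative
      \<mu> s * (A$k$1 * vector_derivative c (at s) + 0) + vector_derivative \<mu> (at s) * (A$k$1 * c s + A$k$2)) (at s)"
      unfolding frame_def[abs_def]
      by (intro has_vector_derivative_mult has_vector_derivative_add has_vector_derivative_mult_right
          has_vector_derivative_const smooth_on_has_vector_derivative smooth_c smooth_\<mu>)
    from vector_derivative_unique_at[OF \<sigma>_deriv this] show ?thesis by simp
  qed
  show ?thesis unfolding d by (simp add: frame_def power2_eq_square algebra_simps)
qed

lemma \<rho>_pos: "\<rho> s > 0"
  unfolding \<rho>_def wedge using \<mu>_nz c'_nz U2_relations(9)[OF A] by simp

lemma smooth_\<rho>: "smooth_on UNIV \<rho>"
proof -
  have "smooth_on UNIV (\<lambda>s. sqrt ((cmod (\<sigma>' 1 s * \<sigma> 2 s - \<sigma>' 2 s * \<sigma> 1 s))\<^sup>2))"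
  proof (rule smooth_on_compose[OF open_UNIV open_greaterThan _ smooth_on_sqrt])
    show "smooth_on UNIV (\<lambda>s. (cmod (\<sigma>' 1 s * \<sigma> 2 s - \<sigma>' 2 s * \<sigma> 1 s))\<^sup>2)"
      unfolding \<sigma>'_def
      by (intro smooth_on_norm2 smooth_on_diff smooth_on_mult smooth_on_vector_derivative smooth_\<sigma> open_UNIV)
    have "0 < (\<rho> s)\<^sup>2" for s using \<rho>_pos[of s] by simp
    then show "(\<lambda>s. (cmod (\<sigma>' 1 s * \<sigma> 2 s - \<sigma>' 2 s * \<sigma> 1 s))\<^sup>2) ` UNIV \<subseteq> {0<..}"
      unfolding \<rho>_def by blast
  qed
  then show ?thesis by (simp add: \<rho>_def[abs_def])
qed

text \<open>\<open>num v / den v\<close> is the preimage of the base point of \<open>v\<close> under the Moebius map of \<open>A\<close>.\<close>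

definition num :: "C3 \<Rightarrow> complex" where "num v = cnj (A$1$1) * c1 v + cnj (A$2$1) * c2 v"
definition den :: "C3 \<Rightarrow> complex" where "den v = cnj (A$1$2) * c1 v + cnj (A$2$2) * c2 v"

definition M :: "H2 set" where "M = M3 (moebius_map A ` Fin ` range c)"

lemma c12_num_den: "c1 v = A$1$1 * num v + A$1$2 * den v" "c2 v = A$2$1 * num v + A$2$2 * den v"
proof -
  have "A$1$1 * num v + A$1$2 * den v = (A$1$1 * cnj (A$1$1) + A$1$2 * cnj (A$1$2)) * c1 v
     + (A$1$1 * cnj (A$2$1) + A$1$2 * cnj (A$2$2)) * c2 v"
    by (simp add: num_def den_def algebra_simps)
  then show "c1 v = A$1$1 * num v + A$1$2 * den v" by (simp add: U2_relations[OF A])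
  have "A$2$1 * num v + A$2$2 * den v = (A$2$1 * cnj (A$1$1) + A$2$2 * cnj (A$1$2)) * c1 v
     + (A$2$1 * cnj (A$2$1) + A$2$2 * cnj (A$2$2)) * c2 v"
    by (simp add: num_def den_def algebra_simps)
  then show "c2 v = A$2$1 * num v + A$2$2 * den v" by (simp add: U2_relations[OF A])
qed

text \<open>Equality of points of the projective line is cross multiplication, which treats infinity
  like any other point. Expressing \<open>c1\<close> and \<open>c2\<close> by \<open>num\<close> and
  \<open>den\<close> then takes out the determinant of A.\<close>

lemma abs_H2_in_M_iff:
  assumes v: "v \<in> homog"
  shows "abs_H2 v \<in> M \<longleftrightarrow> den v \<noteq> 0 \<and> num v / den v \<in> range c"
proof -
  have key: "proj (abs_H2 v) = moebius_map A (Fin z) \<longleftrightarrow> den v \<noteq> 0 \<and> num v / den v = z" for z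
  proof -
    let ?N = "A$1$1 * z + A$1$2" and ?D = "A$2$1 * z + A$2$2"
    have "(cmod ?N)\<^sup>2 + (cmod ?D)\<^sup>2 \<noteq> 0"
      unfolding U2_norm[OF A] by (smt (verit) zero_le_power2)
    then have nz: "?N \<noteq> 0 \<or> ?D \<noteq> 0" by auto
    have nz2: "num v \<noteq> 0 \<or> den v \<noteq> 0"
      using v c12_num_den[of v] by (auto simp: homog_iff)
    have "c1 v * ?D - c2 v * ?N = (A$1$1 * A$2$2 - A$1$2 * A$2$1) * (num v - z * den v)"
      by (subst c12_num_den(1), subst c12_num_den(2)) (simp add: algebra_simps)
    then have "c1 v * ?D = c2 v * ?N \<longleftrightarrow> num v = z * den v"
      using U2_relations(9)[OF A] by (metis eq_iff_diff_eq_0 mult_eq_0_iff)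
    moreover have "proj (abs_H2 v) = moebius_map A (Fin z) \<longleftrightarrow> c1 v * ?D = c2 v * ?N"
      using nz v by (auto simp: proj_abs_H2[OF v] homog_iff frac_eq_eq mult.commute)
    moreover have "num v = z * den v \<longleftrightarrow> den v \<noteq> 0 \<and> num v / den v = z"
      using nz2 by (auto simp: field_simps)
    ultimately show ?thesis by blast
  qed
  show ?thesis unfolding M_def M3_def using key by (auto simp: image_iff)
qed

section \<open>The chart (s, w) and its inverse\<close>

text \<open>If (c1, c2) is a multiple of the unit vector \<sigma>(s), this is the factor. As a
  Hermitian product it is defined for all v and s and smooth in both.\<close>

definition coef :: "C3 \<Rightarrow> real \<Rightarrow> complex" where "coef v s = c1 v * cnj (\<sigma> 1 s) + c2 v * cnj (\<sigma> 2 s)"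

lemma decompose:
  assumes "den v \<noteq> 0" "num v / den v = c s"
  shows "coef v s \<noteq> 0" "c1 v = coef v s * \<sigma> 1 s" "c2 v = coef v s * \<sigma> 2 s"
proof -
  define b where "b = den v / \<mu> s"
  have n: "num v = c s * den v" using assms by (simp add: field_simps)
  have 1: "c1 v = b * \<sigma> 1 s" by (subst c12_num_den) (simp add: n b_def frame_def \<mu>_nz algebra_simps)
  have 2: "c2 v = b * \<sigma> 2 s" by (subst c12_num_den) (simp add: n b_def frame_def \<mu>_nz algebra_simps)
  have "coef v s = b * (\<sigma> 1 s * cnj (\<sigma> 1 s) + \<sigma> 2 s * cnj (\<sigma> 2 s))"
    unfolding coef_def 1 2 by (simp add: algebra_simps)
  then have b: "coef v s = b" by (simp add: \<sigma>_unit')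
  show "coef v s \<noteq> 0" using b assms(1) \<mu>_nz by (simp add: b_def)
  show "c1 v = coef v s * \<sigma> 1 s" "c2 v = coef v s * \<sigma> 2 s" using 1 2 by (simp_all only: b)
qed

definition \<Phi> :: "real^3 \<Rightarrow> C3" where "\<Phi> y = (\<sigma> 1 (y$1), \<sigma> 2 (y$1), Complex (y$2) (y$3))"

lemma \<Phi>_simps [simp]: "c1 (\<Phi> y) = \<sigma> 1 (y$1)" "c2 (\<Phi> y) = \<sigma> 2 (y$1)" "c3 (\<Phi> y) = Complex (y$2) (y$3)"
  by (simp_all add: \<Phi>_def)

lemma \<Phi>_homog: "\<Phi> y \<in> homog"
  using \<sigma>_unit[of "y$1"] by (auto simp: homog_iff)

lemma num_den_\<Phi>: "den (\<Phi> y) = \<mu> (y$1)" "num (\<Phi> y) = \<mu> (y$1) * c (y$1)"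
proof -
  have "den (\<Phi> y) = \<mu> (y$1) * ((cnj (A$1$2) * A$1$1 + cnj (A$2$2) * A$2$1) * c (y$1) + (cnj (A$1$2) * A$1$2 + cnj (A$2$2) * A$2$2))"
    by (simp add: den_def frame_def algebra_simps)
  then show "den (\<Phi> y) = \<mu> (y$1)" by (simp add: U2_relations[OF A])
  have "num (\<Phi> y) = \<mu> (y$1) * ((cnj (A$1$1) * A$1$1 + cnj (A$2$1) * A$2$1) * c (y$1) + (cnj (A$1$1) * A$1$2 + cnj (A$2$1) * A$2$2))"
    by (simp add: num_def frame_def algebra_simps)
  then show "num (\<Phi> y) = \<mu> (y$1) * c (y$1)" by (simp add: U2_relations[OF A])
qed

lemma \<Phi>_in_M: "abs_H2 (\<Phi> y) \<in> M"
  by (simp add: abs_H2_in_M_iff[OF \<Phi>_homog] num_den_\<Phi> \<mu>_nz)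

lemma u1_\<Phi>: "u1 (abs_H2 (\<Phi> y)) = cmod (Complex (y$2) (y$3))"
  by (simp add: u1_abs_H2[OF \<Phi>_homog] eh_n_def \<sigma>_unit)

text \<open>Acting by 1/b normalizes [b \<sigma>(s), \<gamma>] to [\<sigma>(s), \<gamma> b^2],
  whence w = \<gamma> b^2. The parameter s is an argument because the point determines it only
  modulo the period.\<close>

definition \<Phi>_inv :: "C3 \<Rightarrow> real \<Rightarrow> real^3" where
  "\<Phi>_inv v s = (let w = c3 v * (coef v s)\<^sup>2 in s *\<^sub>R axis 1 1 + Re w *\<^sub>R axis 2 1 + Im w *\<^sub>R axis 3 1)"

lemma \<Phi>_inv_nth [simp]: "\<Phi>_inv v s $ 1 = s" "\<Phi>_inv v s $ 2 = Re (c3 v * (coef v s)\<^sup>2)"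
    "\<Phi>_inv v s $ 3 = Im (c3 v * (coef v s)\<^sup>2)"
  by (simp_all add: \<Phi>_inv_def Let_def axis_def)

lemma \<Phi>_\<Phi>_inv [simp]: "c3 (\<Phi> (\<Phi>_inv v s)) = c3 v * (coef v s)\<^sup>2"
  by (simp only: \<Phi>_simps \<Phi>_inv_nth complex_surj)

lemma abs_H2_\<Phi>_inv:
  assumes v: "v \<in> homog" and "den v \<noteq> 0" "num v / den v = c s"
  shows "abs_H2 (\<Phi> (\<Phi>_inv v s)) = abs_H2 v"
proof -
  note d = decompose[OF assms(2,3)]
  have "v = act (coef v s) (\<Phi> (\<Phi>_inv v s))"
    using d by (simp add: act_def prod_eq_iff del: \<Phi>_simps(3))
  then show ?thesis using abs_H2_act[OF \<Phi>_homog d(1)] by metis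
qed

lemma \<Phi>_eqD:
  assumes "abs_H2 (\<Phi> y) = abs_H2 (\<Phi> y')"
  shows "c (y$1) = c (y'$1)" and "y$1 = y'$1 \<Longrightarrow> y = y'"
proof -
  from assms obtain a where a: "a \<noteq> 0" "\<Phi> y' = act a (\<Phi> y)"
    using abs_H2_eq_iff_act[OF \<Phi>_homog \<Phi>_homog] by blast
  then have e: "\<sigma> 1 (y'$1) = a * \<sigma> 1 (y$1)" "\<sigma> 2 (y'$1) = a * \<sigma> 2 (y$1)"
     "Complex (y'$2) (y'$3) = Complex (y$2) (y$3) / a\<^sup>2"
    by (simp_all add: act_def \<Phi>_def)
  have "den (\<Phi> y') = a * den (\<Phi> y)" "num (\<Phi> y') = a * num (\<Phi> y)"
    by (simp_all add: den_def num_def e algebra_simps)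
  then have "num (\<Phi> y') / den (\<Phi> y') = num (\<Phi> y) / den (\<Phi> y)" using a by simp
  then show "c (y$1) = c (y'$1)" using \<mu>_nz by (simp add: num_den_\<Phi>)
  assume y: "y$1 = y'$1"
  have "a = 1" using e(1,2) \<Phi>_homog[of y] by (auto simp: y homog_iff)
  then show "y = y'" using e(3) y by (simp add: vec_eq_iff forall_3)
qed

lemma \<Phi>_inj_on: "inj_on (\<lambda>y. abs_H2 (\<Phi> y)) {y. y$1 \<in> {a..<a + l}}"
proof (rule inj_onI)
  fix y y' assume y: "y \<in> {y. y$1 \<in> {a..<a + l}}" "y' \<in> {y. y$1 \<in> {a..<a + l}}"
    and e: "abs_H2 (\<Phi> y) = abs_H2 (\<Phi> y')"
  have "y$1 = y'$1" by (rule inj_onD[OF inj_on_period \<Phi>_eqD(1)[OF e]]) (use y in auto)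
  then show "y = y'" by (rule \<Phi>_eqD(2)[OF e])
qed

lemma M_eq: "M = (\<lambda>y. abs_H2 (\<Phi> y)) ` {y. y$1 \<in> {a..<a + l}}"
proof (intro set_eqI iffI)
  fix p assume p: "p \<in> M"
  obtain v where v: "v \<in> homog" "abs_H2 v = p" by (rule abs_H2_surj)
  with p have "den v \<noteq> 0" "num v / den v \<in> range c" using abs_H2_in_M_iff[OF v(1)] by simp_all
  then obtain s where s: "s \<in> {a..<a + l}" "num v / den v = c s" using range_c by blast
  with abs_H2_\<Phi>_inv[OF v(1) \<open>den v \<noteq> 0\<close> s(2)] v(2)
  show "p \<in> (\<lambda>y. abs_H2 (\<Phi> y)) ` {y. y$1 \<in> {a..<a + l}}" by (intro image_eqI[of _ _ "\<Phi>_inv v s"]) auto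
qed (use \<Phi>_in_M in auto)

end

section \<open>Coordinate changes to the model chart\<close>

lemma fst_snd_bounded_linear: "bounded_linear c1" "bounded_linear c2" "bounded_linear c3"
  using bounded_linear_fst bounded_linear_snd_comp[OF bounded_linear_fst]
    bounded_linear_compose[OF bounded_linear_fst bounded_linear_snd]
    bounded_linear_compose[OF bounded_linear_snd bounded_linear_snd] by auto

lemma smooth_on_c123:
  fixes f :: "'a::euclidean_space \<Rightarrow> C3"
  assumes "open S" "smooth_on S f"
  shows "smooth_on S (\<lambda>x. c1 (f x))" "smooth_on S (\<lambda>x. c2 (f x))" "smooth_on S (\<lambda>x. c3 (f x))"
  using smooth_on_bounded_linear_comp[OF assms(1) fst_snd_bounded_linear(1) assms(2)]
    smooth_on_bounded_linear_comp[OF assms(1) fst_snd_bounded_linear(2) assms(2)]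
    smooth_on_bounded_linear_comp[OF assms(1) fst_snd_bounded_linear(3) assms(2)] by auto

lemma det_nonzero_if_injective:
  fixes J :: "real^'n^'n"
  assumes "\<And>h. J *v h = 0 \<Longrightarrow> h = 0"
  shows "det J \<noteq> 0"
proof -
  have "\<exists>B. B ** J = mat 1" using assms by (simp add: matrix_left_invertible_ker)
  then show ?thesis using invertible_left_inverse[of J] by (simp add: invertible_det_nz)
qed

context lifted_curve
begin

definition S0 :: "real^3 \<Rightarrow> real" where "S0 y = sqrt ((y$2)\<^sup>2 + (y$3)\<^sup>2 + t ^ 4)"

definition G0 :: "real^3 \<Rightarrow> real^3^3" where
  "G0 y = (\<chi> i j. if i = j then (if i = 1 then 2 * S0 y * (\<rho> (y$1))\<^sup>2 else 1 / (2 * S0 y)) else 0)"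

lemma t4_pos: "t ^ 4 > 0" using t_nz by (simp add: zero_less_power_eq)

lemma S0_pos: "S0 y > 0"
  using t4_pos by (simp add: S0_def add_nonneg_pos)

text \<open>The quotient of \<open>num\<close> and \<open>den\<close> is a smooth map into the
  curve, and the local inverse of c turns it into a smooth parameter \<eta>. Both the starting value
  s0 and the deviation e0 are prescribed, which later keeps \<eta> within one period.\<close>

lemma local_lift:
  assumes P: "local_param M U \<Psi>" and x0: "x0 \<in> U" and s0: "c s0 = num (\<Psi> x0) / den (\<Psi> x0)" and e0: "e0 > 0"
  obtains V \<eta> where "open V" "x0 \<in> V" "V \<subseteq> U" "smooth_on V \<eta>" "\<eta> x0 = s0"
    "\<And>x. x \<in> V \<Longrightarrow> den (\<Psi> x) \<noteq> 0 \<and> c (\<eta> x) = num (\<Psi> x) / den (\<Psi> x)" "\<And>x. x \<in> V \<Longrightarrow> \<bar>\<eta> x - s0\<bar> < e0"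
proof -
  have "(abs_H2 \<circ> \<Psi>) ` U \<subseteq> M"
    using P unfolding local_param_def by (blast dest: openin_imp_subset)
  then have U: "open U" "smooth_on U \<Psi>" "\<Psi> ` U \<subseteq> homog" "abs_H2 ` \<Psi> ` U \<subseteq> M"
    using P unfolding local_param_def image_comp by blast+
  have inM: "den (\<Psi> x) \<noteq> 0" "num (\<Psi> x) / den (\<Psi> x) \<in> range c" if "x \<in> U" for x
    using abs_H2_in_M_iff[of "\<Psi> x"] that U by blast+
  define q where "q x = num (\<Psi> x) / den (\<Psi> x)" for x
  have sq: "smooth_on U q"
    unfolding q_def num_def den_def
    by (intro smooth_on_divide_complex smooth_on_add smooth_on_mult smooth_on_const smooth_on_c123 U(1,2))
       (use inM in \<open>auto simp: den_def\<close>)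
  obtain e J T L where J: "0 < e" "e \<le> e0" "open T" "smooth_on T J" "bounded_linear L"
    "\<And>s. \<bar>s - s0\<bar> < e \<Longrightarrow> L (c s) \<in> T \<and> J (L (c s) :: real) = (s::real)"
    using local_inverse[OF e0] by metis
  obtain d where d: "d > 0" "\<And>s. dist (c s) (c s0) < d \<Longrightarrow> \<exists>k::int. \<bar>s + of_int k * l - s0\<bar> < e"
    using c_near[OF J(1)] by metis
  \<comment> \<open>Within distance d of c s0, \<open>c_near\<close> supplies a parameter close to
    s0, where J inverts; closeness in the plane alone would not exclude another arc of the
    curve.\<close>
  define V where "V = U \<inter> q -` ball (c s0) d"
  have V: "open V" "V \<subseteq> U" unfolding V_def using smooth_on_imp_continuous_on[OF sq] U(1)
    by (auto intro: continuous_open_preimage)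
  have x0V: "x0 \<in> V" using x0 d s0 by (simp add: V_def q_def)
  define \<eta> where "\<eta> x = J (L (q x))" for x
  have ex: "\<exists>s. \<bar>s - s0\<bar> < e \<and> c s = q x" if xV: "x \<in> V" for x
  proof -
    obtain s where s: "q x = c s" using inM(2)[of x] xV V by (auto simp: q_def)
    then have "dist (c s) (c s0) < d" using xV by (simp add: V_def dist_commute)
    then obtain k :: int where "\<bar>s + of_int k * l - s0\<bar> < e" using d by blast
    then show ?thesis using s by (intro exI[of _ "s + of_int k * l"]) (simp add: c_add_int)
  qed
  have \<eta>: "L (q x) \<in> T" "\<bar>\<eta> x - s0\<bar> < e" "c (\<eta> x) = q x" if xV: "x \<in> V" for x
  proof -
    obtain s where "\<bar>s - s0\<bar> < e" "c s = q x" using ex[OF xV] by blast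
    with J(6)[of s] show "L (q x) \<in> T" "\<bar>\<eta> x - s0\<bar> < e" "c (\<eta> x) = q x" by (simp_all add: \<eta>_def)
  qed
  have sL: "smooth_on V (\<lambda>x. L (q x))"
    by (rule smooth_on_bounded_linear_comp[OF V(1) J(5) smooth_on_subset[OF sq V(2)]])
  have "smooth_on V \<eta>"
    unfolding \<eta>_def by (rule smooth_on_compose[OF V(1) J(3) sL J(4)]) (use \<eta>(1) in auto)
  moreover have "\<eta> x0 = s0" using J(6)[of s0] J(1) s0 by (simp add: \<eta>_def q_def)
  ultimately show thesis
    using that[OF V(1) x0V V(2)] \<eta> inM V J(2) by (force simp: q_def)
qed

lemma smooth_coef:
  assumes V: "open V" and \<Psi>: "smooth_on V \<Psi>" and \<eta>: "smooth_on V \<eta>"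
  shows "smooth_on V (\<lambda>x. coef (\<Psi> x) (\<eta> x))"
  unfolding coef_def
  by (intro smooth_on_add smooth_on_mult smooth_on_cnj smooth_on_c123 V \<Psi>
      smooth_on_compose[OF V open_UNIV \<eta> smooth_\<sigma>]) auto

lemma smooth_\<Phi>_inv:
  assumes V: "open V" and \<Psi>: "smooth_on V \<Psi>" and \<eta>: "smooth_on V \<eta>"
  shows "smooth_on V (\<lambda>x. \<Phi>_inv (\<Psi> x) (\<eta> x))"
  unfolding \<Phi>_inv_def Let_def
  by (intro smooth_on_add smooth_on_scaleR smooth_on_const smooth_on_Re smooth_on_Im smooth_on_mult smooth_on_power
      smooth_on_c123 smooth_coef V \<Psi> \<eta>)

text \<open>Differentiate (c1, c2) = b \<sigma>(\<eta>). Horizontality removes \<eta>' from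
  \<open>eh_in\<close>, so \<open>eh_p\<close> depends on w' only, while in \<open>eh_q\<close> the
  terms with b' cancel and only \<eta>' remains. Hence there are no mixed terms and
  \<open>G0\<close> is diagonal. If both \<eta>' and w' vanish on h, then only b' is left, and that
  is motion along the orbit.\<close>

lemma lift_metric:
  assumes V: "open V" and \<Psi>: "smooth_on V \<Psi>" and \<eta>: "smooth_on V \<eta>" and hom: "\<Psi> ` V \<subseteq> homog"
    and lift: "\<And>x. x \<in> V \<Longrightarrow> den (\<Psi> x) \<noteq> 0 \<and> c (\<eta> x) = num (\<Psi> x) / den (\<Psi> x)" and x: "x \<in> V"
  defines "\<tau> \<equiv> \<lambda>x. \<Phi>_inv (\<Psi> x) (\<eta> x)"
  shows "induced_metric t \<Psi> x = transpose (jac_mat \<tau> x) ** G0 (\<tau> x) ** jac_mat \<tau> x"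
    and "frechet_derivative \<tau> (at x) h = 0 \<Longrightarrow> frechet_derivative \<Psi> (at x) h \<in> orbit_tangent (\<Psi> x)"
proof -
  define X where "X = frechet_derivative \<Psi> (at x)"
  define \<eta>' where "\<eta>' = frechet_derivative \<eta> (at x)"
  let ?b = "coef (\<Psi> x) (\<eta> x)" and ?\<gamma> = "c3 (\<Psi> x)"
  define b' where "b' = frechet_derivative (\<lambda>x. coef (\<Psi> x) (\<eta> x)) (at x)"
  have dX: "(\<Psi> has_derivative X) (at x)" unfolding X_def by (rule smooth_on_has_derivative[OF \<Psi> x])
  have d\<eta>: "(\<eta> has_derivative \<eta>') (at x)" unfolding \<eta>'_def by (rule smooth_on_has_derivative[OF \<eta> x])
  have db: "((\<lambda>x. coef (\<Psi> x) (\<eta> x)) has_derivative b') (at x)" unfolding b'_def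
    by (rule smooth_on_has_derivative[OF smooth_coef[OF V \<Psi> \<eta>] x])
  have dc: "((\<lambda>x. c1 (\<Psi> x)) has_derivative (\<lambda>h. c1 (X h))) (at x)"
    "((\<lambda>x. c2 (\<Psi> x)) has_derivative (\<lambda>h. c2 (X h))) (at x)" "((\<lambda>x. c3 (\<Psi> x)) has_derivative (\<lambda>h. c3 (X h))) (at x)"
    using dX by (auto intro!: derivative_eq_intros)
  have d\<sigma>: "((\<lambda>x. \<sigma> k (\<eta> x)) has_derivative (\<lambda>h. \<eta>' h *\<^sub>R \<sigma>' k (\<eta> x))) (at x)" for k
    using has_derivative_compose[OF d\<eta> \<sigma>_deriv[unfolded has_vector_derivative_def]] .
  have dec: "?b \<noteq> 0" "c1 (\<Psi> x) = ?b * \<sigma> 1 (\<eta> x)" "c2 (\<Psi> x) = ?b * \<sigma> 2 (\<eta> x)"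
    using decompose[of "\<Psi> x" "\<eta> x"] lift[OF x] by simp_all
  have "((\<lambda>x. coef (\<Psi> x) (\<eta> x) * \<sigma> 1 (\<eta> x)) has_derivative (\<lambda>h. c1 (X h))) (at x)"
    by (rule has_derivative_transform_within_open[OF dc(1) V x]) (use decompose lift in simp)
  from has_derivative_unique[OF this has_derivative_mult[OF db d\<sigma>]]
  have X1: "c1 (X h) = b' h * \<sigma> 1 (\<eta> x) + ?b * \<eta>' h * \<sigma>' 1 (\<eta> x)" for h
    by (simp add: fun_eq_iff scaleR_conv_of_real)
  have "((\<lambda>x. coef (\<Psi> x) (\<eta> x) * \<sigma> 2 (\<eta> x)) has_derivative (\<lambda>h. c2 (X h))) (at x)"
    by (rule has_derivative_transform_within_open[OF dc(2) V x]) (use decompose lift in simp)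
  from has_derivative_unique[OF this has_derivative_mult[OF db d\<sigma>]]
  have X2: "c2 (X h) = b' h * \<sigma> 2 (\<eta> x) + ?b * \<eta>' h * \<sigma>' 2 (\<eta> x)" for h
    by (simp add: fun_eq_iff scaleR_conv_of_real)
  define w' where "w' h = c3 (X h) * ?b\<^sup>2 + 2 * ?\<gamma> * ?b * b' h" for h
  have dw: "((\<lambda>x. c3 (\<Psi> x) * (coef (\<Psi> x) (\<eta> x))\<^sup>2) has_derivative w') (at x)"
    unfolding w'_def power2_eq_square
    by (rule has_derivative_eq_rhs[OF has_derivative_mult[OF dc(3) has_derivative_mult[OF db db]]])
       (simp add: fun_eq_iff algebra_simps)
  have d\<tau>: "(\<tau> has_derivative (\<lambda>h. \<eta>' h *\<^sub>R axis 1 1 + Re (w' h) *\<^sub>R axis 2 1 + Im (w' h) *\<^sub>R axis 3 1)) (at x)"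
    unfolding \<tau>_def \<Phi>_inv_def Let_def
    by (intro has_derivative_add has_derivative_scaleR_left has_derivative_Re has_derivative_Im d\<eta> dw)
  from frechet_derivative_at[OF d\<tau>]
  have fd\<tau>: "frechet_derivative \<tau> (at x) = (\<lambda>h. \<eta>' h *\<^sub>R axis 1 1 + Re (w' h) *\<^sub>R axis 2 1 + Im (w' h) *\<^sub>R axis 3 1)"
    by (rule sym)
  have J: "jac_mat \<tau> x $ 1 $ j = \<eta>' (axis j 1)" "jac_mat \<tau> x $ 2 $ j = Re (w' (axis j 1))"
    "jac_mat \<tau> x $ 3 $ j = Im (w' (axis j 1))" for j
    by (simp_all add: jac_mat_nth fd\<tau> axis_def)
  have bn: "eh_n (\<Psi> x) = (cmod ?b)\<^sup>2"
    unfolding eh_n_def dec(2,3) norm_mult power_mult_distrib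
    using \<sigma>_unit[of "\<eta> x"] by (metis distrib_left mult.right_neutral)
  have bn': "complex_of_real (eh_n (\<Psi> x)) = ?b * cnj ?b" unfolding bn by (simp add: cmod_square)
  have cb: "cnj ?b \<noteq> 0" using dec(1) by simp
  have eh_in: "eh_in (\<Psi> x) (X h) = cnj ?b * b' h" for h
  proof -
    have "eh_in (\<Psi> x) (X h) = cnj ?b * b' h * (\<sigma> 1 (\<eta> x) * cnj (\<sigma> 1 (\<eta> x)) + \<sigma> 2 (\<eta> x) * cnj (\<sigma> 2 (\<eta> x)))
       + cnj ?b * ?b * \<eta>' h * (\<sigma>' 1 (\<eta> x) * cnj (\<sigma> 1 (\<eta> x)) + \<sigma>' 2 (\<eta> x) * cnj (\<sigma> 2 (\<eta> x)))"
      unfolding eh_in_def X1 X2 by (subst (1) dec(2), subst (1) dec(3)) (simp add: algebra_simps)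
    then show ?thesis unfolding \<sigma>_unit' \<sigma>_horizontal by simp
  qed
  \<comment> \<open>The quotient of b and its conjugate has modulus one, here and in
    \<open>eh_q\<close>, so it disappears from the Hermitian products.\<close>
  have eh_p: "eh_p (\<Psi> x) (X h) = cnj ?b / (2 * ?b) * w' h" for h
    unfolding eh_p_def eh_in bn' w'_def using dec(1) by (simp add: field_simps power2_eq_square)
  have eh_q: "eh_q (\<Psi> x) (X h) = ?b / cnj ?b * (\<eta>' h * (\<sigma>' 1 (\<eta> x) * \<sigma> 2 (\<eta> x) - \<sigma>' 2 (\<eta> x) * \<sigma> 1 (\<eta> x)))" for h
  proof -
    have "c1 (X h) * c2 (\<Psi> x) - c2 (X h) * c1 (\<Psi> x) =
       ?b * ?b * (\<eta>' h * (\<sigma>' 1 (\<eta> x) * \<sigma> 2 (\<eta> x) - \<sigma>' 2 (\<eta> x) * \<sigma> 1 (\<eta> x)))"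
      unfolding X1 X2 by (subst dec(2), subst dec(3)) (simp add: algebra_simps)
    note L = this
    show ?thesis unfolding eh_q_def bn' L using dec(1) cb by (simp add: field_simps)
  qed
  have S: "eh_S t (\<Psi> x) = S0 (\<tau> x)"
  proof -
    have "(\<tau> x $ 2)\<^sup>2 + (\<tau> x $ 3)\<^sup>2 = (cmod (?\<gamma> * ?b\<^sup>2))\<^sup>2"
      unfolding \<tau>_def \<Phi>_inv_nth by (simp only: cmod_power2)
    also have "\<dots> = (eh_n (\<Psi> x) * cmod ?\<gamma>)\<^sup>2" by (simp add: bn norm_mult norm_power mult.commute)
    finally show ?thesis by (simp add: eh_S_def S0_def)
  qed
  have metric: "eh_metric t (\<Psi> x) (X h) (X k) =
      (Re (w' h) * Re (w' k) + Im (w' h) * Im (w' k)) / (2 * S0 (\<tau> x)) + 2 * S0 (\<tau> x) * (\<rho> (\<eta> x))\<^sup>2 * \<eta>' h * \<eta>' k" for h k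
  proof -
    have ph: "eh_p (\<Psi> x) (X h) * cnj (eh_p (\<Psi> x) (X k)) = w' h * cnj (w' k) / 4"
      unfolding eh_p using dec(1) cb by (simp add: field_simps)
    have "eh_q (\<Psi> x) (X h) * cnj (eh_q (\<Psi> x) (X k)) = \<eta>' h * \<eta>' k *
      ((\<sigma>' 1 (\<eta> x) * \<sigma> 2 (\<eta> x) - \<sigma>' 2 (\<eta> x) * \<sigma> 1 (\<eta> x)) * cnj (\<sigma>' 1 (\<eta> x) * \<sigma> 2 (\<eta> x) - \<sigma>' 2 (\<eta> x) * \<sigma> 1 (\<eta> x)))"
      unfolding eh_q using dec(1) cb by (simp add: field_simps)
    also have "\<dots> = of_real (\<eta>' h * \<eta>' k * (\<rho> (\<eta> x))\<^sup>2)"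
      unfolding \<rho>_def of_real_mult of_real_power cmod_square ..
    finally have qh: "eh_q (\<Psi> x) (X h) * cnj (eh_q (\<Psi> x) (X k)) = of_real (\<eta>' h * \<eta>' k * (\<rho> (\<eta> x))\<^sup>2)" .
    have "\<Psi> x \<in> homog" using hom x by blast
    then have "eh_metric t (\<Psi> x) (X h) (X k) = 2 * Re (eh_B t (\<Psi> x) (X h) (X k))"
      by (rule eh_metric_eq[OF _ t_nz])
    also have "eh_B t (\<Psi> x) (X h) (X k) = w' h * cnj (w' k) / 4 / of_real (S0 (\<tau> x)) +
        of_real (S0 (\<tau> x)) * of_real (\<eta>' h * \<eta>' k * (\<rho> (\<eta> x))\<^sup>2)"
      unfolding eh_B_def ph qh S ..
    finally show ?thesis using S0_pos[of "\<tau> x"] by (simp add: field_simps)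
  qed
  show "induced_metric t \<Psi> x = transpose (jac_mat \<tau> x) ** G0 (\<tau> x) ** jac_mat \<tau> x"
  proof -
    have "\<tau> x $ 1 = \<eta> x" by (simp add: \<tau>_def)
    then show ?thesis
      unfolding induced_metric_def partial_deriv_def X_def[symmetric] metric
      by (simp add: vec_eq_iff matrix_matrix_mult_def transpose_def sum_3 J G0_def)
         (simp add: algebra_simps add_divide_distrib)
  qed
  assume h0: "frechet_derivative \<tau> (at x) h = 0"
  have "frechet_derivative \<tau> (at x) h $ 1 = \<eta>' h" "frechet_derivative \<tau> (at x) h $ 2 = Re (w' h)"
    "frechet_derivative \<tau> (at x) h $ 3 = Im (w' h)"
    by (simp_all add: fd\<tau> axis_def)
  then have z: "\<eta>' h = 0" "w' h = 0" unfolding h0 by (simp_all add: complex_eq_iff)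
  \<comment> \<open>The speed along the orbit: it is read off from the first two components, and w'
    = 0 says that the third component agrees.\<close>
  let ?a = "b' h / ?b"
  have "?b * (c3 (X h) * ?b + 2 * ?\<gamma> * b' h) = 0"
    using z(2) by (simp add: w'_def algebra_simps power2_eq_square)
  then have "c3 (X h) * ?b = - (2 * ?\<gamma> * b' h)"
    using dec(1) by (simp add: eq_neg_iff_add_eq_0)
  then have Xc3: "c3 (X h) = - 2 * ?a * ?\<gamma>"
    using dec(1) by (simp add: field_simps)
  have Xc12: "c1 (X h) = ?a * c1 (\<Psi> x)" "c2 (X h) = ?a * c2 (\<Psi> x)"
    unfolding X1 X2 z by (subst dec(2), simp add: dec(1), subst dec(3), simp add: dec(1))
  have ot: "orbit_tangent v = range (\<lambda>a. (a * c1 v, a * c2 v, - 2 * a * c3 v))" for v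
    by (cases v) simp
  have "X h = (?a * c1 (\<Psi> x), ?a * c2 (\<Psi> x), - 2 * ?a * ?\<gamma>)"
    unfolding Xc3[symmetric] Xc12[symmetric] by simp
  then show "frechet_derivative \<Psi> (at x) h \<in> orbit_tangent (\<Psi> x)"
    unfolding X_def[symmetric] ot by (rule image_eqI) simp
qed

text \<open>A kernel vector of the Jacobian would be mapped by the derivative of \<Psi> into the
  orbit direction, against the immersion condition of \<open>local_param\<close>.\<close>

lemma lift_det:
  assumes P: "local_param M U \<Psi>" and V: "open V" "V \<subseteq> U" and \<eta>: "smooth_on V \<eta>"
    and lift: "\<And>x. x \<in> V \<Longrightarrow> den (\<Psi> x) \<noteq> 0 \<and> c (\<eta> x) = num (\<Psi> x) / den (\<Psi> x)" and x: "x \<in> V"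
  shows "det (jac_mat (\<lambda>x. \<Phi>_inv (\<Psi> x) (\<eta> x)) x) \<noteq> 0"
proof (rule det_nonzero_if_injective)
  fix h assume h: "jac_mat (\<lambda>x. \<Phi>_inv (\<Psi> x) (\<eta> x)) x *v h = 0"
  have \<Psi>: "smooth_on V \<Psi>" "\<Psi> ` V \<subseteq> homog" using P V smooth_on_subset unfolding local_param_def by blast+
  have "linear (frechet_derivative (\<lambda>x. \<Phi>_inv (\<Psi> x) (\<eta> x)) (at x))"
    using smooth_on_has_derivative[OF smooth_\<Phi>_inv[OF V(1) \<Psi>(1) \<eta>] x] has_derivative_linear by blast
  then have "frechet_derivative (\<lambda>x. \<Phi>_inv (\<Psi> x) (\<eta> x)) (at x) h = 0"
    using h by (simp add: jac_mat_def matrix_works)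
  from lift_metric(2)[OF V(1) \<Psi>(1) \<eta> \<Psi>(2) lift x this]
  show "h = 0" using P V x unfolding local_param_def by blast
qed

end

section \<open>The Laplacian of radial bump functions\<close>

lemma div_grad_coord_cong:
  assumes V: "open V" "x \<in> V" and eq: "\<And>y. y \<in> V \<Longrightarrow> f y = g y"
  shows "div_coord G (grad_coord G f) x = div_coord G (grad_coord G g) x"
proof -
  have "grad_coord G f y = grad_coord G g y" if "y \<in> V" for y
    unfolding grad_coord_def using partial_deriv_cong[OF V(1) that eq] by simp
  then have "partial_deriv i (\<lambda>y. of_real (vol_density G y) * grad_coord G f y $ i) x =
      partial_deriv i (\<lambda>y. of_real (vol_density G y) * grad_coord G g y $ i) x" for i
    by (intro partial_deriv_cong[OF V]) simp
  then show ?thesis by (simp add: div_coord_def)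
qed

lemma nth_axis3: "axis (1::3) 1 $ 1 = (1::real)" "axis (1::3) 1 $ 2 = (0::real)" "axis (1::3) 1 $ 3 = (0::real)"
  "axis (2::3) 1 $ 1 = (0::real)" "axis (2::3) 1 $ 2 = (1::real)" "axis (2::3) 1 $ 3 = (0::real)"
  "axis (3::3) 1 $ 1 = (0::real)" "axis (3::3) 1 $ 2 = (0::real)" "axis (3::3) 1 $ 3 = (1::real)"
  by (simp_all add: axis_def)

context lifted_curve
begin

definition dens :: "real^3 \<Rightarrow> real" where "dens y = \<rho> (y$1) / sqrt (2 * S0 y)"

lemma det_G0: "det (G0 y) = (dens y)\<^sup>2"
  using S0_pos[of y] by (simp add: det_3 G0_def dens_def power_divide field_simps power2_eq_square)

lemma dens_pos: "dens y > 0"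
  using \<rho>_pos S0_pos by (simp add: dens_def)

lemma vol_density_G0: "vol_density G0 y = dens y"
  using dens_pos[of y] by (simp add: vol_density_def det_G0)

definition G0_inv :: "real^3 \<Rightarrow> real^3^3" where
  "G0_inv y = (\<chi> i j. if i = j then (if i = 1 then 1 / (2 * S0 y * (\<rho> (y$1))\<^sup>2) else 2 * S0 y) else 0)"

lemma matrix_inv_G0: "matrix_inv (G0 y) = G0_inv y"
  by (rule matrix_inv_eqI)
     (use S0_pos[of y] \<rho>_pos[of "y$1"] in
       \<open>simp_all add: vec_eq_iff forall_3 matrix_matrix_mult_def sum_3 G0_def G0_inv_def mat_def\<close>)

definition bump :: "real \<Rightarrow> H2 \<Rightarrow> complex" where
  "bump R p = of_real (flat_exp (1 - (u1 p)\<^sup>2 / R\<^sup>2))"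

text \<open>\<open>- bump_grad / 2\<close> is the derivative of the bump with respect to \<open>z = u\<^sub>1\<^sup>2\<close>.\<close>

definition bump_grad :: "real \<Rightarrow> real \<Rightarrow> real" where "bump_grad R z = 2 * flat_exp1 (1 - z / R\<^sup>2) / R\<^sup>2"
definition bump_hess :: "real \<Rightarrow> real \<Rightarrow> real" where "bump_hess R z = - 2 * flat_exp2 (1 - z / R\<^sup>2) / R ^ 4"

text \<open>The Laplacian of the bump as a function of z = u_1^2. The second summand is 2 S times
  the Euclidean Laplacian -div grad in w; the first comes from differentiating the weight sqrt(2
  S).\<close>

definition lap_profile :: "real \<Rightarrow> real \<Rightarrow> real" where
  "lap_profile R z = z * bump_grad R z / sqrt (z + t ^ 4)
     + 4 * sqrt (z + t ^ 4) * (z * bump_hess R z + bump_grad R z)"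

definition bump_lap :: "real \<Rightarrow> H2 \<Rightarrow> complex" where "bump_lap R p = of_real (lap_profile R ((u1 p)\<^sup>2))"

lemma bump_grad_deriv:
  assumes "R \<noteq> 0"
  shows "(bump_grad R has_real_derivative bump_hess R z) (at z)"
proof -
  have "((\<lambda>z. 1 - z / R\<^sup>2) has_real_derivative (- 1 / R\<^sup>2)) (at z)"
    by (rule DERIV_cong[OF DERIV_diff[OF DERIV_const DERIV_cdivide[OF DERIV_ident]]]) simp
  from DERIV_chain2[OF DERIV_flat_exp1 this]
  have "((\<lambda>z. flat_exp1 (1 - z / R\<^sup>2)) has_real_derivative flat_exp2 (1 - z / R\<^sup>2) * (- 1 / R\<^sup>2)) (at z)" .
  from DERIV_cmult[OF this, of "2 / R\<^sup>2"] show ?thesis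
    by (simp add: bump_grad_def[abs_def] bump_hess_def power2_eq_square power4_eq_xxxx mult.assoc)
qed

definition rad2 :: "real^3 \<Rightarrow> real" where "rad2 y = (y$2)\<^sup>2 + (y$3)\<^sup>2"

lemma S0_rad2: "S0 y = sqrt (rad2 y + t ^ 4)" by (simp add: S0_def rad2_def)

lemma has_derivative_nth: "((\<lambda>y. y $ i) has_derivative (\<lambda>h. h $ i)) F"
  by (rule bounded_linear_imp_has_derivative[OF bounded_linear_vec_nth])

lemma has_derivative_rad2: "(rad2 has_derivative (\<lambda>h. 2 * (y$2) * h$2 + 2 * (y$3) * h$3)) (at y)"
  unfolding rad2_def[abs_def]
  by (rule has_derivative_eq_rhs[OF has_derivative_add[OF
     has_derivative_power[OF has_derivative_nth] has_derivative_power[OF has_derivative_nth]]])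
    (simp add: fun_eq_iff)

definition flux :: "real \<Rightarrow> real^3 \<Rightarrow> real" where
  "flux R y = - \<rho> (y$1) * (sqrt (2 * sqrt (rad2 y + t ^ 4)) * bump_grad R (rad2 y))"

text \<open>The gradient of the bump times the volume density; it has no s component because the
  bump is radial.\<close>

definition flux_field :: "real \<Rightarrow> real^3 \<Rightarrow> real^3" where
  "flux_field R y = (flux R y * y$2) *\<^sub>R axis 2 1 + (flux R y * y$3) *\<^sub>R axis 3 1"

lemma bump_differentiable:
  assumes R: "R \<noteq> 0"
  shows "((\<lambda>y. flat_exp (1 - rad2 y / R\<^sup>2)) has_derivative
    (\<lambda>h. - bump_grad R (rad2 y) / 2 * (2 * (y$2) * h$2 + 2 * (y$3) * h$3))) (at y)"
proof -
  have "((\<lambda>z. 1 - z / R\<^sup>2) has_real_derivative (- 1 / R\<^sup>2)) (at z)" for z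
    by (rule DERIV_cong[OF DERIV_diff[OF DERIV_const DERIV_cdivide[OF DERIV_ident]]]) simp
  from DERIV_chain2[OF DERIV_flat_exp this]
  have "((\<lambda>z. flat_exp (1 - z / R\<^sup>2)) has_derivative (*) (flat_exp1 (1 - rad2 y / R\<^sup>2) * (- 1 / R\<^sup>2))) (at (rad2 y))"
    unfolding has_field_derivative_def .
  from has_derivative_compose[OF has_derivative_rad2 this] show ?thesis
    by (simp add: bump_grad_def)
qed

lemma flux_field_eq:
  assumes R: "R \<noteq> 0"
  shows "vol_density G0 y *\<^sub>R (matrix_inv (G0 y) *v (\<chi> k. partial_deriv k (\<lambda>y. flat_exp (1 - rad2 y / R\<^sup>2)) y)) = flux_field R y"
proof -
  have S: "S0 y > 0" by (rule S0_pos)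
  have "dens y * (2 * S0 y) = \<rho> (y$1) * ((2 * S0 y) / sqrt (2 * S0 y))" by (simp add: dens_def)
  also have "(2 * S0 y) / sqrt (2 * S0 y) = sqrt (2 * S0 y)" using S by (intro real_div_sqrt) simp
  finally have d: "dens y * (2 * S0 y) = \<rho> (y$1) * sqrt (2 * S0 y)" .
  have d2: "dens y * (2 * S0 y * (- bump_grad R (rad2 y) * z)) = flux R y * z" for z
    using arg_cong[OF d, of "\<lambda>x. x * (- bump_grad R (rad2 y) * z)"]
    by (simp add: flux_def S0_rad2 mult.assoc)
  show ?thesis
    unfolding vol_density_G0 matrix_inv_G0 partial_deriv_eq[OF bump_differentiable[OF R]]
    using d2[of "y$2"] d2[of "y$3"]
    by (simp add: vec_eq_iff forall_3 matrix_vector_mult_def sum_3 G0_inv_def flux_field_def nth_axis3 algebra_simps)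
qed

lemma flux_field_div:
  assumes R: "R \<noteq> 0"
  obtains Y' where "(flux_field R has_derivative Y') (at y)"
    "(\<Sum>k\<in>UNIV. Y' (axis k 1) $ k) / vol_density G0 y = - lap_profile R (rad2 y)"
proof -
  let ?z = "rad2 y"
  have z: "?z \<ge> 0" by (simp add: rad2_def)
  define S where "S = sqrt (?z + t ^ 4)"
  have zt: "?z + t ^ 4 > 0" using z t4_pos by linarith
  have S: "S > 0" using zt by (simp add: S_def)
  define r where "r = sqrt (2 * S)"
  have r: "r > 0" "r * r = 2 * S" using S by (simp_all add: r_def)
  let ?g = "\<lambda>z. sqrt (2 * sqrt (z + t ^ 4)) * bump_grad R z"
  define g' where "g' = bump_hess R ?z * r + (inverse r / 2 * (2 * (inverse S / 2))) * bump_grad R ?z"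
  have "((\<lambda>z. sqrt (z + t ^ 4)) has_real_derivative inverse S / 2) (at ?z)"
    unfolding S_def using zt by (auto intro!: derivative_eq_intros)
  from DERIV_cmult[OF this, of 2]
  have "((\<lambda>z. 2 * sqrt (z + t ^ 4)) has_real_derivative 2 * (inverse S / 2)) (at ?z)" .
  from DERIV_chain2[OF DERIV_real_sqrt this]
  have "((\<lambda>z. sqrt (2 * sqrt (z + t ^ 4))) has_real_derivative inverse r / 2 * (2 * (inverse S / 2))) (at ?z)"
    using S by (simp add: S_def[symmetric] r_def)
  from DERIV_mult[OF this bump_grad_deriv[OF R]]
  have "(?g has_real_derivative g') (at ?z)"
    by (simp add: g'_def S_def[symmetric] r_def[symmetric] add.commute)
  from has_derivative_compose[OF has_derivative_rad2 this[unfolded has_field_derivative_def]]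
  have dg: "((\<lambda>y. ?g (rad2 y)) has_derivative (\<lambda>h. g' * (2 * (y$2) * h$2 + 2 * (y$3) * h$3))) (at y)" .
  have "(\<rho> has_derivative frechet_derivative \<rho> (at (y$1))) (at (y$1))"
    by (rule smooth_on_has_derivative[OF smooth_\<rho>]) simp
  from has_derivative_compose[OF has_derivative_nth this]
  have d\<rho>: "((\<lambda>y. \<rho> (y$1)) has_derivative (\<lambda>h. frechet_derivative \<rho> (at (y$1)) (h$1))) (at y)" .
  \<comment> \<open>The field has only w components, so the divergence evaluates the derivative of
    \<rho> at the zero vector only.\<close>
  have lin\<rho>: "frechet_derivative \<rho> (at (y$1)) 0 = 0"
    using smooth_on_has_derivative[OF smooth_\<rho>, of "y$1"] has_derivative_linear linear_0 by blast
  let ?P' = "\<lambda>h. - \<rho> (y$1) * (g' * (2 * (y$2) * h$2 + 2 * (y$3) * h$3)) + - frechet_derivative \<rho> (at (y$1)) (h$1) * ?g ?z"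
  have dP: "(flux R has_derivative ?P') (at y)"
    unfolding flux_def[abs_def] by (intro has_derivative_mult has_derivative_minus d\<rho> dg)
  let ?Y' = "\<lambda>h. (flux R y * h$2 + ?P' h * y$2) *\<^sub>R axis 2 1 + (flux R y * h$3 + ?P' h * y$3) *\<^sub>R (axis 3 1 :: real^3)"
  have dY: "(flux_field R has_derivative ?Y') (at y)"
    unfolding flux_field_def[abs_def]
    by (intro has_derivative_add has_derivative_scaleR_left has_derivative_mult dP has_derivative_nth)
  have "(\<Sum>k\<in>UNIV. ?Y' (axis k 1) $ k) = 2 * flux R y - \<rho> (y$1) * g' * 2 * ?z"
    by (simp add: sum_3 nth_axis3 lin\<rho> rad2_def algebra_simps power2_eq_square)
  also have "\<dots> = - \<rho> (y$1) * (2 * r * bump_grad R ?z + 2 * ?z * g')"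
  proof -
    have "flux R y = - \<rho> (y$1) * (r * bump_grad R ?z)"
      unfolding flux_def r_def S_def ..
    then show ?thesis by (simp only:) (simp add: algebra_simps)
  qed
  also have "\<dots> / vol_density G0 y = - (r * (2 * r * bump_grad R ?z + 2 * ?z * g'))"
    unfolding vol_density_G0 dens_def S0_rad2 S_def[symmetric] r_def[symmetric]
    using \<rho>_pos[of "y$1"] r by (simp add: field_simps)
  also have "r * (2 * r * bump_grad R ?z + 2 * ?z * g') =
     2 * (r * r) * bump_grad R ?z + 2 * ?z * ((r * r) * bump_hess R ?z + (r * inverse r) * (inverse S / 2) * bump_grad R ?z)"
    by (simp add: g'_def algebra_simps)
  also have "\<dots> = lap_profile R ?z"
    unfolding r(2) lap_profile_def S_def[symmetric] using r S by (simp add: field_simps)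
  finally show thesis using that[OF dY] by simp
qed

lemma bump_\<Phi>: "bump R (abs_H2 (\<Phi> y)) = of_real (flat_exp (1 - rad2 y / R\<^sup>2))"
  by (simp add: bump_def u1_\<Phi> cmod_power2 rad2_def)

lemma bump_lap_\<Phi>: "bump_lap R (abs_H2 (\<Phi> y)) = of_real (lap_profile R (rad2 y))"
  by (simp add: bump_lap_def u1_\<Phi> cmod_power2 rad2_def)

lemma laplacian_bump:
  assumes P: "local_param M U \<Psi>" and x: "x \<in> U" and R: "R \<noteq> 0"
  shows "bump_lap R (abs_H2 (\<Psi> x)) =
    - div_coord (induced_metric t \<Psi>) (grad_coord (induced_metric t \<Psi>) (bump R \<circ> (abs_H2 \<circ> \<Psi>))) x"
proof -
  have U: "open U" "smooth_on U \<Psi>" "\<Psi> ` U \<subseteq> homog" using P unfolding local_param_def by blast+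
  have "(abs_H2 \<circ> \<Psi>) ` U \<subseteq> M"
    using P unfolding local_param_def by (blast dest: openin_imp_subset)
  then have "abs_H2 (\<Psi> x) \<in> M" "\<Psi> x \<in> homog" using x U by auto
  then obtain s0 where s0: "c s0 = num (\<Psi> x) / den (\<Psi> x)" using abs_H2_in_M_iff by (metis imageE)
  obtain V \<eta> where V: "open V" "x \<in> V" "V \<subseteq> U" "smooth_on V \<eta>"
    and lift: "\<And>x. x \<in> V \<Longrightarrow> den (\<Psi> x) \<noteq> 0 \<and> c (\<eta> x) = num (\<Psi> x) / den (\<Psi> x)"
    using local_lift[OF P x s0 zero_less_one] by metis
  define \<tau> where "\<tau> y = \<Phi>_inv (\<Psi> y) (\<eta> y)" for y
  have \<Psi>: "smooth_on V \<Psi>" "\<Psi> ` V \<subseteq> homog" using U V smooth_on_subset by blast+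
  have \<tau>: "smooth_on V \<tau>" unfolding \<tau>_def by (rule smooth_\<Phi>_inv[OF V(1) \<Psi>(1) V(4)])
  have abs: "abs_H2 (\<Phi> (\<tau> y)) = abs_H2 (\<Psi> y)" if "y \<in> V" for y
    unfolding \<tau>_def using lift[OF that] \<Psi> that by (intro abs_H2_\<Phi>_inv) auto
  let ?G = "induced_metric t \<Psi>" and ?F = "\<lambda>y. flat_exp (1 - rad2 y / R\<^sup>2)"
  obtain Y' where Y': "(flux_field R has_derivative Y') (at (\<tau> x))"
    "(\<Sum>k\<in>UNIV. Y' (axis k 1) $ k) / vol_density G0 (\<tau> x) = - lap_profile R (rad2 (\<tau> x))"
    by (rule flux_field_div[OF R])
  have "div_coord ?G (grad_coord ?G (bump R \<circ> (abs_H2 \<circ> \<Psi>))) x =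
     div_coord ?G (grad_coord ?G (\<lambda>y. complex_of_real (?F (\<tau> y)))) x"
    by (rule div_grad_coord_cong[OF V(1,2)]) (simp add: abs[symmetric] bump_\<Phi>)
  also have "\<dots> = of_real ((\<Sum>k\<in>UNIV. Y' (axis k 1) $ k) / vol_density G0 (\<tau> x))"
  proof (rule div_grad_coordinate_change[OF V(1,2) smooth_onD[OF \<tau>] _ _ _ _ _ Y'(1)])
    fix y assume y: "y \<in> V"
    show "?G y = transpose (jac_mat \<tau> y) ** G0 (\<tau> y) ** jac_mat \<tau> y"
      unfolding \<tau>_def[abs_def] by (rule lift_metric(1)[OF V(1) \<Psi>(1) V(4) \<Psi>(2) lift y])
    show "det (jac_mat \<tau> y) \<noteq> 0"
      unfolding \<tau>_def[abs_def] by (rule lift_det[OF P V(1,3,4) lift y])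
    show "det (G0 (\<tau> y)) \<noteq> 0" using dens_pos[of "\<tau> y"] by (simp add: det_G0)
    show "?F differentiable at (\<tau> y)" using bump_differentiable[OF R] differentiableI by blast
    show "vol_density G0 (\<tau> y) *\<^sub>R (matrix_inv (G0 (\<tau> y)) *v (\<chi> k. partial_deriv k ?F (\<tau> y))) = flux_field R (\<tau> y)"
      by (rule flux_field_eq[OF R])
  qed
  also have "\<dots> = - bump_lap R (abs_H2 (\<Psi> x))"
    unfolding Y'(2) abs[OF V(2), symmetric] bump_lap_\<Phi> by simp
  finally show ?thesis by simp
qed

lemma smooth_bump:
  assumes U: "open U" "smooth_on U \<Psi>" "\<Psi> ` U \<subseteq> homog"
  shows "smooth_on U (bump R \<circ> (abs_H2 \<circ> \<Psi>))"
proof -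
  \<comment> \<open>u_1^2 is written as n^2 |\<gamma>|^2, a polynomial in the real coordinates, so
    smoothness persists across \<gamma> = 0.\<close>
  let ?f = "\<lambda>x. 1 - ((cmod (c1 (\<Psi> x)))\<^sup>2 + (cmod (c2 (\<Psi> x)))\<^sup>2)\<^sup>2 * (cmod (c3 (\<Psi> x)))\<^sup>2 * inverse (R\<^sup>2)"
  have "smooth_on U ?f"
    by (intro smooth_on_diff smooth_on_const smooth_on_mult smooth_on_power smooth_on_add smooth_on_norm2
        smooth_on_c123 U(1,2))
  then have "smooth_on U (\<lambda>x. complex_of_real (flat_exp (?f x)))"
    by (intro smooth_on_of_real U smooth_on_compose[OF U(1) open_UNIV _ smooth_on_flat_exp]) auto
  then show ?thesis
    by (rule smooth_on_cong[THEN iffD1, OF U(1), rotated])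
       (use U(3) in \<open>auto simp: bump_def u1_abs_H2 eh_n_def power_mult_distrib divide_inverse image_subset_iff\<close>)
qed

end

section \<open>The Riemannian volume\<close>

text \<open>The image of E is the preimage of E under the continuous inverse \<kappa>, hence Borel
  in \<psi>(U), which is open in M.\<close>

lemma image_in_restrict_borel:
  fixes \<psi> :: "'a::topological_space \<Rightarrow> 'b::topological_space"
  assumes U: "open U" and op: "openin (top_of_set M) (\<psi> ` U)" and hom: "homeomorphism U (\<psi> ` U) \<psi> \<kappa>"
    and E: "E \<in> sets borel" "E \<subseteq> U"
  shows "\<psi> ` E \<in> sets (restrict_space borel M)"
proof -
  obtain W where W: "open W" "\<psi> ` U = M \<inter> W" using op by (auto simp: openin_open)
  have \<kappa>: "continuous_on (\<psi> ` U) \<kappa>" "\<And>x. x \<in> U \<Longrightarrow> \<kappa> (\<psi> x) = x"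
    using hom by (auto simp: homeomorphism_def)
  have "\<kappa> \<in> borel_measurable (restrict_space borel (\<psi> ` U))"
    by (rule borel_measurable_continuous_on_restrict[OF \<kappa>(1)])
  then have "\<kappa> -` E \<inter> space (restrict_space borel (\<psi> ` U)) \<in> sets (restrict_space borel (\<psi> ` U))"
    using E(1) by (rule measurable_sets)
  also have "\<kappa> -` E \<inter> space (restrict_space borel (\<psi> ` U)) = \<psi> ` E"
    using \<kappa>(2) E(2) by (auto simp: space_restrict_space)
  finally obtain B where "B \<in> sets borel" "\<psi> ` E = B \<inter> (M \<inter> W)"
    unfolding W(2) by (auto simp: sets_restrict_space)
  then show ?thesis
    using W(1) by (auto simp: sets_restrict_space intro!: image_eqI[of _ _ "B \<inter> W"])
qed

context lifted_curve
begin

abbreviation \<phi> :: "real^3 \<Rightarrow> H2" where "\<phi> y \<equiv> abs_H2 (\<Phi> y)"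

lemma smooth_\<Phi>: "smooth_on UNIV \<Phi>"
proof -
  have nth: "smooth_on UNIV (\<lambda>y::real^3. y $ i)" for i
    by (rule smooth_on_bounded_linear[OF bounded_linear_vec_nth])
  have C: "Complex a b = of_real a + \<i> * of_real b" for a b by (simp add: complex_eq_iff)
  show ?thesis
    unfolding \<Phi>_def[abs_def] C
    by (intro smooth_on_Pair smooth_on_add smooth_on_mult smooth_on_const smooth_on_of_real nth open_UNIV
        smooth_on_compose[OF open_UNIV open_UNIV nth smooth_\<sigma>] subset_UNIV)
qed

lemma continuous_\<phi>: "continuous_on S \<phi>"
proof (rule continuous_on_compose2[OF continuous_on_abs_H2])
  show "continuous_on S \<Phi>" using smooth_on_imp_continuous_on[OF smooth_\<Phi>] continuous_on_subset by blast
qed (use \<Phi>_homog in auto)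

lemma continuous_dens: "continuous_on S dens"
proof -
  have "continuous_on UNIV \<rho>" by (rule smooth_on_imp_continuous_on[OF smooth_\<rho>])
  then have 1: "continuous_on S (\<lambda>y::real^3. \<rho> (y$1))"
    by (rule continuous_on_compose2) (auto intro: continuous_on_component continuous_on_id)
  have 2: "continuous_on S S0" unfolding S0_def[abs_def] by (intro continuous_intros)
  show ?thesis unfolding dens_def[abs_def]
    using S0_pos by (intro continuous_on_divide 1 continuous_on_real_sqrt continuous_on_mult_left 2)
      (simp add: less_imp_neq[symmetric])
qed

lemma continuous_vol_density:
  assumes U: "open U" "smooth_on U \<Psi>" "\<Psi> ` U \<subseteq> homog"
  shows "continuous_on U (vol_density (induced_metric t \<Psi>))"
proof -
  have 1: "continuous_on U \<Psi>" by (rule smooth_on_imp_continuous_on[OF U(2)])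
  have 2: "continuous_on U (\<lambda>x. partial_deriv i \<Psi> x)" for i
    unfolding partial_deriv_def by (rule smooth_on_imp_continuous_on[OF smooth_on_frechet_derivative[OF U(2)]])
  have nz: "complex_of_real (eh_S t v) \<noteq> 0" for v using eh_S_pos[OF t_nz, of v] by simp
  have nn: "complex_of_real (eh_n (\<Psi> x)) \<noteq> 0" if "x \<in> U" for x using eh_n_pos[of "\<Psi> x"] U(3) that by auto
  have n: "continuous_on U (\<lambda>x. eh_n (\<Psi> x))" unfolding eh_n_def by (intro continuous_intros 1)
  have S: "continuous_on U (\<lambda>x. eh_S t (\<Psi> x))" unfolding eh_S_def by (intro continuous_intros 1 n)
  have "continuous_on U (\<lambda>x. 2 * Re (eh_B t (\<Psi> x) (partial_deriv i \<Psi> x) (partial_deriv j \<Psi> x)))" for i j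
    unfolding eh_B_def eh_p_def eh_q_def eh_in_def
    by (intro continuous_intros 1 2 n S) (use nz nn in auto)
  then have G: "continuous_on U (\<lambda>x. induced_metric t \<Psi> x $ i $ j)" for i j
    by (rule continuous_on_eq) (use U(3) in \<open>auto simp: induced_metric_def intro!: eh_metric_eq[symmetric] t_nz\<close>)
  show ?thesis unfolding vol_density_def[abs_def] det_3
    by (intro continuous_on_real_sqrt continuous_on_add continuous_on_diff continuous_on_mult G)
qed

section \<open>Period strips as charts\<close>

text \<open>The parameter of the base point when the curve is cut at a. The cut stays variable
  because strips with two different cuts are needed to cover M.\<close>

definition base :: "real \<Rightarrow> C3 \<Rightarrow> real" where "base a v = the_inv_into {a..<a + l} c (num v / den v)"

lemma base_den:
  assumes "v \<in> homog" "abs_H2 v \<in> M"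
  shows "den v \<noteq> 0"
  using assms abs_H2_in_M_iff[OF assms(1)] by simp

lemma base:
  assumes "v \<in> homog" "abs_H2 v \<in> M"
  shows "base a v \<in> {a..<a + l}" "c (base a v) = num v / den v"
proof -
  have m: "num v / den v \<in> c ` {a..<a + l}"
    using assms abs_H2_in_M_iff[OF assms(1)] range_c[of a] by simp
  show "base a v \<in> {a..<a + l}"
    unfolding base_def by (rule the_inv_into_into[OF inj_on_period m subset_refl])
  show "c (base a v) = num v / den v"
    unfolding base_def by (rule f_the_inv_into_f[OF inj_on_period m])
qed

lemma base_eqI:
  assumes "v \<in> homog" "abs_H2 v \<in> M" "s \<in> {a..<a + l}" "c s = num v / den v"
  shows "base a v = s"
  unfolding base_def assms(4)[symmetric] by (rule the_inv_into_f_f[OF inj_on_period assms(3)])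

lemma \<phi>_\<Phi>_inv_base:
  assumes "v \<in> homog" "abs_H2 v \<in> M"
  shows "\<phi> (\<Phi>_inv v (base a v)) = abs_H2 v"
  using abs_H2_\<Phi>_inv[OF assms(1) base_den[OF assms]] base(2)[OF assms] by metis

definition period_strip :: "real \<Rightarrow> (real^3) set" where "period_strip a = {y. y$1 \<in> {a<..<a + l}}"

lemma open_period_strip: "open (period_strip a)"
proof -
  have "period_strip a = (\<lambda>y. y$1) -` {a<..<a + l}" by (auto simp: period_strip_def)
  moreover have "open ((\<lambda>y::real^3. y$1) -` {a<..<a + l})"
    by (rule open_vimage) (auto intro: continuous_on_component continuous_on_id)
  ultimately show ?thesis by simp
qed

text \<open>Pairing the tangent vector with \<sigma> isolates the orbit speed a, and horizontality
  makes it 0. The positivity of \<rho> then gives the s component, and the w components are read off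
  directly.\<close>

lemma \<Phi>_immersion:
  assumes "frechet_derivative \<Phi> (at x) h \<in> orbit_tangent (\<Phi> x)"
  shows "h = 0"
proof -
  have C: "Complex a b = of_real a + \<i> * of_real b" for a b by (simp add: complex_eq_iff)
  have d\<sigma>: "((\<lambda>y. \<sigma> k (y$1)) has_derivative (\<lambda>h. h$1 *\<^sub>R \<sigma>' k (x$1))) (at x)" for k
    using has_derivative_compose[OF has_derivative_nth \<sigma>_deriv[unfolded has_vector_derivative_def]] .
  have d\<Phi>: "(\<Phi> has_derivative (\<lambda>h. (h$1 *\<^sub>R \<sigma>' 1 (x$1), h$1 *\<^sub>R \<sigma>' 2 (x$1), of_real (h$2) + \<i> * of_real (h$3)))) (at x)"
    unfolding \<Phi>_def[abs_def] C
    by (intro has_derivative_Pair d\<sigma> has_derivative_add has_derivative_mult_right has_derivative_of_real has_derivative_nth)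
  have "(h$1 *\<^sub>R \<sigma>' 1 (x$1), h$1 *\<^sub>R \<sigma>' 2 (x$1), complex_of_real (h$2) + \<i> * of_real (h$3)) \<in> orbit_tangent (\<Phi> x)"
    using assms unfolding frechet_derivative_at[OF d\<Phi>, symmetric] .
  then obtain a where a: "h$1 * \<sigma>' 1 (x$1) = a * \<sigma> 1 (x$1)" "h$1 * \<sigma>' 2 (x$1) = a * \<sigma> 2 (x$1)"
     "complex_of_real (h$2) + \<i> * of_real (h$3) = - 2 * a * Complex (x$2) (x$3)"
    unfolding \<Phi>_def by (auto simp: scaleR_conv_of_real)
  have "a = a * (\<sigma> 1 (x$1) * cnj (\<sigma> 1 (x$1)) + \<sigma> 2 (x$1) * cnj (\<sigma> 2 (x$1)))" by (simp add: \<sigma>_unit')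
  also have "\<dots> = (a * \<sigma> 1 (x$1)) * cnj (\<sigma> 1 (x$1)) + (a * \<sigma> 2 (x$1)) * cnj (\<sigma> 2 (x$1))"
    by (simp add: algebra_simps)
  also have "\<dots> = h$1 * (\<sigma>' 1 (x$1) * cnj (\<sigma> 1 (x$1)) + \<sigma>' 2 (x$1) * cnj (\<sigma> 2 (x$1)))"
    unfolding a(1,2)[symmetric] by (simp add: algebra_simps)
  also have "\<dots> = 0" by (simp add: \<sigma>_horizontal)
  finally have a0: "a = 0" .
  have "\<rho> (x$1) \<noteq> 0" using \<rho>_pos[of "x$1"] by simp
  then have "h$1 = 0" using a(1,2) by (auto simp: a0 \<rho>_def)
  moreover have "h$2 = 0" "h$3 = 0" using a(3) by (simp_all add: a0 complex_eq_iff)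
  ultimately show "h = 0" by (simp add: vec_eq_iff forall_3)
qed

text \<open>The image is M without the fibre over c a. In homogeneous coordinates this is an
  inequation, so openness in M follows from openness of the quotient map.\<close>

lemma \<phi>_period_strip: "\<phi> ` period_strip a = {p \<in> M. \<exists>v\<in>homog. p = abs_H2 v \<and> num v \<noteq> c a * den v}"
proof (intro set_eqI iffI)
  fix p assume "p \<in> \<phi> ` period_strip a"
  then obtain y where y: "y \<in> period_strip a" "p = \<phi> y" by auto
  have "c (y$1) \<noteq> c a"
    using inj_onD[OF inj_on_period, of "y$1" a a] y l_pos by (auto simp: period_strip_def)
  then show "p \<in> {p \<in> M. \<exists>v\<in>homog. p = abs_H2 v \<and> num v \<noteq> c a * den v}"
    using \<Phi>_in_M[of y] \<Phi>_homog[of y] \<mu>_nz by (auto simp: y(2) num_den_\<Phi> intro!: bexI[of _ "\<Phi> y"])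
next
  fix p assume "p \<in> {p \<in> M. \<exists>v\<in>homog. p = abs_H2 v \<and> num v \<noteq> c a * den v}"
  then obtain v where v: "v \<in> homog" "abs_H2 v \<in> M" "p = abs_H2 v" "num v \<noteq> c a * den v" by auto
  note b = base[OF v(1,2), of a]
  have "base a v \<noteq> a" using b(2) v(4) base_den[OF v(1,2)] by (auto simp: field_simps)
  then have "\<Phi>_inv v (base a v) \<in> period_strip a" using b(1) by (simp add: period_strip_def)
  then show "p \<in> \<phi> ` period_strip a" using \<phi>_\<Phi>_inv_base[OF v(1,2), of a] v(3) by (metis imageI)
qed

lemma openin_\<phi>_period_strip: "openin (top_of_set M) (\<phi> ` period_strip a)"
proof -
  let ?W = "{v \<in> homog. num v \<noteq> c a * den v}"
  have "?W = homog \<inter> {v. num v \<noteq> c a * den v}" by auto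
  moreover have "open (homog \<inter> {v. num v \<noteq> c a * den v})"
    unfolding num_def den_def by (intro open_Int open_homog open_Collect_neq continuous_intros)
  ultimately have "open (abs_H2 ` ?W)" by (intro open_abs_H2_image) auto
  moreover have "\<phi> ` period_strip a = M \<inter> abs_H2 ` ?W" unfolding \<phi>_period_strip by auto
  ultimately show ?thesis by (auto simp: openin_open)
qed

text \<open>Off the cut, \<open>c_near\<close> gives a translate of the parameter close to the old
  one, and that translate still lies in the chosen period, so it is the parameter itself.\<close>

lemma continuous_base:
  "continuous_on {v \<in> homog. abs_H2 v \<in> \<phi> ` period_strip a} (base a)"
  unfolding continuous_on_iff
proof (intro ballI allI impI)
  fix v0 and e :: real assume v0: "v0 \<in> {v \<in> homog. abs_H2 v \<in> \<phi> ` period_strip a}" and e: "e > 0"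
  let ?D = "{v \<in> homog. abs_H2 v \<in> \<phi> ` period_strip a}"
  have D: "v \<in> homog" "abs_H2 v \<in> M" "base a v \<noteq> a" if vD: "v \<in> ?D" for v
  proof -
    obtain y where y: "y \<in> period_strip a" "abs_H2 v = \<phi> y" using vD by blast
    show v: "v \<in> homog" "abs_H2 v \<in> M" using vD y \<Phi>_in_M by auto
    have "\<phi> (\<Phi>_inv v (base a v)) = \<phi> y" using \<phi>_\<Phi>_inv_base[OF v] y by simp
    then have "\<Phi>_inv v (base a v) = y"
      by (rule inj_onD[OF \<Phi>_inj_on[of a]]) (use base[OF v, of a] y in \<open>auto simp: period_strip_def\<close>)
    then have "base a v = y$1" by (metis \<Phi>_inv_nth(1))
    then show "base a v \<noteq> a" using y by (auto simp: period_strip_def)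
  qed
  let ?s = "base a v0"
  \<comment> \<open>The distances to both ends of the period are included so that the nearby
    translate cannot leave it.\<close>
  define e' where "e' = Min {e, ?s - a, a + l - ?s}"
  have e': "e' > 0" "e' \<le> e" "e' \<le> ?s - a" "e' \<le> a + l - ?s"
    using base[OF D(1,2)[OF v0], of a] D(3)[OF v0] e by (auto simp: e'_def)
  obtain d where d: "d > 0" "\<And>s. dist (c s) (c ?s) < d \<Longrightarrow> \<exists>k::int. \<bar>s + of_int k * l - ?s\<bar> < e'"
    using c_near[OF e'(1)] by metis
  have nd: "continuous_on S num" "continuous_on S den" for S
    unfolding num_def[abs_def] den_def[abs_def] by (intro continuous_intros)+
  have "continuous_on ?D (\<lambda>v. num v / den v)"
    by (rule continuous_on_divide[OF nd]) (use base_den[OF D(1,2)] in blast)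
  then obtain d' where d': "d' > 0" "\<And>v. v \<in> ?D \<Longrightarrow> dist v v0 < d' \<Longrightarrow> dist (num v / den v) (num v0 / den v0) < d"
    using v0 d(1) unfolding continuous_on_iff by meson
  have "dist (base a v) ?s < e" if v: "v \<in> ?D" "dist v v0 < d'" for v
  proof -
    have "dist (c (base a v)) (c ?s) < d"
      using d'(2)[OF v] base(2)[OF D(1,2)[OF v(1)]] base(2)[OF D(1,2)[OF v0]] by simp
    then obtain k :: int where k: "\<bar>base a v + of_int k * l - ?s\<bar> < e'" using d(2) by blast
    then have "base a v + of_int k * l \<in> {a..<a + l}" using e' by auto
    then have "base a v = base a v + of_int k * l"
      by (rule inj_onD[OF inj_on_period[of a], rotated -1])
         (use base(1)[OF D(1,2)[OF v(1)], of a] in \<open>simp_all add: c_add_int\<close>)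
    then have z: "of_int k * l = 0" by linarith
    show ?thesis using k e'(2) unfolding z by (simp add: dist_real_def)
  qed
  then show "\<exists>d>0. \<forall>v\<in>?D. dist v v0 < d \<longrightarrow> dist (base a v) ?s < e" using d'(1) by blast
qed

text \<open>The inverse is continuous because its composition with the quotient map is the explicit
  expression \<open>\<Phi>_inv v (base a v)\<close>.\<close>

lemma homeomorphism_\<phi>:
  "\<exists>\<kappa>. homeomorphism (period_strip a) (\<phi> ` period_strip a) \<phi> \<kappa>"
proof -
  let ?S = "period_strip a"
  have sub: "?S \<subseteq> {y. y$1 \<in> {a..<a + l}}" by (auto simp: period_strip_def)
  have inj: "inj_on \<phi> ?S" by (rule inj_on_subset[OF \<Phi>_inj_on sub])
  define \<kappa> where "\<kappa> = the_inv_into ?S \<phi>"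
  have \<kappa>: "\<kappa> (\<phi> y) = y" if "y \<in> ?S" for y unfolding \<kappa>_def by (rule the_inv_into_f_f[OF inj that])
  let ?D = "{v \<in> homog. abs_H2 v \<in> \<phi> ` ?S}"
  have eq: "\<Phi>_inv v (base a v) = \<kappa> (abs_H2 v)" if vD: "v \<in> ?D" for v
  proof -
    obtain y where y: "y \<in> ?S" "abs_H2 v = \<phi> y" using vD by blast
    have v: "v \<in> homog" "abs_H2 v \<in> M" using vD y \<Phi>_in_M by auto
    have "\<phi> (\<Phi>_inv v (base a v)) = \<phi> y" using \<phi>_\<Phi>_inv_base[OF v] y by simp
    then have "\<Phi>_inv v (base a v) = y"
      by (rule inj_onD[OF \<Phi>_inj_on[of a]]) (use base[OF v, of a] y sub in auto)
    then show ?thesis using \<kappa>[OF y(1)] y(2) by simp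
  qed
  have \<sigma>c: "continuous_on UNIV (\<sigma> k)" for k by (rule smooth_on_imp_continuous_on[OF smooth_\<sigma>])
  have "continuous_on ?D (\<lambda>v. \<sigma> k (base a v))" for k
    by (rule continuous_on_compose2[OF \<sigma>c continuous_base]) simp
  then have "continuous_on ?D (\<lambda>v. \<Phi>_inv v (base a v))"
    unfolding \<Phi>_inv_def Let_def coef_def by (intro continuous_intros continuous_base)
  then have "continuous_on ?D (\<lambda>v. \<kappa> (abs_H2 v))" by (rule continuous_on_eq) (rule eq)
  then have "continuous_on (\<phi> ` ?S) \<kappa>" by (rule continuous_on_H2)
  then have "homeomorphism ?S (\<phi> ` ?S) \<phi> \<kappa>"
    using \<kappa> continuous_\<phi> by (auto simp: homeomorphism_def image_image)
  then show ?thesis by blast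
qed

lemma local_param_\<Phi>: "local_param M (period_strip a) \<Phi>"
  unfolding local_param_def
  using open_period_strip smooth_on_subset[OF smooth_\<Phi> subset_UNIV] \<Phi>_homog \<Phi>_immersion
    openin_\<phi>_period_strip homeomorphism_\<phi> by (auto simp: comp_def)

text \<open>\<open>lift_metric\<close> applied to \<Phi> itself with the first coordinate as
  parameter: the coordinate change is the identity.\<close>

lemma vol_density_\<Phi>: "vol_density (induced_metric t \<Phi>) y = dens y"
proof -
  have lift: "den (\<Phi> x) \<noteq> 0 \<and> c (x$1) = num (\<Phi> x) / den (\<Phi> x)" for x
    by (simp add: num_den_\<Phi> \<mu>_nz)
  have nth: "smooth_on UNIV (\<lambda>y::real^3. y $ 1)" by (rule smooth_on_bounded_linear[OF bounded_linear_vec_nth])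
  have id: "\<Phi>_inv (\<Phi> x) (x$1) = x" for x
    using \<Phi>_eqD(2)[OF abs_H2_\<Phi>_inv[OF \<Phi>_homog], of x "x$1"] lift[of x] by simp
  have J: "jac_mat (\<lambda>x. x) y = mat 1" by (simp add: jac_mat_def matrix_def mat_def axis_def vec_eq_iff)
  have "induced_metric t \<Phi> y = G0 y"
    using lift_metric(1)[OF open_UNIV smooth_\<Phi> nth _ lift UNIV_I, of y] \<Phi>_homog by (auto simp: id J transpose_mat)
  then show ?thesis using vol_density_G0[of y] by (simp add: vol_density_def)
qed

end

context lifted_curve
begin

section \<open>The volume measure from a fundamental domain\<close>

text \<open>Half-open, so that \<phi> maps it bijectively onto M.\<close>

definition FD :: "(real^3) set" where "FD = {y. y$1 \<in> {0..<l}}"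

lemma nth_measurable [measurable]: "(\<lambda>y::real^3. y $ i) \<in> borel_measurable borel"
  by (rule borel_measurable_continuous_onI) (auto intro: continuous_on_component continuous_on_id)

lemma FD_borel [measurable]: "FD \<in> sets borel"
  unfolding FD_def by measurable

lemma dens_measurable [measurable]: "dens \<in> borel_measurable borel"
  by (rule borel_measurable_continuous_onI[OF continuous_dens])

lemma measurable_\<phi> [measurable]: "\<phi> \<in> measurable borel (restrict_space borel M)"
  by (rule measurable_restrict_space2) (auto simp: \<Phi>_in_M intro: borel_measurable_continuous_onI continuous_\<phi>)

definition vol :: "H2 measure" where
  "vol = distr (density lborel (\<lambda>y. ennreal (indicator FD y * dens y))) (restrict_space borel M) \<phi>"

lemma sets_vol: "sets vol = sets (restrict_space borel M)"
  by (simp add: vol_def)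

lemma space_vol: "space vol = M"
  by (simp add: vol_def space_restrict_space)

lemma vimage_borel: "B \<in> sets (restrict_space borel M) \<Longrightarrow> \<phi> -` B \<in> sets borel"
  using measurable_sets[OF measurable_\<phi>, of B] by simp

lemma nn_integral_vol:
  assumes "f \<in> borel_measurable (restrict_space borel M)"
  shows "(\<integral>\<^sup>+p. f p \<partial>vol) = (\<integral>\<^sup>+y\<in>FD. ennreal (dens y) * f (\<phi> y) \<partial>lborel)"
proof -
  have m: "(\<lambda>y. f (\<phi> y)) \<in> borel_measurable borel"
    using measurable_compose[OF measurable_\<phi> assms] .
  have "(\<integral>\<^sup>+p. f p \<partial>vol) = (\<integral>\<^sup>+y. f (\<phi> y) \<partial>density lborel (\<lambda>y. ennreal (indicator FD y * dens y)))"
    unfolding vol_def using assms by (subst nn_integral_distr) auto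
  also have "\<dots> = (\<integral>\<^sup>+y. ennreal (indicator FD y * dens y) * f (\<phi> y) \<partial>lborel)"
    using m by (subst nn_integral_density) auto
  also have "\<dots> = (\<integral>\<^sup>+y\<in>FD. ennreal (dens y) * f (\<phi> y) \<partial>lborel)"
    by (intro nn_integral_cong) (auto simp: indicator_def)
  finally show ?thesis .
qed

lemma emeasure_vol:
  assumes B: "B \<in> sets (restrict_space borel M)"
  shows "emeasure vol B = (\<integral>\<^sup>+y\<in>FD \<inter> \<phi> -` B. ennreal (dens y) \<partial>lborel)"
proof -
  have "emeasure vol B = (\<integral>\<^sup>+p. indicator B p \<partial>vol)"
    using B by (simp add: sets_vol)
  also have "\<dots> = (\<integral>\<^sup>+y\<in>FD. ennreal (dens y) * indicator B (\<phi> y) \<partial>lborel)"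
    using B by (subst nn_integral_vol) auto
  also have "\<dots> = (\<integral>\<^sup>+y\<in>FD \<inter> \<phi> -` B. ennreal (dens y) \<partial>lborel)"
    by (intro nn_integral_cong) (auto simp: indicator_def)
  finally show ?thesis .
qed

lemma \<phi>_inj_FD: "inj_on \<phi> FD"
  using \<Phi>_inj_on[of 0] by (simp add: FD_def)

lemma local_paramD:
  assumes P: "local_param M U \<Psi>"
  shows "open U" "smooth_on U \<Psi>" "\<Psi> ` U \<subseteq> homog" "\<And>x. x \<in> U \<Longrightarrow> abs_H2 (\<Psi> x) \<in> M"
    "inj_on (\<lambda>x. abs_H2 (\<Psi> x)) U"
    "\<And>E. E \<in> sets borel \<Longrightarrow> E \<subseteq> U \<Longrightarrow> (\<lambda>x. abs_H2 (\<Psi> x)) ` E \<in> sets (restrict_space borel M)"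
proof -
  show "open U" "smooth_on U \<Psi>" "\<Psi> ` U \<subseteq> homog" using P unfolding local_param_def by blast+
  obtain \<kappa> where \<kappa>: "homeomorphism U ((abs_H2 \<circ> \<Psi>) ` U) (abs_H2 \<circ> \<Psi>) \<kappa>" using P unfolding local_param_def by blast
  have op: "openin (top_of_set M) ((abs_H2 \<circ> \<Psi>) ` U)" using P unfolding local_param_def by blast
  show "abs_H2 (\<Psi> x) \<in> M" if "x \<in> U" for x using openin_imp_subset[OF op] that by auto
  show "inj_on (\<lambda>x. abs_H2 (\<Psi> x)) U"
    using \<kappa> unfolding homeomorphism_def comp_def by (metis inj_on_inverseI)
  show "(\<lambda>x. abs_H2 (\<Psi> x)) ` E \<in> sets (restrict_space borel M)" if "E \<in> sets borel" "E \<subseteq> U" for E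
    using image_in_restrict_borel[OF \<open>open U\<close> op \<kappa> that] by (simp add: comp_def)
qed

text \<open>The coordinate change \<tau> into the fundamental domain need not be continuous on U.
  The hypothesis \<open>loc\<close> says that near each point of S it agrees on S with a smooth map,
  which is enough for derivatives within S and so for the change of variables.\<close>

lemma vol_chart_piece:
  assumes P: "local_param M U \<Psi>" and S: "S \<in> sets borel" "S \<subseteq> U"
    and loc: "\<And>x. x \<in> S \<Longrightarrow> \<exists>V \<eta>. open V \<and> x \<in> V \<and> V \<subseteq> U \<and> smooth_on V \<eta> \<and>
       (\<forall>y\<in>V. den (\<Psi> y) \<noteq> 0 \<and> c (\<eta> y) = num (\<Psi> y) / den (\<Psi> y)) \<and> (\<forall>y\<in>V \<inter> S. \<eta> y = base 0 (\<Psi> y))"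
  shows "(\<integral>\<^sup>+x\<in>S. ennreal (vol_density (induced_metric t \<Psi>) x) \<partial>lborel) = emeasure vol ((\<lambda>x. abs_H2 (\<Psi> x)) ` S)"
proof -
  note U = local_paramD[OF P]
  let ?\<psi> = "\<lambda>x. abs_H2 (\<Psi> x)" and ?vol = "vol_density (induced_metric t \<Psi>)"
  define \<tau> where "\<tau> x = \<Phi>_inv (\<Psi> x) (base 0 (\<Psi> x))" for x
  have hom: "\<Psi> x \<in> homog" if "x \<in> U" for x using U(3) that by blast
  have \<phi>\<tau>: "\<phi> (\<tau> x) = ?\<psi> x" if "x \<in> U" for x
    unfolding \<tau>_def by (rule \<phi>_\<Phi>_inv_base[OF hom U(4)]) (rule that)+
  have \<tau>FD: "\<tau> x \<in> FD" if "x \<in> U" for x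
    using base(1)[OF hom[OF that] U(4)[OF that], of 0] by (simp add: \<tau>_def FD_def)
  have inj: "inj_on \<tau> S"
  proof (rule inj_onI)
    fix x y assume xy: "x \<in> S" "y \<in> S" "\<tau> x = \<tau> y"
    then have xyU: "x \<in> U" "y \<in> U" using S(2) by auto
    have "?\<psi> x = ?\<psi> y" using \<phi>\<tau>[OF xyU(1)] \<phi>\<tau>[OF xyU(2)] xy(3) by simp
    then show "x = y" by (rule inj_onD[OF U(5) _ xyU])
  qed
  have img: "\<tau> ` S = FD \<inter> \<phi> -` (?\<psi> ` S)"
  proof (intro set_eqI iffI)
    fix y assume "y \<in> \<tau> ` S"
    then obtain x where "x \<in> S" "y = \<tau> x" by blast
    then show "y \<in> FD \<inter> \<phi> -` (?\<psi> ` S)" using \<tau>FD[of x] \<phi>\<tau>[of x] S(2) by auto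
  next
    fix y assume "y \<in> FD \<inter> \<phi> -` (?\<psi> ` S)"
    then obtain x where x: "y \<in> FD" "x \<in> S" "\<phi> y = ?\<psi> x" by blast
    then have "y = \<tau> x" using \<phi>\<tau>[of x] \<tau>FD[of x] S(2) by (intro inj_onD[OF \<phi>_inj_FD]) auto
    then show "y \<in> \<tau> ` S" using x(2) by blast
  qed
  have "\<exists>D. (\<tau> has_derivative D) (at x within S) \<and> ?vol x = \<bar>det (matrix D)\<bar> * dens (\<tau> x)" if x: "x \<in> S" for x
  proof -
    obtain V \<eta> where V: "open V" "x \<in> V" "V \<subseteq> U" "smooth_on V \<eta>"
       "\<And>y. y \<in> V \<Longrightarrow> den (\<Psi> y) \<noteq> 0 \<and> c (\<eta> y) = num (\<Psi> y) / den (\<Psi> y)" "\<And>y. y \<in> V \<inter> S \<Longrightarrow> \<eta> y = base 0 (\<Psi> y)"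
      using loc[OF x] by metis
    define \<tau>' where "\<tau>' y = \<Phi>_inv (\<Psi> y) (\<eta> y)" for y
    have \<Psi>V: "smooth_on V \<Psi>" "\<Psi> ` V \<subseteq> homog" using U V(3) smooth_on_subset by blast+
    let ?D = "frechet_derivative \<tau>' (at x)"
    have "(\<tau>' has_derivative ?D) (at x)"
      unfolding \<tau>'_def[abs_def] by (rule smooth_on_has_derivative[OF smooth_\<Phi>_inv[OF V(1) \<Psi>V(1) V(4)] V(2)])
    then have d: "(\<tau>' has_derivative ?D) (at x within S)" by (rule has_derivative_at_withinI)
    obtain e where e: "e > 0" "ball x e \<subseteq> V" using V(1,2) openE by blast
    have "(\<tau> has_derivative ?D) (at x within S)"
      by (rule has_derivative_transform_within[OF d e(1) x])
         (use e(2) V(6) in \<open>auto simp: \<tau>_def \<tau>'_def dist_commute subset_iff\<close>)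
    moreover have "induced_metric t \<Psi> x = transpose (jac_mat \<tau>' x) ** G0 (\<tau>' x) ** jac_mat \<tau>' x"
      unfolding \<tau>'_def[abs_def] by (rule lift_metric(1)[OF V(1) \<Psi>V(1) V(4) \<Psi>V(2) V(5) V(2)])
    then have "?vol x = \<bar>det (jac_mat \<tau>' x)\<bar> * sqrt (det (G0 (\<tau>' x)))"
      by (simp add: vol_density_def det_mul det_transpose real_sqrt_mult)
    then have "?vol x = \<bar>det (matrix ?D)\<bar> * dens (\<tau>' x)"
      using vol_density_G0[of "\<tau>' x"] by (simp add: vol_density_def jac_mat_def)
    moreover have "\<tau>' x = \<tau> x" using V(6)[of x] V(2) x by (simp add: \<tau>_def \<tau>'_def)
    ultimately show ?thesis by auto
  qed
  then obtain D where D: "\<And>x. x \<in> S \<Longrightarrow> (\<tau> has_derivative D x) (at x within S)"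
      "\<And>x. x \<in> S \<Longrightarrow> ?vol x = \<bar>det (matrix (D x))\<bar> * dens (\<tau> x)"
    by metis
  have B: "?\<psi> ` S \<in> sets (restrict_space borel M)" by (rule U(6)[OF S])
  have imgm: "\<tau> ` S \<in> sets borel" unfolding img using vimage_borel[OF B] by simp
  have "(\<integral>\<^sup>+x\<in>S. ennreal (?vol x) \<partial>lborel) = (\<integral>\<^sup>+y\<in>\<tau> ` S. ennreal (dens y) \<partial>lborel)"
  proof (rule nn_integral_change_of_variables[OF S(1) D(1) inj D(2)])
    show "set_borel_measurable borel S ?vol"
      unfolding set_borel_measurable_def
      by (rule borel_measurable_continuous_on_indicator[OF S(1) continuous_on_subset[OF continuous_vol_density[OF U(1-3)] S(2)]])
    show "set_borel_measurable borel (\<tau> ` S) dens"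
      unfolding set_borel_measurable_def
      by (rule borel_measurable_continuous_on_indicator[OF imgm continuous_dens])
    show "0 \<le> dens y" for y using dens_pos[of y] by simp
  qed
  then show ?thesis unfolding emeasure_vol[OF B] img .
qed

text \<open>A chart is cut along the fibre over \<open>c 0\<close>, where the fundamental domain wraps around; on each
  of the two pieces the coordinate change has a derivative within the piece.\<close>
lemma vol_chart:
  assumes P: "local_param M U \<Psi>" and E: "E \<in> sets borel" "E \<subseteq> U"
  shows "emeasure vol ((\<lambda>x. abs_H2 (\<Psi> x)) ` E) = (\<integral>\<^sup>+x\<in>E. ennreal (vol_density (induced_metric t \<Psi>) x) \<partial>lborel)"
proof -
  note U = local_paramD[OF P]
  let ?\<psi> = "\<lambda>x. abs_H2 (\<Psi> x)" and ?vol = "vol_density (induced_metric t \<Psi>)"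
  have hom: "\<Psi> x \<in> homog" if "x \<in> U" for x using U(3) that by blast
  \<comment> \<open>It vanishes exactly on the fibre over c 0, where the parameter in the
    fundamental domain is 0.\<close>
  let ?f = "\<lambda>x. num (\<Psi> x) - c 0 * den (\<Psi> x)"
  define O' where "O' = U \<inter> ?f -` (- {0})"
  have "continuous_on U \<Psi>" by (rule smooth_on_imp_continuous_on[OF U(2)])
  then have "continuous_on U ?f" unfolding num_def den_def by (intro continuous_intros)
  then have O': "open O'" unfolding O'_def using U(1) by (intro continuous_open_preimage) auto
  define E1 where "E1 = E - O'"
  define E2 where "E2 = E \<inter> O'"
  have E12: "E1 \<in> sets borel" "E2 \<in> sets borel" "E1 \<subseteq> U" "E2 \<subseteq> U" "E1 \<inter> E2 = {}" "E = E1 \<union> E2"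
    using E O' by (auto simp: E1_def E2_def)
  have b0: "base 0 (\<Psi> x) = 0 \<longleftrightarrow> x \<notin> O'" if "x \<in> U" for x
  proof -
    have b: "base 0 (\<Psi> x) \<in> {0..<0 + l}" "c (base 0 (\<Psi> x)) = num (\<Psi> x) / den (\<Psi> x)" "den (\<Psi> x) \<noteq> 0"
      using base[OF hom[OF that] U(4)[OF that], of 0] base_den[OF hom[OF that] U(4)[OF that]] by simp_all
    have "base 0 (\<Psi> x) = 0 \<longleftrightarrow> c (base 0 (\<Psi> x)) = c 0"
      using inj_onD[OF inj_on_period, of "base 0 (\<Psi> x)" 0 0] b(1) l_pos by auto
    also have "\<dots> \<longleftrightarrow> x \<notin> O'" using b(2,3) that by (auto simp: O'_def field_simps)
    finally show ?thesis .
  qed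
  have lift: "\<exists>V \<eta>. open V \<and> x \<in> V \<and> V \<subseteq> U \<and> smooth_on V \<eta> \<and>
       (\<forall>y\<in>V. den (\<Psi> y) \<noteq> 0 \<and> c (\<eta> y) = num (\<Psi> y) / den (\<Psi> y)) \<and> (\<forall>y\<in>V. \<bar>\<eta> y - base 0 (\<Psi> x)\<bar> < e)"
    if "x \<in> U" "e > 0" for x e
    using local_lift[OF P that(1) base(2)[OF hom[OF that(1)] U(4)[OF that(1)]] that(2)] by metis
  have p1: "(\<integral>\<^sup>+x\<in>E1. ennreal (?vol x) \<partial>lborel) = emeasure vol (?\<psi> ` E1)"
  proof (rule vol_chart_piece[OF P E12(1,3)])
    fix x assume x: "x \<in> E1"
    then have xU: "x \<in> U" and bx: "base 0 (\<Psi> x) = 0" using E12(3) b0[of x] by (auto simp: E1_def)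
    \<comment> \<open>A lift over the fibre is an integer multiple of l. Keeping it below l in
      modulus forces it to be 0, the value of \<open>base\<close>.\<close>
    obtain V \<eta> where V: "open V" "x \<in> V" "V \<subseteq> U" "smooth_on V \<eta>"
      "\<And>y. y \<in> V \<Longrightarrow> den (\<Psi> y) \<noteq> 0 \<and> c (\<eta> y) = num (\<Psi> y) / den (\<Psi> y)" "\<And>y. y \<in> V \<Longrightarrow> \<bar>\<eta> y\<bar> < l"
      using lift[OF xU l_pos] unfolding bx by auto
    have "\<eta> y = base 0 (\<Psi> y)" if y: "y \<in> V \<inter> E1" for y
    proof -
      have "y \<in> U" "y \<notin> O'" using y E12(3) by (auto simp: E1_def)
      then have by0: "base 0 (\<Psi> y) = 0" using b0 by blast
      have "c (\<eta> y) = c 0"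
        using V(5)[of y] y base(2)[OF hom U(4), OF \<open>y \<in> U\<close> \<open>y \<in> U\<close>, of 0] by0 by simp
      then obtain k :: int where k: "0 = \<eta> y + of_int k * l" by (auto simp: c_eq_iff)
      have "\<bar>of_int k * l\<bar> < 1 * l" using V(6)[of y] y k by auto
      then have "\<bar>real_of_int k\<bar> < 1" using l_pos by (simp add: abs_mult)
      then have "k = 0" by linarith
      then show ?thesis using k by0 by simp
    qed
    then show "\<exists>V \<eta>. open V \<and> x \<in> V \<and> V \<subseteq> U \<and> smooth_on V \<eta> \<and>
       (\<forall>y\<in>V. den (\<Psi> y) \<noteq> 0 \<and> c (\<eta> y) = num (\<Psi> y) / den (\<Psi> y)) \<and> (\<forall>y\<in>V \<inter> E1. \<eta> y = base 0 (\<Psi> y))"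
      using V by blast
  qed
  have p2: "(\<integral>\<^sup>+x\<in>E2. ennreal (?vol x) \<partial>lborel) = emeasure vol (?\<psi> ` E2)"
  proof (rule vol_chart_piece[OF P E12(2,4)])
    fix x assume x: "x \<in> E2"
    then have xU: "x \<in> U" and "base 0 (\<Psi> x) \<noteq> 0" using E12(4) b0[of x] by (auto simp: E2_def)
    moreover have "base 0 (\<Psi> x) \<in> {0..<0 + l}" by (rule base(1)[OF hom[OF xU] U(4)[OF xU]])
    \<comment> \<open>The distance from the parameter to the ends of the period: a lift this close
      stays inside the period and is therefore \<open>base\<close>.\<close>
    ultimately have e: "min (base 0 (\<Psi> x)) (l - base 0 (\<Psi> x)) > 0" by auto
    obtain V \<eta> where V: "open V" "x \<in> V" "V \<subseteq> U" "smooth_on V \<eta>"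
      "\<And>y. y \<in> V \<Longrightarrow> den (\<Psi> y) \<noteq> 0 \<and> c (\<eta> y) = num (\<Psi> y) / den (\<Psi> y)"
      "\<And>y. y \<in> V \<Longrightarrow> \<bar>\<eta> y - base 0 (\<Psi> x)\<bar> < min (base 0 (\<Psi> x)) (l - base 0 (\<Psi> x))"
      using lift[OF xU e] by auto
    have "\<eta> y = base 0 (\<Psi> y)" if y: "y \<in> V" for y
    proof (rule base_eqI[symmetric])
      show "\<Psi> y \<in> homog" "abs_H2 (\<Psi> y) \<in> M" using y V(3) hom U(4) by blast+
      show "\<eta> y \<in> {0..<0 + l}" using V(6)[OF y] by (auto simp: abs_if split: if_splits)
      show "c (\<eta> y) = num (\<Psi> y) / den (\<Psi> y)" using V(5)[OF y] by blast
    qed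
    then show "\<exists>V \<eta>. open V \<and> x \<in> V \<and> V \<subseteq> U \<and> smooth_on V \<eta> \<and>
       (\<forall>y\<in>V. den (\<Psi> y) \<noteq> 0 \<and> c (\<eta> y) = num (\<Psi> y) / den (\<Psi> y)) \<and> (\<forall>y\<in>V \<inter> E2. \<eta> y = base 0 (\<Psi> y))"
      using V by blast
  qed
  have m: "(\<lambda>x. ennreal (?vol x) * indicator S x) \<in> borel_measurable lborel" if S: "S \<in> sets borel" "S \<subseteq> U" for S
  proof -
    have "(\<lambda>x. indicator S x *\<^sub>R ?vol x) \<in> borel_measurable borel"
      by (rule borel_measurable_continuous_on_indicator[OF S(1) continuous_on_subset[OF continuous_vol_density[OF U(1-3)] S(2)]])
    then have "(\<lambda>x. ennreal (indicator S x *\<^sub>R ?vol x)) \<in> borel_measurable lborel" by simp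
    moreover have "ennreal (indicator S x *\<^sub>R ?vol x) = ennreal (?vol x) * indicator S x" for x
      by (simp add: indicator_def)
    ultimately show ?thesis by simp
  qed
  have "emeasure vol (?\<psi> ` E) = emeasure vol (?\<psi> ` E1 \<union> ?\<psi> ` E2)"
    unfolding E12(6) image_Un ..
  also have "\<dots> = emeasure vol (?\<psi> ` E1) + emeasure vol (?\<psi> ` E2)"
  proof (rule plus_emeasure[symmetric])
    show "?\<psi> ` E1 \<in> sets vol" "?\<psi> ` E2 \<in> sets vol" unfolding sets_vol using E12 U(6) by blast+
    show "?\<psi> ` E1 \<inter> ?\<psi> ` E2 = {}"
      using inj_on_image_Int[OF U(5) E12(3,4)] E12(5) by simp
  qed
  also have "\<dots> = (\<integral>\<^sup>+x. ennreal (?vol x) * indicator E1 x + ennreal (?vol x) * indicator E2 x \<partial>lborel)"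
    unfolding p1[symmetric] p2[symmetric] by (rule nn_integral_add[symmetric]) (use m E12 in auto)
  also have "\<dots> = (\<integral>\<^sup>+x\<in>E. ennreal (?vol x) \<partial>lborel)"
    using E12(5,6) by (intro nn_integral_cong) (auto simp: indicator_def)
  finally show ?thesis .
qed

text \<open>The choice operator has only one candidate: every Borel set of M splits into two pieces,
  each inside the image of one strip chart, and the chart condition fixes the measure of each
  piece.\<close>

lemma riemannian_volume_eq: "riemannian_volume M (eh_hypersurface t M) = vol"
proof -
  let ?P = "\<lambda>\<nu>. sets \<nu> = sets (restrict_space borel M) \<and>
     (\<forall>(U, \<psi>, G)\<in>eh_hypersurface t M. \<forall>E\<in>sets borel. E \<subseteq> U \<longrightarrow>
        emeasure \<nu> (\<psi> ` E) = (\<integral>\<^sup>+x\<in>E. ennreal (vol_density G x) \<partial>lborel))"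
  have ex: "?P vol"
    using vol_chart by (auto simp: sets_vol eh_hypersurface_def comp_def)
  have unique: "\<nu> = vol" if \<nu>: "?P \<nu>" for \<nu>
  proof (rule measure_eqI)
    show "sets \<nu> = sets vol" using \<nu> by (simp add: sets_vol)
    fix B assume "B \<in> sets \<nu>"
    then have B: "B \<in> sets (restrict_space borel M)" using \<nu> by simp
    have strip: "emeasure \<nu> (\<phi> ` E) = (\<integral>\<^sup>+y\<in>E. ennreal (dens y) \<partial>lborel)" "\<phi> ` E \<in> sets \<nu>"
      if E: "E \<in> sets borel" "E \<subseteq> period_strip a" for E a
    proof -
      have "(period_strip a, abs_H2 \<circ> \<Phi>, induced_metric t \<Phi>) \<in> eh_hypersurface t M"
        using local_param_\<Phi> by (auto simp: eh_hypersurface_def)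
      with \<nu> E have "emeasure \<nu> ((abs_H2 \<circ> \<Phi>) ` E) = (\<integral>\<^sup>+y\<in>E. ennreal (vol_density (induced_metric t \<Phi>) y) \<partial>lborel)"
        by blast
      then show "emeasure \<nu> (\<phi> ` E) = (\<integral>\<^sup>+y\<in>E. ennreal (dens y) \<partial>lborel)"
        by (simp add: vol_density_\<Phi> comp_def)
      show "\<phi> ` E \<in> sets \<nu>" using local_paramD(6)[OF local_param_\<Phi> E] \<nu> by simp
    qed
    let ?A = "FD \<inter> \<phi> -` B"
    let ?E1 = "?A \<inter> {y. y$1 = 0}" and ?E2 = "?A \<inter> {y. y$1 \<noteq> 0}"
    have A: "?A \<in> sets borel" using vimage_borel[OF B] by simp
    have Z: "{y::real^3. y$1 = 0} \<in> sets borel" "{y::real^3. y$1 \<noteq> 0} \<in> sets borel" by measurable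
    have E: "?E1 \<in> sets borel" "?E2 \<in> sets borel" using A Z by auto
    \<comment> \<open>The open strip starting at 0 omits the fibre s = 0, and the one starting at
      -l/2 contains that fibre in its interior.\<close>
    have sub: "?E1 \<subseteq> period_strip (- l / 2)" "?E2 \<subseteq> period_strip 0"
      using l_pos by (auto simp: period_strip_def FD_def)
    have "B \<subseteq> M" using sets.sets_into_space[OF B] by (simp add: space_restrict_space)
    then have "B \<subseteq> \<phi> ` ?A" using M_eq[of 0] by (force simp: FD_def)
    then have "B = \<phi> ` ?A" by auto
    also have "\<dots> = \<phi> ` ?E1 \<union> \<phi> ` ?E2" by blast
    finally have "emeasure \<nu> B = emeasure \<nu> (\<phi> ` ?E1 \<union> \<phi> ` ?E2)" by simp
    also have "\<dots> = emeasure \<nu> (\<phi> ` ?E1) + emeasure \<nu> (\<phi> ` ?E2)"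
    proof (rule plus_emeasure[symmetric])
      show "\<phi> ` ?E1 \<in> sets \<nu>" "\<phi> ` ?E2 \<in> sets \<nu>"
        using strip(2)[OF E(1) sub(1)] strip(2)[OF E(2) sub(2)] .
      show "\<phi> ` ?E1 \<inter> \<phi> ` ?E2 = {}"
        using inj_on_image_Int[OF \<phi>_inj_FD, of ?E1 ?E2] by auto
    qed
    also have "\<dots> = (\<integral>\<^sup>+y. ennreal (dens y) * indicator ?E1 y + ennreal (dens y) * indicator ?E2 y \<partial>lborel)"
      unfolding strip(1)[OF E(1) sub(1)] strip(1)[OF E(2) sub(2)]
      by (rule nn_integral_add[symmetric]) (use E in auto)
    also have "\<dots> = (\<integral>\<^sup>+y\<in>?A. ennreal (dens y) \<partial>lborel)"
      by (intro nn_integral_cong) (auto simp: indicator_def)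
    also have "\<dots> = emeasure vol B" by (rule emeasure_vol[OF B, symmetric])
    finally show "emeasure \<nu> B = emeasure vol B" .
  qed
  show ?thesis unfolding riemannian_volume_def by (rule some_equality[of ?P]) (use ex unique in blast)+
qed

end

section \<open>Approximate null vectors\<close>

context lifted_curve
begin

section \<open>Volumes of tubes\<close>

definition tube :: "real \<Rightarrow> H2 set" where "tube R = {p \<in> M. u1 p \<le> R}"

lemma tube_sets: "tube R \<in> sets (restrict_space borel M)"
proof -
  have "u1 -` {..R} \<in> sets borel"
    using measurable_sets[OF borel_measurable_continuous_onI[OF continuous_on_u1], of "{..R}"] by simp
  moreover have "tube R = u1 -` {..R} \<inter> M" by (auto simp: tube_def)
  ultimately show ?thesis by (auto simp: sets_restrict_space)
qed

definition solid :: "real \<Rightarrow> (real^3) set" where "solid R = {y \<in> FD. rad2 y \<le> R\<^sup>2}"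

lemma rad2_measurable [measurable]: "rad2 \<in> borel_measurable borel"
  unfolding rad2_def[abs_def] by measurable

lemma solid_borel: "solid R \<in> sets borel"
proof -
  have "{y. rad2 y \<le> R\<^sup>2} \<in> sets borel" by measurable
  moreover have "solid R = FD \<inter> {y. rad2 y \<le> R\<^sup>2}" by (auto simp: solid_def)
  ultimately show ?thesis by simp
qed

lemma u1_\<phi>_rad2: "(u1 (\<phi> y))\<^sup>2 = rad2 y" "u1 (\<phi> y) \<ge> 0"
  by (simp_all add: u1_\<Phi> cmod_power2 rad2_def)

lemma FD_tube: "R \<ge> 0 \<Longrightarrow> FD \<inter> \<phi> -` tube R = solid R"
  using u1_\<phi>_rad2 abs_le_square_iff[of "u1 (\<phi> y)" R for y]
  by (auto simp: tube_def solid_def \<Phi>_in_M)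

lemma emeasure_tube: "R \<ge> 0 \<Longrightarrow> emeasure vol (tube R) = (\<integral>\<^sup>+y\<in>solid R. ennreal (dens y) \<partial>lborel)"
  by (simp add: emeasure_vol[OF tube_sets] FD_tube)

text \<open>The fundamental domain is not closed. Adding the face s = l gives a compact set with the
  same image, used for finite volume and for compact supports.\<close>

definition closed_solid :: "real \<Rightarrow> (real^3) set" where
  "closed_solid R = {y. y$1 \<in> {0..l} \<and> rad2 y \<le> R\<^sup>2}"

lemma compact_closed_solid: "compact (closed_solid R)"
proof -
  have "closed_solid R \<subseteq> cball 0 (l + \<bar>R\<bar> + \<bar>R\<bar>)"
  proof
    fix y assume y: "y \<in> closed_solid R"
    have "(y$2)\<^sup>2 \<le> R\<^sup>2" "(y$3)\<^sup>2 \<le> R\<^sup>2" using y zero_le_power2[of "y$2"] zero_le_power2[of "y$3"]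
      unfolding closed_solid_def rad2_def mem_Collect_eq by linarith+
    then have "\<bar>y$2\<bar> \<le> \<bar>R\<bar>" "\<bar>y$3\<bar> \<le> \<bar>R\<bar>" by (simp_all add: abs_le_square_iff)
    moreover have "\<bar>y$1\<bar> \<le> l" using y by (auto simp: closed_solid_def)
    moreover have "norm y \<le> (\<Sum>i\<in>UNIV. \<bar>y$i\<bar>)" by (rule norm_le_l1_cart)
    ultimately show "y \<in> cball 0 (l + \<bar>R\<bar> + \<bar>R\<bar>)" by (simp add: sum_3)
  qed
  then have "bounded (closed_solid R)" using bounded_subset bounded_cball by blast
  moreover have "closed (closed_solid R)"
    unfolding closed_solid_def rad2_def atLeastAtMost_iff
    by (intro closed_Collect_conj closed_Collect_le continuous_intros)
  ultimately show ?thesis by (simp add: compact_eq_bounded_closed)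
qed

lemma emeasure_tube_finite:
  assumes "R \<ge> 0"
  shows "emeasure vol (tube R) < \<infinity>"
proof -
  have "bounded (dens ` closed_solid R)"
    by (intro compact_imp_bounded compact_continuous_image continuous_dens compact_closed_solid)
  then obtain C where C: "\<And>y. y \<in> closed_solid R \<Longrightarrow> \<bar>dens y\<bar> \<le> C" by (auto simp: bounded_real)
  have sub: "solid R \<subseteq> closed_solid R" by (auto simp: solid_def closed_solid_def FD_def)
  have "(\<integral>\<^sup>+y\<in>solid R. ennreal (dens y) \<partial>lborel) \<le> (\<integral>\<^sup>+y. ennreal C * indicator (closed_solid R) y \<partial>lborel)"
  proof (rule nn_integral_mono)
    fix y show "ennreal (dens y) * indicator (solid R) y \<le> ennreal C * indicator (closed_solid R) y"
      using C[of y] sub by (auto simp: indicator_def intro!: ennreal_leI)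
  qed
  also have "\<dots> = ennreal C * emeasure lborel (closed_solid R)"
    using compact_closed_solid by (intro nn_integral_cmult_indicator) (simp add: borel_compact)
  also have "\<dots> < \<infinity>"
    using emeasure_compact_finite[OF compact_closed_solid]
    by (simp add: ennreal_mult_less_top)
  finally show ?thesis by (simp add: emeasure_tube[OF assms])
qed

definition tube_vol :: "real \<Rightarrow> real" where "tube_vol R = measure vol (tube R)"

lemma tube_vol_eq: "R \<ge> 0 \<Longrightarrow> ennreal (tube_vol R) = (\<integral>\<^sup>+y\<in>solid R. ennreal (dens y) \<partial>lborel)"
  unfolding tube_vol_def using emeasure_tube_finite[of R]
  by (subst emeasure_eq_ennreal_measure[symmetric]) (auto simp: emeasure_tube)

text \<open>The density is positive, so zero volume would make the solid negligible, although it
  contains a nonempty open set.\<close>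

lemma tube_vol_pos:
  assumes "R > 0"
  shows "tube_vol R > 0"
proof (rule ccontr)
  assume "\<not> tube_vol R > 0"
  then have "tube_vol R = 0" by (simp add: tube_vol_def zero_less_measure_iff)
  then have "(\<integral>\<^sup>+y\<in>solid R. ennreal (dens y) \<partial>lborel) = 0" using tube_vol_eq[of R] assms by simp
  then have "AE y in lborel. ennreal (dens y) * indicator (solid R) y = 0"
    using solid_borel by (subst (asm) nn_integral_0_iff_AE) auto
  then have "AE y in lborel. y \<notin> solid R"
    by eventually_elim (use dens_pos in \<open>auto simp: indicator_def split: if_splits simp: less_le\<close>)
  then have null: "solid R \<in> null_sets lborel"
    using solid_borel by (simp add: AE_iff_null_sets)
  let ?O = "{y::real^3. 0 < y$1 \<and> y$1 < l \<and> rad2 y < R\<^sup>2}"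
  have "open ?O" unfolding rad2_def by (intro open_Collect_conj open_Collect_less continuous_intros)
  moreover have "(l / 2) *\<^sub>R axis 1 1 \<in> ?O" using l_pos assms by (simp add: rad2_def axis_def)
  ultimately have "\<not> negligible ?O" using open_not_negligible by blast
  moreover have "?O \<subseteq> solid R" by (auto simp: solid_def FD_def)
  moreover have "negligible (solid R)"
    using null by (simp add: negligible_iff_null_sets null_sets_completionI)
  ultimately show False using negligible_subset by blast
qed

text \<open>Halving w carries the solid of R onto that of R/2 with Jacobian 1/4. It decreases S and
  leaves \<rho> alone, so the density at the image point is at least as large.\<close>

lemma tube_vol_doubling:
  assumes "R \<ge> 0"
  shows "tube_vol R \<le> 4 * tube_vol (R / 2)"
proof -
  define g :: "real^3 \<Rightarrow> real^3" where "g y = (\<chi> i. if i = 1 then y$1 else y$i / 2)" for y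
  have lin: "linear g" by (rule linearI) (auto simp: g_def vec_eq_iff add_divide_distrib)
  have det: "det (matrix g) = 1 / 4"
    by (simp add: det_3 matrix_def g_def axis_def)
  have gn: "g y $ 1 = y$1" "g y $ 2 = y$2 / 2" "g y $ 3 = y$3 / 2" for y by (simp_all add: g_def)
  have rad: "rad2 (g y) = rad2 y / 4" for y by (simp add: rad2_def gn power_divide add_divide_distrib)
  have img: "g ` solid R = solid (R / 2)"
  proof (intro set_eqI iffI)
    fix y assume "y \<in> solid (R / 2)"
    then have "(\<chi> i. if i = 1 then y$1 else 2 * y$i) \<in> solid R"
      by (simp add: solid_def FD_def rad2_def power_mult_distrib power_divide)
    moreover have "y = g (\<chi> i. if i = 1 then y$1 else 2 * y$i)" by (simp add: g_def vec_eq_iff)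
    ultimately show "y \<in> g ` solid R" by blast
  qed (auto simp: solid_def FD_def gn rad power_divide)
  have cg: "continuous_on S g" for S by (rule linear_continuous_on) (simp add: lin linear_conv_bounded_linear[symmetric])
  have inj: "inj_on g (solid R)"
    by (rule inj_onI) (auto simp: vec_eq_iff forall_3 g_def)
  let ?h = "\<lambda>y. \<bar>det (matrix g)\<bar> * dens (g y)"
  have ch: "continuous_on UNIV (\<lambda>y. dens (g y))"
    by (rule continuous_on_compose2[OF continuous_dens cg]) auto
  have "(\<integral>\<^sup>+y\<in>solid R. ennreal (?h y) \<partial>lborel) = (\<integral>\<^sup>+y\<in>g ` solid R. ennreal (dens y) \<partial>lborel)"
  proof (rule nn_integral_change_of_variables[OF solid_borel _ inj refl])
    show "(g has_derivative g) (at x within solid R)" for x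
      by (rule bounded_linear_imp_has_derivative) (simp add: lin linear_conv_bounded_linear[symmetric])
    show "0 \<le> dens y" for y using dens_pos[of y] by simp
    show "set_borel_measurable borel (solid R) ?h"
      unfolding set_borel_measurable_def
      by (rule borel_measurable_continuous_on_indicator[OF solid_borel])
         (intro continuous_on_mult_left continuous_on_subset[OF ch subset_UNIV])
    show "set_borel_measurable borel (g ` solid R) dens"
      unfolding set_borel_measurable_def img
      by (rule borel_measurable_continuous_on_indicator[OF solid_borel continuous_dens])
  qed
  also have "\<dots> = ennreal (tube_vol (R / 2))" unfolding img using assms by (simp add: tube_vol_eq)
  finally have eq: "(\<integral>\<^sup>+y\<in>solid R. ennreal (?h y) \<partial>lborel) = ennreal (tube_vol (R / 2))" .
  have mono: "dens y \<le> 4 * ?h y" for y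
  proof -
    have "S0 (g y) \<le> S0 y"
      unfolding S0_rad2 rad by (intro real_sqrt_le_mono) (simp add: rad2_def)
    then have "\<rho> (y$1) / sqrt (2 * S0 y) \<le> \<rho> (y$1) / sqrt (2 * S0 (g y))"
      using S0_pos[of "g y"] \<rho>_pos[of "y$1"] by (intro divide_left_mono mult_pos_pos) auto
    then show ?thesis by (simp add: det dens_def gn)
  qed
  have "ennreal (tube_vol R) = (\<integral>\<^sup>+y\<in>solid R. ennreal (dens y) \<partial>lborel)" by (rule tube_vol_eq[OF assms])
  also have "\<dots> \<le> (\<integral>\<^sup>+y. 4 * (ennreal (?h y) * indicator (solid R) y) \<partial>lborel)"
  proof (rule nn_integral_mono)
    fix y
    have "ennreal (dens y) \<le> ennreal (4 * ?h y)" by (rule ennreal_leI[OF mono])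
    also have "\<dots> = 4 * ennreal (?h y)" by (subst ennreal_mult') auto
    finally show "ennreal (dens y) * indicator (solid R) y \<le> 4 * (ennreal (?h y) * indicator (solid R) y)"
      by (simp add: indicator_def)
  qed
  also have "\<dots> = 4 * (\<integral>\<^sup>+y\<in>solid R. ennreal (?h y) \<partial>lborel)"
  proof (rule nn_integral_cmult)
    have "(\<lambda>y. ennreal (?h y)) \<in> borel_measurable lborel"
      using borel_measurable_continuous_onI[OF ch] by simp
    then show "(\<lambda>y. ennreal (?h y) * indicator (solid R) y) \<in> borel_measurable lborel"
      using solid_borel by simp
  qed
  also have "\<dots> = ennreal (4 * tube_vol (R / 2))" unfolding eq by (subst ennreal_mult') auto
  finally show ?thesis by (subst (asm) ennreal_le_iff) (simp_all add: tube_vol_def)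
qed

section \<open>Bounds for the bumps and their Laplacians\<close>

lemma integrable_tube: "R \<ge> 0 \<Longrightarrow> integrable vol (\<lambda>p. k * indicator (tube R) p :: real)"
  using emeasure_tube_finite[of R] tube_sets by (intro integrable_mult_right integrable_real_indicator) (auto simp: sets_vol)

lemma integral_tube: "R \<ge> 0 \<Longrightarrow> (\<integral>p. k * indicator (tube R) p \<partial>vol) = k * tube_vol R"
  using tube_sets[of R] sets.sets_into_space[OF tube_sets[of R]]
  by (simp add: tube_vol_def sets_vol space_vol space_restrict_space Int_absorb2)

text \<open>All norms are estimated by pointwise comparison with multiples of indicators of tubes,
  asked on M only, where the measure lives.\<close>

lemma L2_bounds:
  assumes f: "continuous_on UNIV f" and R: "R \<ge> 0" and k: "\<And>p. p \<in> M \<Longrightarrow> (cmod (f p))\<^sup>2 \<le> k * indicator (tube R) p"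
  shows "f \<in> L2 vol" "(L2norm vol f)\<^sup>2 \<le> k * tube_vol R"
    "\<lbrakk>R' \<ge> 0; \<And>p. p \<in> M \<Longrightarrow> k' * indicator (tube R') p \<le> (cmod (f p))\<^sup>2\<rbrakk> \<Longrightarrow> k' * tube_vol R' \<le> (L2norm vol f)\<^sup>2"
proof -
  have "f \<in> borel_measurable (restrict_space borel M)"
    by (rule borel_measurable_continuous_on_restrict[OF continuous_on_subset[OF f subset_UNIV]])
  then have m: "f \<in> borel_measurable vol" by (simp add: measurable_cong_sets[OF sets_vol refl])
  have i: "integrable vol (\<lambda>p. (cmod (f p))\<^sup>2)"
    by (rule Bochner_Integration.integrable_bound[OF integrable_tube[OF R, of k]])
       (use m k in \<open>auto simp: space_vol intro!: AE_I2 order_trans[OF k]\<close>)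
  show "f \<in> L2 vol" using m i by (simp add: L2_def)
  have sq: "(L2norm vol f)\<^sup>2 = (\<integral>p. (cmod (f p))\<^sup>2 \<partial>vol)" by (simp add: L2norm_def)
  have "(\<integral>p. (cmod (f p))\<^sup>2 \<partial>vol) \<le> (\<integral>p. k * indicator (tube R) p \<partial>vol)"
    by (rule integral_mono[OF i integrable_tube[OF R]]) (use k space_vol in auto)
  then show "(L2norm vol f)\<^sup>2 \<le> k * tube_vol R" by (simp only: sq integral_tube[OF R])
  assume R': "R' \<ge> 0" and k': "\<And>p. p \<in> M \<Longrightarrow> k' * indicator (tube R') p \<le> (cmod (f p))\<^sup>2"
  have "(\<integral>p. k' * indicator (tube R') p \<partial>vol) \<le> (\<integral>p. (cmod (f p))\<^sup>2 \<partial>vol)"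
    by (rule integral_mono[OF integrable_tube[OF R'] i]) (use k' space_vol in auto)
  then show "k' * tube_vol R' \<le> (L2norm vol f)\<^sup>2" by (simp only: sq integral_tube[OF R'])
qed

lemma continuous_bump: "continuous_on UNIV (bump R)"
proof -
  have "continuous_on UNIV (\<lambda>p. 1 - (u1 p)\<^sup>2 / R\<^sup>2)"
    unfolding divide_inverse
    by (intro continuous_on_diff continuous_on_const continuous_on_mult_right continuous_on_power continuous_on_u1)
  then have "continuous_on UNIV (\<lambda>p. flat_exp (1 - (u1 p)\<^sup>2 / R\<^sup>2))"
    by (rule continuous_on_compose2[OF continuous_flat_exp]) auto
  then show ?thesis unfolding bump_def[abs_def] by (rule continuous_on_of_real)
qed

lemma continuous_bump_lap: "continuous_on UNIV (bump_lap R)"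
proof -
  have c: "continuous_on UNIV (\<lambda>p. (u1 p)\<^sup>2)" by (intro continuous_intros continuous_on_u1)
  have a: "continuous_on UNIV (\<lambda>p. 1 - (u1 p)\<^sup>2 / R\<^sup>2)"
    unfolding divide_inverse by (intro continuous_on_diff continuous_on_const continuous_on_mult_right c)
  have 1: "continuous_on UNIV (\<lambda>p. flat_exp1 (1 - (u1 p)\<^sup>2 / R\<^sup>2))"
    by (rule continuous_on_compose2[OF continuous_flat_exp1 a]) auto
  have 2: "continuous_on UNIV (\<lambda>p. flat_exp2 (1 - (u1 p)\<^sup>2 / R\<^sup>2))"
    by (rule continuous_on_compose2[OF continuous_flat_exp2 a]) auto
  have S: "continuous_on UNIV (\<lambda>p. sqrt ((u1 p)\<^sup>2 + t ^ 4))"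
    by (intro continuous_on_real_sqrt continuous_on_add continuous_on_const c)
  have nz: "sqrt ((u1 p)\<^sup>2 + t ^ 4) \<noteq> 0" for p using t4_pos by (smt (verit) real_sqrt_eq_zero_cancel_iff zero_le_power2)
  show ?thesis
    unfolding bump_lap_def[abs_def] lap_profile_def bump_grad_def bump_hess_def divide_inverse
    by (intro continuous_on_of_real continuous_on_add continuous_on_mult continuous_on_const continuous_on_inverse
        c S 1[unfolded divide_inverse] 2[unfolded divide_inverse] ballI nz)
qed

lemma flat_exp_bound:
  obtains C where "C > 0" "\<And>x. x \<le> 1 \<Longrightarrow> \<bar>flat_exp1 x\<bar> \<le> C" "\<And>x. x \<le> 1 \<Longrightarrow> \<bar>flat_exp2 x\<bar> \<le> C"
proof -
  have "bounded (flat_exp1 ` {0..1})" "bounded (flat_exp2 ` {0..1})"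
    by (intro compact_imp_bounded compact_continuous_image continuous_flat_exp1 continuous_flat_exp2 compact_Icc)+
  then obtain C1 C2 where "\<forall>y\<in>flat_exp1 ` {0..1}. \<bar>y\<bar> \<le> C1" "\<forall>y\<in>flat_exp2 ` {0..1}. \<bar>y\<bar> \<le> C2"
    unfolding bounded_real by metis
  then have C: "\<And>x. x \<in> {0..1} \<Longrightarrow> \<bar>flat_exp1 x\<bar> \<le> C1" "\<And>x. x \<in> {0..1} \<Longrightarrow> \<bar>flat_exp2 x\<bar> \<le> C2"
    by simp_all
  have C0: "0 \<le> C1" "0 \<le> C2" using C[of 0] by auto
  \<comment> \<open>One constant for both derivatives. Below 0 they vanish, and the 1 makes the
    constant positive.\<close>
  have "\<bar>flat_exp1 x\<bar> \<le> C1 + C2 + 1" "\<bar>flat_exp2 x\<bar> \<le> C1 + C2 + 1" if "x \<le> 1" for x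
    using C[of x] C0 that flat_exp1_eq_0[of x] flat_exp2_eq_0[of x] by (cases "x \<le> 0"; force)+
  moreover have "C1 + C2 + 1 > 0" using C0 by simp
  ultimately show thesis using that by blast
qed

text \<open>For t^2 \<le> R one has S \<le> 2 R and z / S \<le> R. The first summand then
  contributes 2 C / R and the second 4 * 2 * (2 + 2) C / R, which adds up to 34.\<close>

lemma lap_profile_bound:
  assumes C: "C > 0" "\<And>x. x \<le> 1 \<Longrightarrow> \<bar>flat_exp1 x\<bar> \<le> C" "\<And>x. x \<le> 1 \<Longrightarrow> \<bar>flat_exp2 x\<bar> \<le> C"
    and R: "R > 0" "t\<^sup>2 \<le> R" and z: "0 \<le> z" "z \<le> R\<^sup>2"
  shows "\<bar>lap_profile R z\<bar> \<le> 34 * C / R"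
proof -
  define S where "S = sqrt (z + t ^ 4)"
  have zt: "z + t ^ 4 > 0" using z t4_pos by linarith
  have S0: "S > 0" using zt by (simp add: S_def)
  have "t ^ 4 = (t\<^sup>2)\<^sup>2" by simp
  also have "\<dots> \<le> R\<^sup>2" using R by (intro power_mono) auto
  finally have "z + t ^ 4 \<le> (2 * R)\<^sup>2" using z by (simp add: power_mult_distrib)
  then have S2: "S \<le> 2 * R" unfolding S_def using R by (intro real_le_lsqrt) auto
  have "sqrt z \<le> S" unfolding S_def using t4_pos by (intro real_sqrt_le_mono) simp
  moreover have "sqrt z \<le> R" using z R by (intro real_le_lsqrt) auto
  ultimately have "sqrt z * sqrt z \<le> R * S" using z R by (intro mult_mono) auto
  then have zS: "z / S \<le> R" using z S0 by (simp add: field_simps)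
  have arg: "1 - z / R\<^sup>2 \<le> 1" using z by simp
  have g: "\<bar>bump_grad R z\<bar> \<le> 2 * C / R\<^sup>2"
    using C(2)[OF arg] R by (simp add: bump_grad_def abs_mult divide_right_mono)
  have h: "\<bar>bump_hess R z\<bar> \<le> 2 * C / R ^ 4"
    using C(3)[OF arg] R by (simp add: bump_hess_def abs_mult divide_right_mono)
  have "\<bar>lap_profile R z\<bar> \<le> (z / S) * \<bar>bump_grad R z\<bar> + 4 * S * (z * \<bar>bump_hess R z\<bar> + \<bar>bump_grad R z\<bar>)"
  proof -
    have "lap_profile R z = (z / S) * bump_grad R z + 4 * S * (z * bump_hess R z + bump_grad R z)"
      by (simp add: lap_profile_def S_def)
    then have "\<bar>lap_profile R z\<bar> \<le> \<bar>(z / S) * bump_grad R z\<bar> + \<bar>4 * S * (z * bump_hess R z + bump_grad R z)\<bar>"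
      by (simp only: abs_triangle_ineq)
    also have "\<bar>(z / S) * bump_grad R z\<bar> = (z / S) * \<bar>bump_grad R z\<bar>" using z S0 by (simp add: abs_mult)
    also have "\<bar>4 * S * (z * bump_hess R z + bump_grad R z)\<bar> = 4 * S * \<bar>z * bump_hess R z + bump_grad R z\<bar>"
      using S0 by (simp add: abs_mult)
    also have "\<bar>z * bump_hess R z + bump_grad R z\<bar> \<le> z * \<bar>bump_hess R z\<bar> + \<bar>bump_grad R z\<bar>"
      using abs_triangle_ineq[of "z * bump_hess R z" "bump_grad R z"] z by (simp add: abs_mult)
    finally show ?thesis using S0 by (simp add: mult_left_mono)
  qed
  also have "\<dots> \<le> R * (2 * C / R\<^sup>2) + 4 * (2 * R) * (R\<^sup>2 * (2 * C / R ^ 4) + 2 * C / R\<^sup>2)"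
    using zS S2 z S0 R C(1) g h by (intro add_mono mult_mono) auto
  also have "\<dots> = 34 * C / R"
    using R by (simp add: field_simps power2_eq_square power4_eq_xxxx)
  finally show ?thesis .
qed

lemma lap_profile_eq_0:
  assumes "R > 0" "z \<ge> R\<^sup>2"
  shows "lap_profile R z = 0"
proof -
  have "1 - z / R\<^sup>2 \<le> 0" using assms by (simp add: field_simps)
  then show ?thesis
    by (simp add: lap_profile_def bump_grad_def bump_hess_def flat_exp1_eq_0 flat_exp2_eq_0)
qed

lemma u1_nonneg: "u1 p \<ge> 0"
proof -
  obtain v where "v \<in> homog" "abs_H2 v = p" by (rule abs_H2_surj)
  then show ?thesis using u1_abs_H2[of v] by (auto simp: eh_n_def)
qed

lemma bump_in_laplacian:
  assumes R: "R > 0"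
  shows "(bump R, bump_lap R) \<in> laplacian M (eh_hypersurface t M)"
proof -
  have chart: "\<exists>\<Psi>. \<psi> = abs_H2 \<circ> \<Psi> \<and> G = induced_metric t \<Psi> \<and> local_param M U \<Psi>"
    if "(U, \<psi>, G) \<in> eh_hypersurface t M" for U \<psi> G
    using that unfolding eh_hypersurface_def by blast
  have "smooth_on U (bump R \<circ> \<psi>)" if a: "(U, \<psi>, G) \<in> eh_hypersurface t M" for U \<psi> G
  proof -
    obtain \<Psi> where \<Psi>: "\<psi> = abs_H2 \<circ> \<Psi>" "local_param M U \<Psi>" using chart[OF a] by blast
    show ?thesis unfolding \<Psi>(1) by (rule smooth_bump[OF local_paramD(1,2,3)[OF \<Psi>(2)]])
  qed
  then have "smooth_fun (eh_hypersurface t M) (bump R)"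
    unfolding smooth_fun_def by blast
  \<comment> \<open>The support lies in the image of a compact set, because the curve is closed and
    the bump vanishes for u_1 \<ge> R.\<close>
  moreover have "compact (\<phi> ` closed_solid R)"
    by (intro compact_continuous_image continuous_\<phi> compact_closed_solid)
  moreover have "\<phi> ` closed_solid R \<subseteq> M" using \<Phi>_in_M by blast
  moreover have "bump R p = 0" if p: "p \<in> M - \<phi> ` closed_solid R" for p
  proof -
    obtain y where y: "y \<in> FD" "p = \<phi> y" using p M_eq[of 0] by (auto simp: FD_def)
    then have "rad2 y > R\<^sup>2" using p by (force simp: closed_solid_def FD_def)
    then have "1 - rad2 y / R\<^sup>2 \<le> 0" using R by (simp add: field_simps)
    then show ?thesis unfolding y(2) bump_\<Phi> by (simp add: flat_exp_eq_0)
  qed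
  ultimately have "test_fun M (eh_hypersurface t M) (bump R)"
    unfolding test_fun_def by blast
  moreover have "bump_lap R (\<psi> x) = - div_coord G (grad_coord G (bump R \<circ> \<psi>)) x"
    if a: "(U, \<psi>, G) \<in> eh_hypersurface t M" and x: "x \<in> U" for U \<psi> G x
  proof -
    obtain \<Psi> where \<Psi>: "\<psi> = abs_H2 \<circ> \<Psi>" "G = induced_metric t \<Psi>" "local_param M U \<Psi>" using chart[OF a] by blast
    show ?thesis unfolding \<Psi>(1,2) using laplacian_bump[OF \<Psi>(3) x, of R] R by simp
  qed
  ultimately show ?thesis unfolding laplacian_def by blast
qed

lemma bump_norms:
  assumes C: "C > 0" "\<And>x. x \<le> 1 \<Longrightarrow> \<bar>flat_exp1 x\<bar> \<le> C" "\<And>x. x \<le> 1 \<Longrightarrow> \<bar>flat_exp2 x\<bar> \<le> C"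
    and R: "R > 0" "t\<^sup>2 \<le> R"
  shows "bump R \<in> L2 vol" "bump_lap R \<in> L2 vol"
    "(flat_exp (3/4))\<^sup>2 * tube_vol (R / 2) \<le> (L2norm vol (bump R))\<^sup>2"
    "(L2norm vol (bump_lap R))\<^sup>2 \<le> (34 * C / R)\<^sup>2 * tube_vol R"
proof -
  have u2: "u1 p \<le> R \<longleftrightarrow> (u1 p)\<^sup>2 \<le> R\<^sup>2" if "R > 0" for p R
    using u1_nonneg[of p] that by (simp add: abs_le_square_iff[symmetric])
  have b: "(cmod (bump R p))\<^sup>2 \<le> (flat_exp 1)\<^sup>2 * indicator (tube R) p" if "p \<in> M" for p
  proof (cases "p \<in> tube R")
    case True
    then show ?thesis using flat_exp_mono[of "1 - (u1 p)\<^sup>2 / R\<^sup>2" 1] flat_exp_nonneg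
      by (simp add: bump_def power_mono)
  next
    case False
    then have "1 - (u1 p)\<^sup>2 / R\<^sup>2 \<le> 0" using u2[OF R(1), of p] R \<open>p \<in> M\<close> by (simp add: tube_def field_simps)
    then show ?thesis by (simp add: bump_def flat_exp_eq_0)
  qed
  have b': "(flat_exp (3/4))\<^sup>2 * indicator (tube (R / 2)) p \<le> (cmod (bump R p))\<^sup>2" if "p \<in> M" for p
  proof (cases "p \<in> tube (R / 2)")
    case True
    then have "(u1 p)\<^sup>2 \<le> (R / 2)\<^sup>2" using u2[of "R / 2" p] R by (simp add: tube_def)
    \<comment> \<open>On the inner tube u_1 \<le> R/2 the argument of the bump is at least 1 - 1/4,
      which bounds it below independently of R.\<close>
    then have "3/4 \<le> 1 - (u1 p)\<^sup>2 / R\<^sup>2" using R by (simp add: field_simps)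
    then show ?thesis using True flat_exp_mono flat_exp_nonneg by (simp add: bump_def power_mono)
  qed simp
  have l: "(cmod (bump_lap R p))\<^sup>2 \<le> (34 * C / R)\<^sup>2 * indicator (tube R) p" if "p \<in> M" for p
  proof (cases "p \<in> tube R")
    case True
    then have "\<bar>lap_profile R ((u1 p)\<^sup>2)\<bar> \<le> 34 * C / R"
      using u2[OF R(1), of p] by (intro lap_profile_bound C R) (auto simp: tube_def)
    then have "\<bar>lap_profile R ((u1 p)\<^sup>2)\<bar>\<^sup>2 \<le> (34 * C / R)\<^sup>2" by (intro power_mono) auto
    then show ?thesis using True by (simp add: bump_lap_def)
  next
    case False
    then have "(u1 p)\<^sup>2 \<ge> R\<^sup>2" using u2[OF R(1), of p] \<open>p \<in> M\<close> by (simp add: tube_def)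
    then show ?thesis using lap_profile_eq_0[OF R(1)] by (simp add: bump_lap_def)
  qed
  have R0: "R \<ge> 0" "R / 2 \<ge> 0" using R by auto
  show "bump R \<in> L2 vol" by (rule L2_bounds(1)[OF continuous_bump R0(1) b])
  show "bump_lap R \<in> L2 vol" by (rule L2_bounds(1)[OF continuous_bump_lap R0(1) l])
  show "(flat_exp (3/4))\<^sup>2 * tube_vol (R / 2) \<le> (L2norm vol (bump R))\<^sup>2"
    by (rule L2_bounds(3)[OF continuous_bump R0(1) b R0(2) b'])
  show "(L2norm vol (bump_lap R))\<^sup>2 \<le> (34 * C / R)\<^sup>2 * tube_vol R"
    by (rule L2_bounds(2)[OF continuous_bump_lap R0(1) l])
qed

section \<open>Zero in the spectrum\<close>

lemma L2_closure_superset: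
  assumes "(f, g) \<in> T" "f \<in> L2 \<nu>" "g \<in> L2 \<nu>"
  shows "(f, g) \<in> L2_closure \<nu> T"
proof -
  have "\<exists>f' h. (\<forall>n. (f' n, h n) \<in> T \<inter> (L2 \<nu> \<times> L2 \<nu>)) \<and>
       (\<lambda>n::nat. L2norm \<nu> (\<lambda>x. f' n x - f x)) \<longlonglongrightarrow> 0 \<and> (\<lambda>n. L2norm \<nu> (\<lambda>x. h n x - g x)) \<longlonglongrightarrow> 0"
    by (rule exI[of _ "\<lambda>_. f"], rule exI[of _ "\<lambda>_. g"]) (use assms in \<open>simp add: L2norm_def\<close>)
  then show ?thesis using assms by (simp add: L2_closure_def)
qed

text \<open>At z = 0 the estimate of \<open>resolvent_set\<close> would bound the norm of each bump
  by K times the norm of its Laplacian; a single bump of large radius refutes a given K.\<close>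

lemma zero_in_spectrum: "0 \<in> L2_spectrum vol (L2_closure vol (laplacian M (eh_hypersurface t M)))"
proof (rule ccontr)
  let ?T = "L2_closure vol (laplacian M (eh_hypersurface t M))"
  assume "0 \<notin> L2_spectrum vol ?T"
  then have "0 \<in> resolvent_set vol ?T" by (simp add: L2_spectrum_def)
  then have "\<exists>K. \<forall>(u, v)\<in>?T. L2norm vol u \<le> K * L2norm vol (\<lambda>x. v x - 0 * u x)"
    unfolding resolvent_set_def by blast
  then obtain K where K: "\<forall>(u, v)\<in>?T. L2norm vol u \<le> K * L2norm vol (\<lambda>x. v x - 0 * u x)" by blast
  obtain C where C: "C > 0" "\<And>x. x \<le> 1 \<Longrightarrow> \<bar>flat_exp1 x\<bar> \<le> C" "\<And>x. x \<le> 1 \<Longrightarrow> \<bar>flat_exp2 x\<bar> \<le> C"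
    using flat_exp_bound by metis
  define m where "m = flat_exp (3/4)"
  have m: "m > 0" by (simp add: m_def flat_exp_pos)
  \<comment> \<open>68 is 34 times the square root of the doubling constant 4. The term t^2 serves
    the bound on the profile, and the 1 makes the last inequality strict. The modulus is taken
    because K may be negative.\<close>
  define R where "R = t\<^sup>2 + 1 + 68 * C * \<bar>K\<bar> / m"
  have R: "R > 0" "t\<^sup>2 \<le> R" "68 * C * \<bar>K\<bar> / m < R"
  proof -
    have "68 * C * \<bar>K\<bar> / m \<ge> 0" using C(1) m by simp
    then show "R > 0" "t\<^sup>2 \<le> R" "68 * C * \<bar>K\<bar> / m < R"
      unfolding R_def using zero_le_power2[of t] by linarith+
  qed
  note N = bump_norms[OF C R(1,2)]
  have "(bump R, bump_lap R) \<in> ?T"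
    by (rule L2_closure_superset[OF bump_in_laplacian[OF R(1)] N(1,2)])
  from bspec[OF K this] have "L2norm vol (bump R) \<le> K * L2norm vol (bump_lap R)" by simp
  then have "(L2norm vol (bump R))\<^sup>2 \<le> (K * L2norm vol (bump_lap R))\<^sup>2"
    by (intro power_mono) (simp_all add: L2norm_def)
  then have "m\<^sup>2 * tube_vol (R / 2) \<le> K\<^sup>2 * ((34 * C / R)\<^sup>2 * tube_vol R)"
    using N(3,4) mult_left_mono[OF N(4), of "K\<^sup>2"] by (simp add: m_def power_mult_distrib)
  also have "\<dots> \<le> K\<^sup>2 * ((34 * C / R)\<^sup>2 * (4 * tube_vol (R / 2)))"
    using R by (intro mult_left_mono tube_vol_doubling) auto
  also have "\<dots> = (68 * C * \<bar>K\<bar> / R)\<^sup>2 * tube_vol (R / 2)" by (simp add: power2_eq_square)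
  \<comment> \<open>The volume of the inner tube cancels because it is positive.\<close>
  finally have "m\<^sup>2 \<le> (68 * C * \<bar>K\<bar> / R)\<^sup>2" using tube_vol_pos[of "R / 2"] R by simp
  then have "m \<le> 68 * C * \<bar>K\<bar> / R" by (rule power2_le_imp_le) (use C R in auto)
  then show False using R m by (simp add: field_simps)
qed

lemma mu0_le_0: "mu0 M (eh_hypersurface t M) \<le> 0"
  unfolding mu0_def Let_def riemannian_volume_eq
  by (rule INF_lower2[of 0]) (use zero_in_spectrum in auto)

end

theorem corollary5:
  fixes \<Gamma> :: "complex set" and t :: real and A :: "complex^2^2"
  assumes "smooth_closed_curve \<Gamma>" and "t \<noteq> 0" and "A \<in> U2"
  shows "let M = M3 (moebius_map A ` Fin ` \<Gamma>) in
    mu0 M (eh_hypersurface t M) \<le> ereal (t powi (- 2))"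
proof -
  obtain c :: "real \<Rightarrow> complex" and l where c: "l > 0" "smooth_on UNIV c" "\<And>s. c (s + l) = c s" "inj_on c {0..<l}"
     "\<And>s. vector_derivative c (at s) \<noteq> 0" "\<Gamma> = range c"
    using assms(1) unfolding smooth_closed_curve_def by blast
  interpret closed_curve c l by unfold_locales (use c in auto)
  obtain \<mu> where \<mu>: "smooth_on UNIV \<mu>" "\<And>s. (cmod (\<mu> s))\<^sup>2 * (1 + (cmod (c s))\<^sup>2) = 1"
    "\<And>s. vector_derivative (frame A c \<mu> 1) (at s) * cnj (frame A c \<mu> 1 s) +
         vector_derivative (frame A c \<mu> 2) (at s) * cnj (frame A c \<mu> 2 s) = 0"
    using horizontal_lift[OF assms(3)] by metis
  interpret lifted_curve c l A \<mu> t by unfold_locales (use assms \<mu> in auto)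
  have "mu0 M (eh_hypersurface t M) \<le> ereal (t powi (- 2))"
    by (rule order_trans[OF mu0_le_0]) (simp add: power_int_minus)
  then show ?thesis by (simp add: M_def c(6) Let_def)
qed

end
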